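(* Let $\bm{z}_1,\dots,\bm{z}_n\in\mathbb{R}^d$ arrive one at a time in a stream, and for $S\subseteq[n]$ write $Z|_S=\mathrm{conv}\{\bm{z}_i:i\in S\}$. There exists a streaming algorithm that, for every timestep $t$, maintains a subset $S_t\subseteq[n]$, a center $\bm{c}_t\in\mathbb{R}^d$ and a scaling factor $\alpha_t\in(0,1]$ such that \[Z|_{S_t}\subseteq \mathrm{conv}\{\bm{z}_1,\dots,\bm{z}_t\}\subseteq \bm{c}_t+\frac{1}{\alpha_t}\cdot\big(Z|_{S_t}-\bm{c}_t\big).\] Moreover, letting $d_t=\dim(\mathrm{aff}\{\bm{z}_1,\dots,\bm{z}_t\})$ and letting $r_t$ and $R_t$ be the largest and smallest parameters, respectively, for which there exists $\bm{c}^\star_t$ with \[\bm{c}^\star_t+r_t\cdot\big(B_2^d\cap \mathrm{span}\{\bm{z}_1-\bm{c}^\star_t,\dots,\bm{z}_t-\bm{c}^\star_t\}\big)\subseteq \mathrm{conv}\{\bm{z}_1,\dots,\bm{z}_t\}\subseteq \bm{c}^\star_t+R_t\cdot B_2^d,\] we have for all $t$ \[\frac{1}{\alpha_t}=O\!\left(d_t\log\!\left(d_t\cdot\max_{t'\le t}\frac{R_t}{r_{t'}}\right)\right)\quad\text{and}\quad |S_t|=O\!\left(d_t\log\!\left(\max_{t'\le t}\frac{R_t}{r_{t'}}\right)\right),\] and, if all the $\bm{z}_i$ have integer coordinates in $[-N,N]$, then \[\frac{1}{\alpha_t}=O\big(d_t\log(dN)\big)\quad\text{and}\quad |S_t|=O\big(d_t\log(dN)\big).\]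 Each $S_t$ is either $S_{t-1}$ or $S_{t-1}\cup\{t\}$ (for $t\ge1$, with $S_0=\varnothing$). The algorithm runs in time $\widetilde{O}(nd^2)$ and stores at most $O(d^2)$ floating point numbers.
   Context: $B_2^d$ is the Euclidean unit ball; $\mathrm{span}$ denotes linear span and $\mathrm{aff}$ affine span. In the streaming model the algorithm receives the points one at a time and updates its output after each point, without knowing $n$ in advance. $O(\cdot)$ hides absolute constants; $\widetilde{O}$ also hides logarithmic factors.
   Formalization: Each bound O(f) on 1/α_t and |S_t| is read as O(max(1, f)), since f can be 0 or undefined (e.g. two points: d_t = 1, R_t = r_t, or d = N = 1); when z_1,…,z_{t'} coincide, r_{t'} is infinite and R_t/r_{t'} counts as 0. *)

theory Defs
  imports "HOL-Analysis.Analysis" "HOL-Analysis.Finite_Function_Topology"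
begin

section \<open>Euclidean space of varying dimension\<close>

text \<open>
  The algorithm and all hidden constants have to be chosen before the dimension, so the dimension
  cannot be a type. Points are finitely supported sequences, and the space of dimension \<open>d\<close> is the
  subspace of those supported on the coordinates below \<open>d\<close>. The linear structure (and with it
  \<open>span\<close>, \<open>dim\<close>, \<open>affine hull\<close>, \<open>convex hull\<close>) is the library's. The library norm on this type is the
  \<open>\<ell>\<^sub>1\<close> norm and is not used: the Euclidean norm is \<^const>\<open>L2_set\<close>.
\<close>

type_synonym point = "nat \<Rightarrow>\<^sub>0 real"

definition Rd :: "nat \<Rightarrow> point set" where
  "Rd d = {x. Poly_Mapping.keys x \<subseteq> {..<d}}"

definition unit_ball :: "nat \<Rightarrow> point set" where
  "unit_ball d = {x \<in> Rd d. L2_set (Poly_Mapping.lookup x) {..<d} \<le> 1}"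

definition point_of :: "nat \<Rightarrow> (nat \<Rightarrow> real) \<Rightarrow> point" where
  "point_of d f = (\<Sum>j<d. Poly_Mapping.single j (f j))"

definition dilate :: "point \<Rightarrow> real \<Rightarrow> point set \<Rightarrow> point set" where
  "dilate c a A = (\<lambda>x. c + a *\<^sub>R (x - c)) ` A"

text \<open>Dimension of an affine hull, as that of its direction space (the library's \<open>aff_dim\<close> is
  restricted to Euclidean types).\<close>

definition affine_dim :: "point set \<Rightarrow> nat" where
  "affine_dim X = dim {x - y |x y. x \<in> affine hull X \<and> y \<in> affine hull X}"

definition sandwiched :: "nat \<Rightarrow> point set \<Rightarrow> point \<Rightarrow> real \<Rightarrow> real \<Rightarrow> bool" where
  "sandwiched d X c r R \<longleftrightarrow> c \<in> Rd d \<and> 0 \<le> r \<and> 0 \<le> R \<and>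
     (\<lambda>u. c + r *\<^sub>R u) ` (unit_ball d \<inter> span ((\<lambda>x. x - c) ` X)) \<subseteq> convex hull X \<and>
     convex hull X \<subseteq> (\<lambda>u. c + R *\<^sub>R u) ` unit_ball d"

text \<open>The extended reals are needed because \<open>r\<close> is unbounded when \<open>X\<close> is a single point.\<close>

definition inner_radius :: "nat \<Rightarrow> point set \<Rightarrow> ereal" where
  "inner_radius d X = Sup {ereal r |r. \<exists>c R. sandwiched d X c r R}"

definition outer_radius :: "nat \<Rightarrow> point set \<Rightarrow> ereal" where
  "outer_radius d X = Inf {ereal R |R. \<exists>c r. sandwiched d X c r R}"

text \<open>A prefix consisting of copies of one point has \<open>inner_radius = \<infinity>\<close> and contributes \<open>0\<close>
  to the maximum.\<close>

definition aspect_ratio :: "nat \<Rightarrow> (nat \<Rightarrow> point) \<Rightarrow> nat \<Rightarrow> real" where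
  "aspect_ratio d z t =
     real_of_ereal (Max ((\<lambda>t'. outer_radius d (z ` {1..t}) / inner_radius d (z ` {1..t'})) ` {1..t}))"


section \<open>Streaming algorithms on a real RAM\<close>

text \<open>
  A program has finitely many index registers (natural numbers), an array of real cells addressed
  by index expressions, and an index set that it maintains as its output and cannot read. It is run
  once per arriving point, whose coordinates it can read. It also knows the dimension, but not the
  length of the stream. Real constants are integers, so that a program cannot hide information
  in them, and there is no conversion from reals to indices.
\<close>

datatype iexp =
    INum nat
  | IReg nat
  | IDim
  | IAdd iexp iexp
  | ISub iexp iexp
  | IMul iexp iexp

datatype rexp =
    RNum int
  | RIndex iexp
  | RCell iexp
  | RInput iexp
  | RAdd rexp rexp
  | RSub rexp rexp
  | RMul rexp rexp
  | RDiv rexp rexp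
  | RSqrt rexp
  | RExp rexp
  | RLn rexp

datatype bexp =
    ILess iexp iexp
  | RLess rexp rexp
  | BNot bexp
  | BAnd bexp bexp

datatype com =
    Skip
  | SetReg nat iexp
  | SetCell iexp rexp
  | Insert_Index iexp
  | Remove_Index iexp
  | Seq com com
  | Cond bexp com com
  | Loop bexp com

record state =
  reg :: "nat \<Rightarrow> nat"
  cell :: "nat \<Rightarrow> real"
  selected :: "nat set"

definition initial_state :: state where
  "initial_state = \<lparr>reg = (\<lambda>_. 0), cell = (\<lambda>_. 0), selected = {}\<rparr>"

primrec ival :: "nat \<Rightarrow> state \<Rightarrow> iexp \<Rightarrow> nat" where
  "ival d s (INum k) = k"
| "ival d s (IReg v) = reg s v"
| "ival d s IDim = d"
| "ival d s (IAdd a b) = ival d s a + ival d s b"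
| "ival d s (ISub a b) = ival d s a - ival d s b"
| "ival d s (IMul a b) = ival d s a * ival d s b"

primrec rval :: "nat \<Rightarrow> point \<Rightarrow> state \<Rightarrow> rexp \<Rightarrow> real" where
  "rval d x s (RNum k) = of_int k"
| "rval d x s (RIndex i) = real (ival d s i)"
| "rval d x s (RCell i) = cell s (ival d s i)"
| "rval d x s (RInput i) = Poly_Mapping.lookup x (ival d s i)"
| "rval d x s (RAdd a b) = rval d x s a + rval d x s b"
| "rval d x s (RSub a b) = rval d x s a - rval d x s b"
| "rval d x s (RMul a b) = rval d x s a * rval d x s b"
| "rval d x s (RDiv a b) = rval d x s a / rval d x s b"
| "rval d x s (RSqrt a) = sqrt (rval d x s a)"
| "rval d x s (RExp a) = exp (rval d x s a)"
| "rval d x s (RLn a) = ln (rval d x s a)"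

primrec bval :: "nat \<Rightarrow> point \<Rightarrow> state \<Rightarrow> bexp \<Rightarrow> bool" where
  "bval d x s (ILess a b) \<longleftrightarrow> ival d s a < ival d s b"
| "bval d x s (RLess a b) \<longleftrightarrow> rval d x s a < rval d x s b"
| "bval d x s (BNot p) \<longleftrightarrow> \<not> bval d x s p"
| "bval d x s (BAnd p q) \<longleftrightarrow> bval d x s p \<and> bval d x s q"

text \<open>Running time: every operation and every access has cost one.\<close>

primrec icost :: "iexp \<Rightarrow> nat" where
  "icost (INum k) = 1"
| "icost (IReg v) = 1"
| "icost IDim = 1"
| "icost (IAdd a b) = icost a + icost b + 1"
| "icost (ISub a b) = icost a + icost b + 1"
| "icost (IMul a b) = icost a + icost b + 1"

primrec rcost :: "rexp \<Rightarrow> nat" where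
  "rcost (RNum k) = 1"
| "rcost (RIndex i) = icost i + 1"
| "rcost (RCell i) = icost i + 1"
| "rcost (RInput i) = icost i + 1"
| "rcost (RAdd a b) = rcost a + rcost b + 1"
| "rcost (RSub a b) = rcost a + rcost b + 1"
| "rcost (RMul a b) = rcost a + rcost b + 1"
| "rcost (RDiv a b) = rcost a + rcost b + 1"
| "rcost (RSqrt a) = rcost a + 1"
| "rcost (RExp a) = rcost a + 1"
| "rcost (RLn a) = rcost a + 1"

primrec bcost :: "bexp \<Rightarrow> nat" where
  "bcost (ILess a b) = icost a + icost b + 1"
| "bcost (RLess a b) = rcost a + rcost b + 1"
| "bcost (BNot p) = bcost p + 1"
| "bcost (BAnd p q) = bcost p + bcost q + 1"

text \<open>Addresses of the real cells read by an expression.\<close>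

primrec raddr :: "nat \<Rightarrow> state \<Rightarrow> rexp \<Rightarrow> nat set" where
  "raddr d s (RNum k) = {}"
| "raddr d s (RIndex i) = {}"
| "raddr d s (RCell i) = {ival d s i}"
| "raddr d s (RInput i) = {}"
| "raddr d s (RAdd a b) = raddr d s a \<union> raddr d s b"
| "raddr d s (RSub a b) = raddr d s a \<union> raddr d s b"
| "raddr d s (RMul a b) = raddr d s a \<union> raddr d s b"
| "raddr d s (RDiv a b) = raddr d s a \<union> raddr d s b"
| "raddr d s (RSqrt a) = raddr d s a"
| "raddr d s (RExp a) = raddr d s a"
| "raddr d s (RLn a) = raddr d s a"

primrec baddr :: "nat \<Rightarrow> state \<Rightarrow> bexp \<Rightarrow> nat set" where
  "baddr d s (ILess a b) = {}"
| "baddr d s (RLess a b) = raddr d s a \<union> raddr d s b"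
| "baddr d s (BNot p) = baddr d s p"
| "baddr d s (BAnd p q) = baddr d s p \<union> baddr d s q"

text \<open>
  \<open>exec d x M W c s k s'\<close>: on input point \<open>x\<close>, the command \<open>c\<close> leads from \<open>s\<close> to \<open>s'\<close> in time \<open>k\<close>,
  using only the real cells with address below \<open>M\<close> and storing only values up to \<open>W\<close> in index
  registers. Executions that exceed \<open>M\<close> or \<open>W\<close> get stuck; the bounds have no other effect.
\<close>

inductive exec :: "nat \<Rightarrow> point \<Rightarrow> nat \<Rightarrow> nat \<Rightarrow> com \<Rightarrow> state \<Rightarrow> nat \<Rightarrow> state \<Rightarrow> bool"
  for d x M W where
  Skip: "exec d x M W Skip s 1 s"
| SetReg: "ival d s e \<le> W \<Longrightarrow>
    exec d x M W (SetReg v e) s (icost e + 1) (s\<lparr>reg := (reg s)(v := ival d s e)\<rparr>)"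
| SetCell: "ival d s a < M \<Longrightarrow> raddr d s e \<subseteq> {..<M} \<Longrightarrow>
    exec d x M W (SetCell a e) s (icost a + rcost e + 1)
      (s\<lparr>cell := (cell s)(ival d s a := rval d x s e)\<rparr>)"
| Insert_Index: "exec d x M W (Insert_Index e) s (icost e + 1)
    (s\<lparr>selected := insert (ival d s e) (selected s)\<rparr>)"
| Remove_Index: "exec d x M W (Remove_Index e) s (icost e + 1)
    (s\<lparr>selected := selected s - {ival d s e}\<rparr>)"
| Seq: "exec d x M W c1 s k1 s1 \<Longrightarrow> exec d x M W c2 s1 k2 s2 \<Longrightarrow>
    exec d x M W (Seq c1 c2) s (k1 + k2) s2"
| Cond_True: "baddr d s b \<subseteq> {..<M} \<Longrightarrow> bval d x s b \<Longrightarrow> exec d x M W c1 s k s' \<Longrightarrow>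
    exec d x M W (Cond b c1 c2) s (bcost b + k) s'"
| Cond_False: "baddr d s b \<subseteq> {..<M} \<Longrightarrow> \<not> bval d x s b \<Longrightarrow> exec d x M W c2 s k s' \<Longrightarrow>
    exec d x M W (Cond b c1 c2) s (bcost b + k) s'"
| Loop_False: "baddr d s b \<subseteq> {..<M} \<Longrightarrow> \<not> bval d x s b \<Longrightarrow>
    exec d x M W (Loop b c) s (bcost b) s"
| Loop_True: "baddr d s b \<subseteq> {..<M} \<Longrightarrow> bval d x s b \<Longrightarrow> exec d x M W c s k1 s1 \<Longrightarrow>
    exec d x M W (Loop b c) s1 k2 s2 \<Longrightarrow> exec d x M W (Loop b c) s (bcost b + k1 + k2) s2"

text \<open>\<open>\<sigma> t\<close> is the state after the first \<open>t\<close> points, and \<open>\<tau> t\<close> the time spent on the \<open>t\<close>-th point.\<close>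

definition stream_run ::
  "com \<Rightarrow> nat \<Rightarrow> (nat \<Rightarrow> point) \<Rightarrow> nat \<Rightarrow> nat \<Rightarrow> nat \<Rightarrow> (nat \<Rightarrow> state) \<Rightarrow> (nat \<Rightarrow> nat) \<Rightarrow> bool" where
  "stream_run P d z n M W \<sigma> \<tau> \<longleftrightarrow>
     \<sigma> 0 = initial_state \<and> (\<forall>t\<in>{1..n}. exec d (z t) M W P (\<sigma> (t - 1)) (\<tau> t) (\<sigma> t))"

text \<open>Output convention: cell \<open>0\<close> holds the scaling factor, cells \<open>1, \<dots>, d\<close> the center.\<close>

definition scaling :: "state \<Rightarrow> real" where
  "scaling s = cell s 0"

definition center :: "nat \<Rightarrow> state \<Rightarrow> point" where
  "center d s = point_of d (\<lambda>j. cell s (Suc j))"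

text \<open>Runs are determined by the program and the points seen so far; in particular they do not
  depend on the length of the stream or on the resource bounds.\<close>

inductive_cases exec_SkipE: "exec d x M W Skip s k s'"
inductive_cases exec_SetRegE: "exec d x M W (SetReg v e) s k s'"
inductive_cases exec_SetCellE: "exec d x M W (SetCell a e) s k s'"
inductive_cases exec_InsertE: "exec d x M W (Insert_Index e) s k s'"
inductive_cases exec_RemoveE: "exec d x M W (Remove_Index e) s k s'"
inductive_cases exec_SeqE: "exec d x M W (Seq c1 c2) s k s'"
inductive_cases exec_CondE: "exec d x M W (Cond b c1 c2) s k s'"
inductive_cases exec_LoopE: "exec d x M W (Loop b c) s k s'"

lemma exec_deterministic:
  "exec d x M W c s k s' \<Longrightarrow> exec d x M' W' c s k' s'' \<Longrightarrow> k' = k \<and> s'' = s'"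
proof (induction arbitrary: k' s'' rule: exec.induct)
  case Skip
  then show ?case by (rule exec_SkipE) simp
next
  case SetReg
  from SetReg.prems show ?case by (rule exec_SetRegE) simp
next
  case SetCell
  from SetCell.prems show ?case by (rule exec_SetCellE) simp
next
  case Insert_Index
  from Insert_Index.prems show ?case by (rule exec_InsertE) simp
next
  case Remove_Index
  from Remove_Index.prems show ?case by (rule exec_RemoveE) simp
next
  case Seq
  from Seq.prems show ?case by (rule exec_SeqE) (use Seq.IH in blast)
next
  case Cond_True
  from Cond_True.prems show ?case by (rule exec_CondE) (use Cond_True.IH Cond_True.hyps in blast)+
next
  case Cond_False
  from Cond_False.prems show ?case by (rule exec_CondE) (use Cond_False.IH Cond_False.hyps in blast)+
next
  case Loop_False
  from Loop_False.prems show ?case by (rule exec_LoopE) (use Loop_False.hyps in blast)+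
next
  case Loop_True
  from Loop_True.prems show ?case by (rule exec_LoopE) (use Loop_True.IH Loop_True.hyps in blast)+
qed

lemma stream_run_deterministic:
  assumes "stream_run P d z n M W \<sigma> \<tau>" "stream_run P d z' n' M' W' \<sigma>' \<tau>'"
    and "t \<le> n" "t \<le> n'" "\<forall>i\<in>{1..t}. z i = z' i"
  shows "\<sigma>' t = \<sigma> t"
  using assms(3-)
proof (induction t)
  case 0
  then show ?case using assms(1,2) by (simp add: stream_run_def)
next
  case (Suc t)
  have r: "exec d (z (Suc t)) M W P (\<sigma> t) (\<tau> (Suc t)) (\<sigma> (Suc t))"
    using assms(1) Suc.prems(1) by (auto simp: stream_run_def dest: bspec[where x = "Suc t"])
  have r': "exec d (z' (Suc t)) M' W' P (\<sigma>' t) (\<tau>' (Suc t)) (\<sigma>' (Suc t))"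
    using assms(2) Suc.prems(2) by (auto simp: stream_run_def dest: bspec[where x = "Suc t"])
  have "z' (Suc t) = z (Suc t)" "\<sigma>' t = \<sigma> t"
    using Suc by simp_all
  with r r' show ?case using exec_deterministic by metis
qed

end

theory Submission
  imports Defs "Jordan_Normal_Form.Determinant"
begin

text \<open>
  The algorithm maintains a basis of the whole space consisting of differences \<open>z i - z 1\<close> of selected
  points and of unit vectors, together with the inverse of the basis matrix. A new point is skipped
  if it has coordinate \<open>0\<close> on every unit vector and coordinates of absolute value at most \<open>2\<close> on the
  points. Otherwise it is selected and replaces a unit vector, or else a point on which its
  coordinate exceeds \<open>2\<close>. Selected points are never removed, so every point remains a combination of
  selected differences with coefficients at most \<open>2\<close>. With respect to a center that gives all \<open>m\<close> selected
  points weight of order at least \<open>1 / m\<close>, such combinations lie in the hull of the selected points scaled by \<open>O(m)\<close>.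

  To bound \<open>m\<close>, consider the Gram determinant of the points in the basis. A replacement of a point
  multiplies it by more than \<open>4\<close>, a replacement of a unit vector multiplies it by the squared distance
  of the new point from the preceding span, and by Hadamard's inequality it is at most \<open>(2 R)^(2 k)\<close>
  in dimension \<open>k\<close>. That distance is the height of a pyramid containing the inscribed ball, hence at
  least \<open>2 r\<close>, so there are at most \<open>k log (R / r)\<close> replacements of points. For integer points the
  squared distances multiply to a positive integer Gram determinant.
\<close>

section \<open>Gram determinants\<close>

text \<open>Any threshold above 1 would let every exchange of points raise the volume by a fixed
  factor, while threshold 1 would give no bound on their number; the threshold is also the bound on
  the coefficients, and 2 balances both. The obstacle is that the dimension grows: a new point may
  be arbitrarily close to the old span and so shrink the volume. Hence the basis is compared with a
  reference list, the points that raised the dimension in their order of arrival. Both Gram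
  determinants gain the same factor when the dimension rises, so after \<open>s\<close> exchanges of
  points their quotient is at least \<open>4 ^ s\<close>. The heights of the reference points are
  those at their arrival, which is why the inner radii of all prefixes enter the bound. Filling the
  basis up with unit vectors makes its matrix invertible from the start: every change is a rank-one
  update, and a nonzero coordinate on a unit vector reveals a point outside the span. Finally,
  \<open>m\<close> also counts the \<open>k\<close> points that raised the dimension;
  \<open>k\<close> is absorbed by \<open>k log (R / r)\<close> because the aspect ratio is at least
  3/2 as soon as \<open>k\<close> is at least 2.\<close>

lemma lookup_scaleR [simp]:
  "Poly_Mapping.lookup (a *\<^sub>R x) i = a *\<^sub>R Poly_Mapping.lookup x i"
proof -
  have "finite {i. a *\<^sub>R Poly_Mapping.lookup x i \<noteq> 0}"
    by (rule finite_subset[OF _ finite_keys[of x]]) (auto simp: in_keys_iff)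
  then show ?thesis
    by (simp add: scaleR_poly_mapping_def)
qed

lemma Rd_iff: "x \<in> Rd d \<longleftrightarrow> (\<forall>i\<ge>d. Poly_Mapping.lookup x i = 0)"
  unfolding Rd_def by (auto simp: in_keys_iff subset_iff not_less[symmetric])

lemma subspace_Rd: "subspace (Rd d)"
  by (auto simp: subspace_def Rd_iff lookup_add)

lemmas Rd_add [simp, intro] = subspace_add[OF subspace_Rd]
lemmas Rd_diff [simp, intro] = subspace_diff[OF subspace_Rd]
lemmas Rd_scale [simp, intro] = subspace_scale[OF subspace_Rd]
lemmas Rd_sum [intro] = subspace_sum[OF subspace_Rd]
lemmas Rd_0 [simp, intro] = subspace_0[OF subspace_Rd]

lemma convex_Rd: "convex (Rd d)"
  using subspace_Rd by (rule subspace_imp_convex)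

lemma Rd_eqI:
  assumes "x \<in> Rd d" "y \<in> Rd d"
    and "\<And>i. i < d \<Longrightarrow> Poly_Mapping.lookup x i = Poly_Mapping.lookup y i"
  shows "x = y"
  using assms by (intro poly_mapping_eqI) (metis Rd_iff not_le)

section \<open>Euclidean inner product and orthogonal residuals\<close>

definition ip :: "nat \<Rightarrow> point \<Rightarrow> point \<Rightarrow> real" where
  "ip d x y = (\<Sum>j<d. Poly_Mapping.lookup x j * Poly_Mapping.lookup y j)"

lemma ip_commute: "ip d x y = ip d y x"
  by (simp add: ip_def mult.commute)

lemma ip_add [simp]: "ip d (x + y) w = ip d x w + ip d y w" "ip d w (x + y) = ip d w x + ip d w y"
  by (simp_all add: ip_def lookup_add algebra_simps sum.distrib)

lemma ip_diff [simp]: "ip d (x - y) w = ip d x w - ip d y w" "ip d w (x - y) = ip d w x - ip d w y"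
  by (simp_all add: ip_def lookup_minus algebra_simps sum_subtractf)

lemma ip_scale [simp]: "ip d (a *\<^sub>R x) w = a * ip d x w" "ip d w (a *\<^sub>R x) = a * ip d w x"
  by (simp_all add: ip_def sum_distrib_left algebra_simps)

lemma ip_0 [simp]: "ip d 0 w = 0" "ip d w 0 = 0"
  by (simp_all add: ip_def)

lemma ip_sum: "ip d (\<Sum>i\<in>I. f i) w = (\<Sum>i\<in>I. ip d (f i) w)" "ip d w (\<Sum>i\<in>I. f i) = (\<Sum>i\<in>I. ip d w (f i))"
  by (induction I rule: infinite_finite_induct) simp_all

lemma ip_nonneg [simp]: "0 \<le> ip d x x"
  by (simp add: ip_def sum_nonneg)

lemma ip_eq_0_iff: "x \<in> Rd d \<Longrightarrow> ip d x x = 0 \<longleftrightarrow> x = 0"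
  by (auto simp: ip_def sum_nonneg_eq_0_iff intro: Rd_eqI)

lemma L2_set_eq_ip: "L2_set (Poly_Mapping.lookup x) {..<d} = sqrt (ip d x x)"
  by (simp add: L2_set_def ip_def power2_eq_square)

lemma ip_orthogonal_span:
  assumes "\<And>b. b \<in> B \<Longrightarrow> ip d r b = 0" "x \<in> span B"
  shows "ip d r x = 0"
  using assms(2)
proof (induction rule: span_induct_alt)
  case base
  show ?case by simp
next
  case (step c b y)
  then show ?case using assms(1) by simp
qed

text \<open>Gram-Schmidt: \<open>a\<close> and \<open>x\<close> are first reduced modulo
  \<open>B\<close>, then the component of \<open>x'\<close> along the residual \<open>a'\<close> is
  removed.\<close>

lemma orthogonal_residual_exists:
  assumes "finite B" "B \<subseteq> Rd d" "x \<in> Rd d"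
  shows "\<exists>r\<in>Rd d. x - r \<in> span B \<and> (\<forall>b\<in>B. ip d r b = 0)"
  using assms
proof (induction B arbitrary: x)
  case empty
  then show ?case by (intro bexI[of _ x]) auto
next
  case (insert a B)
  obtain a' where a': "a' \<in> Rd d" "a - a' \<in> span B" "\<forall>b\<in>B. ip d a' b = 0"
    using insert.IH[of a] insert.prems by auto
  obtain x' where x': "x' \<in> Rd d" "x - x' \<in> span B" "\<forall>b\<in>B. ip d x' b = 0"
    using insert.IH[of x] insert.prems by auto
  \<comment> \<open>If \<open>a\<close> lies in the span of \<open>B\<close>, then \<open>a'\<close>
    is 0, and the quotient is 0 by the convention for division, which does no harm.\<close>
  define r where "r = x' - (ip d x' a' / ip d a' a') *\<^sub>R a'"
  have sub: "span B \<subseteq> span (insert a B)"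
    by (intro span_mono) auto
  have a'_span: "a' \<in> span (insert a B)"
    using span_diff[OF span_base[of a "insert a B"] subsetD[OF sub a'(2)]] by simp
  have "x - r \<in> span (insert a B)"
    using span_add[OF subsetD[OF sub x'(2)] span_scale[OF a'_span]]
    by (simp add: r_def algebra_simps)
  moreover have orth: "ip d r b = 0" if "b \<in> B" for b
    using that a'(3) x'(3) by (simp add: r_def)
  moreover have "ip d r a = 0"
  proof -
    have "ip d r (a - a') = 0"
      using orth a'(2) by (rule ip_orthogonal_span)
    moreover have "ip d r a' = 0"
    proof (cases "a' = 0")
      case False
      then have "ip d a' a' \<noteq> 0"
        using a'(1) ip_eq_0_iff by blast
      then show ?thesis by (simp add: r_def)
    qed simp
    ultimately show ?thesis by simp
  qed
  ultimately show ?case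
    using a'(1) x'(1) by (intro bexI[of _ r]) (auto simp: r_def)
qed

section \<open>Gram matrices and their determinants\<close>

definition gram_matrix :: "nat \<Rightarrow> point list \<Rightarrow> real mat" where
  "gram_matrix d bs = mat (length bs) (length bs) (\<lambda>(i, j). ip d (bs ! i) (bs ! j))"

definition gram :: "nat \<Rightarrow> point list \<Rightarrow> real" where
  "gram d bs = Determinant.det (gram_matrix d bs)"

lemma gram_matrix_carrier [simp]: "gram_matrix d bs \<in> carrier_mat (length bs) (length bs)"
  by (simp add: gram_matrix_def)

lemma gram_Nil [simp]: "gram d [] = 1"
  by (simp add: gram_def gram_matrix_def)

text \<open>With the coefficients as rows of \<open>C\<close>, bilinearity makes the Gram matrix of
  \<open>xs\<close> the product of \<open>C\<close>, the Gram matrix of \<open>ys\<close> and the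
  transpose of \<open>C\<close>.\<close>

lemma gram_linear_image:
  assumes "length xs = n" "length ys = n" "C \<in> carrier_mat n n"
    and lin: "\<And>i. i < n \<Longrightarrow> xs ! i = (\<Sum>j<n. C $$ (i, j) *\<^sub>R ys ! j)"
  shows "gram d xs = (Determinant.det C)\<^sup>2 * gram d ys"
proof -
  let ?G = "gram_matrix d ys"
  have G: "?G \<in> carrier_mat n n"
    using gram_matrix_carrier[of d ys] assms(2) by simp
  have "gram_matrix d xs = C * ?G * transpose_mat C" (is "_ = ?R")
  proof (rule eq_matI)
    fix i j assume "i < dim_row ?R" "j < dim_col ?R"
    then have ij: "i < n" "j < n"
      using assms by auto
    have "?R $$ (i, j) = (\<Sum>l<n. (\<Sum>k<n. C $$ (i, k) * ip d (ys ! k) (ys ! l)) * C $$ (j, l))"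
      using assms(1-3) ij by (simp add: scalar_prod_def gram_matrix_def lessThan_atLeast0)
    also have "\<dots> = ip d (xs ! i) (xs ! j)"
      using ij by (simp add: lin ip_sum sum_distrib_left sum_distrib_right mult_ac)
    finally show "gram_matrix d xs $$ (i, j) = ?R $$ (i, j)"
      using assms(1) ij by (simp add: gram_matrix_def)
  qed (use assms in \<open>auto simp: gram_matrix_def\<close>)
  then have "gram d xs = Determinant.det (C * ?G * transpose_mat C)"
    by (simp add: gram_def)
  also have "\<dots> = Determinant.det C * Determinant.det ?G * Determinant.det (transpose_mat C)"
    using assms(3) G by (subst det_mult[of _ n], simp, simp, subst det_mult[of _ n]) auto
  also have "\<dots> = (Determinant.det C)\<^sup>2 * gram d ys"
    using assms(3) by (simp add: Determinant.det_transpose gram_def power2_eq_square)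
  finally show ?thesis .
qed

lemma gram_snoc_orthogonal:
  assumes "\<And>b. b \<in> set bs \<Longrightarrow> ip d r b = 0"
  shows "gram d (bs @ [r]) = gram d bs * ip d r r"
proof -
  let ?n = "length bs"
  have *: "gram_matrix d (bs @ [r]) =
      four_block_mat (gram_matrix d bs) (0\<^sub>m ?n 1) (0\<^sub>m 1 ?n) (mat 1 1 (\<lambda>_. ip d r r))"
    using assms assms[unfolded ip_commute[of d r]]
    by (intro eq_matI) (auto simp: gram_matrix_def nth_append less_Suc_eq)
  show ?thesis
    unfolding gram_def *
    by (subst det_four_block_mat_upper_right_zero_col[of _ ?n]) (auto simp: det_single)
qed

lemma span_list:
  assumes "x \<in> span (set bs)"
  shows "\<exists>c. x = (\<Sum>j<length bs. c j *\<^sub>R bs ! j)"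
  using assms
proof (induction bs arbitrary: x rule: rev_induct)
  case (snoc b bs)
  obtain a where "x - a *\<^sub>R b \<in> span (set bs)"
    using snoc.prems span_breakdown_eq[of x b "set bs"] by (auto simp del: span_insert)
  then obtain c where c: "x - a *\<^sub>R b = (\<Sum>j<length bs. c j *\<^sub>R bs ! j)"
    using snoc.IH by blast
  have "(\<Sum>j<length (bs @ [b]). (c(length bs := a)) j *\<^sub>R (bs @ [b]) ! j) =
      (\<Sum>j<length bs. c j *\<^sub>R bs ! j) + a *\<^sub>R b"
    by (simp add: nth_append)
  also have "\<dots> = x"
    unfolding c[symmetric] by simp
  finally show ?case by metis
qed simp

text \<open>Base times height: \<open>x\<close> arises from its residual \<open>r\<close> by a
  shear, whose matrix is unit lower triangular and so has determinant 1.\<close>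

lemma gram_snoc:
  assumes "x - r \<in> span (set bs)" "\<And>b. b \<in> set bs \<Longrightarrow> ip d r b = 0"
  shows "gram d (bs @ [x]) = gram d bs * ip d r r"
proof -
  let ?n = "length bs"
  obtain c where c: "x - r = (\<Sum>j<?n. c j *\<^sub>R bs ! j)"
    using span_list[OF assms(1)] by blast
  define C :: "real mat" where
    "C = mat (Suc ?n) (Suc ?n) (\<lambda>(i, j). if i = j then 1 else if i = ?n then c j else 0)"
  have C: "C \<in> carrier_mat (Suc ?n) (Suc ?n)"
    by (simp add: C_def)
  have "Determinant.det C = prod_list (diag_mat C)"
    by (rule det_lower_triangular[OF _ C]) (auto simp: C_def)
  also have "\<dots> = 1"
    by (simp add: prod_list_diag_prod C_def)
  finally have det: "Determinant.det C = 1" .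
  have "gram d (bs @ [x]) = (Determinant.det C)\<^sup>2 * gram d (bs @ [r])"
  proof (rule gram_linear_image[OF _ _ C])
    fix i assume i: "i < Suc ?n"
    show "(bs @ [x]) ! i = (\<Sum>j<Suc ?n. C $$ (i, j) *\<^sub>R (bs @ [r]) ! j)"
    proof (cases "i = ?n")
      case True
      have "(\<Sum>j<Suc ?n. C $$ (i, j) *\<^sub>R (bs @ [r]) ! j) = (\<Sum>j<?n. c j *\<^sub>R bs ! j) + r"
        using True by (simp add: C_def nth_append)
      also have "\<dots> = x" unfolding c[symmetric] by simp
      finally show ?thesis
        using True by (metis nth_append_length)
    next
      case False
      then have i': "i < ?n" using i by simp
      have "(\<Sum>j<Suc ?n. C $$ (i, j) *\<^sub>R (bs @ [r]) ! j) = (\<Sum>j<Suc ?n. if i = j then bs ! j else 0)"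
        using i' by (auto simp: C_def nth_append simp del: sum.delta sum.delta' intro!: sum.cong)
      also have "\<dots> = bs ! i" by (subst sum.delta') (use i' in auto)
      finally show ?thesis using i' by (simp add: nth_append)
    qed
  qed simp_all
  moreover have "gram d (bs @ [r]) = gram d bs * ip d r r"
    using assms(2) by (rule gram_snoc_orthogonal)
  ultimately show ?thesis
    by (simp add: det)
qed

text \<open>The matrix of the exchange is the identity with one row replaced by \<open>c\<close>;
  Cramer's rule for the identity matrix evaluates its determinant as \<open>c p\<close>. This is why
  a coordinate above 2 gains a factor above 4.\<close>

lemma gram_list_update:
  assumes "p < length bs" "x = (\<Sum>j<length bs. c j *\<^sub>R bs ! j)"
  shows "gram d (bs[p := x]) = (c p)\<^sup>2 * gram d bs"
proof -
  let ?n = "length bs"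
  let ?v = "Matrix.vec ?n c"
  define R :: "real mat" where "R = replace_col (1\<^sub>m ?n) (1\<^sub>m ?n *\<^sub>v ?v) p"
  have R: "R \<in> carrier_mat ?n ?n"
    by (simp add: R_def replace_col_def)
  have R_entry: "R $$ (i, j) = (if j = p then c i else if i = j then 1 else 0)"
    if "i < ?n" "j < ?n" for i j
    using that by (simp add: R_def replace_col_def)
  have "Determinant.det R = c p"
    unfolding R_def using assms(1) by (subst cramer_lemma_mat[of _ ?n]) auto
  moreover have "gram d (bs[p := x]) = (Determinant.det (transpose_mat R))\<^sup>2 * gram d bs"
  proof (rule gram_linear_image[where n = ?n])
    fix i assume i: "i < ?n"
    have "(\<Sum>j<?n. transpose_mat R $$ (i, j) *\<^sub>R bs ! j) =
        (\<Sum>j<?n. if i = p then c j *\<^sub>R bs ! j else if j = i then bs ! j else 0)"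
      using R i by (intro sum.cong) (auto simp: R_entry)
    also have "\<dots> = bs[p := x] ! i"
      using i assms by (auto simp: nth_list_update)
    finally show "bs[p := x] ! i = (\<Sum>j<?n. transpose_mat R $$ (i, j) *\<^sub>R bs ! j)" ..
  qed (use R in auto)
  ultimately show ?thesis
    using Determinant.det_transpose[OF R] by simp
qed

text \<open>Hadamard's inequality: each vector contributes the squared length of its residual, which
  by Pythagoras is at most its own squared length.\<close>

lemma gram_bounds:
  assumes "set bs \<subseteq> Rd d"
  shows "0 \<le> gram d bs \<and> gram d bs \<le> (\<Prod>b\<leftarrow>bs. ip d b b)"
  using assms
proof (induction bs rule: rev_induct)
  case Nil
  show ?case by simp
next
  case (snoc x bs)
  obtain r where r: "r \<in> Rd d" "x - r \<in> span (set bs)" "\<forall>b\<in>set bs. ip d r b = 0"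
    using orthogonal_residual_exists[of "set bs" d x] snoc.prems by auto
  then have g: "gram d (bs @ [x]) = gram d bs * ip d r r"
    by (intro gram_snoc) auto
  have "ip d r (x - r) = 0"
    using r by (metis ip_orthogonal_span)
  then have "ip d x x = ip d r r + ip d (x - r) (x - r)"
    by (simp add: ip_commute[of d x r])
  moreover have "0 \<le> ip d (x - r) (x - r)" by (rule ip_nonneg)
  ultimately have "ip d r r \<le> ip d x x" by linarith
  moreover have IH: "gram d bs \<le> (\<Prod>b\<leftarrow>bs. ip d b b)" "0 \<le> gram d bs"
    using snoc by auto
  ultimately have "gram d bs * ip d r r \<le> (\<Prod>b\<leftarrow>bs. ip d b b) * ip d x x"
    by (intro mult_mono) auto
  then show ?case
    using IH by (simp add: g)
qed

text \<open>By the Leibniz formula the determinant is a polynomial in the entries with integer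
  coefficients.\<close>

lemma gram_Ints:
  assumes "\<And>b j. b \<in> set bs \<Longrightarrow> j < d \<Longrightarrow> Poly_Mapping.lookup b j \<in> \<int>"
  shows "gram d bs \<in> \<int>"
proof -
  have "ip d (bs ! i) (bs ! j) \<in> \<int>" if "i < length bs" "j < length bs" for i j
    unfolding ip_def using that assms by (intro Ints_sum Ints_mult) auto
  then have entry: "gram_matrix d bs $$ (i, p i) \<in> \<int>"
    if "p permutes {0..<length bs}" "i < length bs" for p i
    using that by (simp add: gram_matrix_def)
  have sign: "signof p \<in> (\<int> :: real set)" for p :: "nat \<Rightarrow> nat"
    by (simp add: sign_def)
  show ?thesis
    unfolding gram_def det_def'[OF gram_matrix_carrier]
    by (intro Ints_sum Ints_mult Ints_prod sign entry) auto
qed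

section \<open>Real RAM programs and the algorithm\<close>

text \<open>Total correctness. The run asserted to exist also respects the bounds \<open>M\<close>
  and \<open>W\<close>, since a run exceeding them gets stuck.\<close>

definition triple ::
  "nat \<Rightarrow> point \<Rightarrow> nat \<Rightarrow> nat \<Rightarrow> (state \<Rightarrow> bool) \<Rightarrow> nat \<Rightarrow> com \<Rightarrow> (state \<Rightarrow> bool) \<Rightarrow> bool" where
  "triple d x M W A T c B \<longleftrightarrow> (\<forall>s. A s \<longrightarrow> (\<exists>k s'. k \<le> T \<and> exec d x M W c s k s' \<and> B s'))"

lemma triple_Skip: "(\<And>s. A s \<Longrightarrow> B s) \<Longrightarrow> triple d x M W A 1 Skip B"
  unfolding triple_def using exec.Skip by blast

lemma triple_SetReg:
  assumes "\<And>s. A s \<Longrightarrow> ival d s e \<le> W" "\<And>s. A s \<Longrightarrow> B (s\<lparr>reg := (reg s)(v := ival d s e)\<rparr>)"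
  shows "triple d x M W A (icost e + 1) (SetReg v e) B"
  unfolding triple_def using assms exec.SetReg by blast

lemma triple_SetCell:
  assumes "\<And>s. A s \<Longrightarrow> ival d s a < M" "\<And>s. A s \<Longrightarrow> raddr d s e \<subseteq> {..<M}"
    "\<And>s. A s \<Longrightarrow> B (s\<lparr>cell := (cell s)(ival d s a := rval d x s e)\<rparr>)"
  shows "triple d x M W A (icost a + rcost e + 1) (SetCell a e) B"
  unfolding triple_def using assms exec.SetCell by (metis le_refl)

lemma triple_Insert:
  assumes "\<And>s. A s \<Longrightarrow> B (s\<lparr>selected := insert (ival d s e) (selected s)\<rparr>)"
  shows "triple d x M W A (icost e + 1) (Insert_Index e) B"
  unfolding triple_def using assms exec.Insert_Index by blast

lemma triple_Seq:
  assumes "triple d x M W A T1 c1 B" "triple d x M W B T2 c2 C"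
  shows "triple d x M W A (T1 + T2) (Seq c1 c2) C"
  unfolding triple_def
proof (intro allI impI)
  fix s assume "A s"
  then obtain k1 s1 where 1: "k1 \<le> T1" "exec d x M W c1 s k1 s1" "B s1"
    using assms(1) unfolding triple_def by blast
  then obtain k2 s2 where "k2 \<le> T2" "exec d x M W c2 s1 k2 s2" "C s2"
    using assms(2) unfolding triple_def by blast
  with 1 show "\<exists>k s'. k \<le> T1 + T2 \<and> exec d x M W (Seq c1 c2) s k s' \<and> C s'"
    using exec.Seq by (metis add_mono)
qed

lemma triple_Cond:
  assumes "triple d x M W (\<lambda>s. A s \<and> bval d x s b) T c1 B"
    and "triple d x M W (\<lambda>s. A s \<and> \<not> bval d x s b) T c2 B"
    and "\<And>s. A s \<Longrightarrow> baddr d s b \<subseteq> {..<M}"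
  shows "triple d x M W A (bcost b + T) (Cond b c1 c2) B"
  unfolding triple_def
proof (intro allI impI)
  fix s assume s: "A s"
  show "\<exists>k s'. k \<le> bcost b + T \<and> exec d x M W (Cond b c1 c2) s k s' \<and> B s'"
  proof (cases "bval d x s b")
    case True
    then obtain k s' where "k \<le> T" "exec d x M W c1 s k s'" "B s'"
      using assms(1) s unfolding triple_def by blast
    with True show ?thesis
      using exec.Cond_True[OF assms(3)[OF s] True] by (metis add_left_mono)
  next
    case False
    then obtain k s' where "k \<le> T" "exec d x M W c2 s k s'" "B s'"
      using assms(2) s unfolding triple_def by blast
    with False show ?thesis
      using exec.Cond_False[OF assms(3)[OF s] False] by (metis add_left_mono)
  qed
qed

lemma triple_weaken:
  assumes "triple d x M W A T c B" "\<And>s. A' s \<Longrightarrow> A s" "\<And>s. B s \<Longrightarrow> B' s" "T \<le> T'"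
  shows "triple d x M W A' T' c B'"
  using assms unfolding triple_def by (meson le_trans)

definition For :: "nat \<Rightarrow> com \<Rightarrow> com" where
  "For v c = Seq (SetReg v (INum 0))
     (Loop (ILess (IReg v) IDim) (Seq c (SetReg v (IAdd (IReg v) (INum 1)))))"

text \<open>The guard costs 3 and the increment 4, hence \<open>T + 7\<close> per round; the
  initialisation costs 2 and the last, failing guard 3. The counter ends at \<open>d\<close>, which
  must fit below \<open>W\<close>. Since the loop overwrites the counter, \<open>I\<close> has to be
  stable under changing it.\<close>

lemma triple_For:
  assumes "d \<le> W"
    and stable: "\<And>i n s. I i s \<Longrightarrow> I i (s\<lparr>reg := (reg s)(v := n)\<rparr>)"
    and body: "\<And>i. i < d \<Longrightarrow>
      triple d x M W (\<lambda>s. I i s \<and> reg s v = i) T c (\<lambda>s. I (Suc i) s \<and> reg s v = i)"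
  shows "triple d x M W (I 0) (5 + d * (T + 7)) (For v c) (I d)"
proof -
  let ?L = "Loop (ILess (IReg v) IDim) (Seq c (SetReg v (IAdd (IReg v) (INum 1))))"
  have loop: "\<exists>k s'. k \<le> 3 + (d - i) * (T + 7) \<and> exec d x M W ?L s k s' \<and> I d s'"
    if "i \<le> d" "I i s" "reg s v = i" for i s
    using that
  proof (induction "d - i" arbitrary: i s)
    case 0
    have "exec d x M W ?L s 3 s"
      using exec.Loop_False[of d s "ILess (IReg v) IDim" M x W] 0 by (simp add: numeral_3_eq_3)
    moreover have "i = d" using 0 by simp
    ultimately show ?case
      using 0(3) by (intro exI[of _ 3] exI[of _ s]) auto
  next
    case (Suc n)
    then have i: "i < d" by simp
    then obtain k s1 where 1: "k \<le> T" "exec d x M W c s k s1" "I (Suc i) s1" "reg s1 v = i"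
      using body[OF i] Suc.prems unfolding triple_def by blast
    let ?s2 = "s1\<lparr>reg := (reg s1)(v := Suc i)\<rparr>"
    have "exec d x M W (SetReg v (IAdd (IReg v) (INum 1))) s1 4 ?s2"
      using exec.SetReg[of d s1 "IAdd (IReg v) (INum 1)" W x M v] 1(4) i assms(1)
      by (simp add: eval_nat_numeral)
    from exec.Seq[OF 1(2) this] have e: "exec d x M W (Seq c (SetReg v (IAdd (IReg v) (INum 1)))) s (k + 4) ?s2" .
    have "n = d - Suc i" using Suc.hyps(2) by simp
    from Suc.hyps(1)[OF this, of ?s2]
    obtain k' s' where 2: "k' \<le> 3 + (d - Suc i) * (T + 7)" "exec d x M W ?L ?s2 k' s'" "I d s'"
      using i stable[OF 1(3)] by auto
    have "exec d x M W ?L s (3 + (k + 4) + k') s'"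
      using exec.Loop_True[OF _ _ e 2(2)] i Suc.prems by simp
    moreover have "3 + (k + 4) + k' \<le> 3 + (d - i) * (T + 7)"
      using 1(1) 2(1) i Suc_diff_Suc[OF i, symmetric] by simp
    ultimately show ?case using 2(3) by blast
  qed
  show ?thesis
    unfolding triple_def
  proof (intro allI impI)
    fix s assume "I 0 s"
    then obtain k s' where l: "k \<le> 3 + d * (T + 7)"
        "exec d x M W ?L (s\<lparr>reg := (reg s)(v := 0)\<rparr>) k s'" "I d s'"
      using loop[of 0 "s\<lparr>reg := (reg s)(v := 0)\<rparr>"] stable by auto
    have "exec d x M W (SetReg v (INum 0)) s 2 (s\<lparr>reg := (reg s)(v := 0)\<rparr>)"
      using exec.SetReg[of d s "INum 0" W x M v] by (simp add: eval_nat_numeral)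
    from exec.Seq[OF this l(2)] have "exec d x M W (For v c) s (2 + k) s'"
      by (simp add: For_def)
    with l show "\<exists>k s'. k \<le> 5 + d * (T + 7) \<and> exec d x M W (For v c) s k s' \<and> I d s'"
      by (intro exI[of _ "2 + k"] exI[of _ s']) auto
  qed
qed

text \<open>The cells after cell \<open>0\<close> are used as a matrix with rows of length \<open>d\<close>. Its rows hold the
  center (\<open>0\<close>), the first point (\<open>1\<close>), the coordinates of the current point in the maintained
  basis (\<open>2\<close>), the squared pivoting thresholds (\<open>3\<close>), the pivot row (\<open>4\<close>), the sum of the selected
  points relative to the first one (\<open>5\<close>), and the threshold of the best pivot candidate (\<open>6\<close>). From
  row \<open>7\<close> on they hold the inverse of the basis matrix minus the identity, so that the initial zero
  cells stand for the basis of unit vectors. Register \<open>0\<close> is the time, register \<open>1\<close> counts the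
  pivots, register \<open>2\<close> is the pivot slot, and registers \<open>3\<close> and \<open>4\<close> are loop counters.\<close>

definition loc :: "nat \<Rightarrow> nat \<Rightarrow> nat \<Rightarrow> nat" where
  "loc d k j = 1 + k * d + j"

definition Loc :: "iexp \<Rightarrow> iexp \<Rightarrow> iexp" where
  "Loc a b = IAdd (IAdd (INum 1) (IMul a IDim)) b"

lemma ival_Loc [simp]: "ival d s (Loc a b) = loc d (ival d s a) (ival d s b)"
  by (simp add: Loc_def loc_def)

lemma icost_Loc [simp]: "icost (Loc a b) = icost a + icost b + 5"
  by (simp add: Loc_def)

lemma loc_eq_iff [simp]:
  assumes "j < d" "j' < d"
  shows "loc d k j = loc d k' j' \<longleftrightarrow> k = k' \<and> j = j'"
proof
  assume "loc d k j = loc d k' j'"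
  then have e: "k * d + j = k' * d + j'" by (simp add: loc_def)
  have "(k * d + j) div d = k" "(k' * d + j') div d = k'" using assms by auto
  then have "k = k'" using e by simp
  then show "k = k' \<and> j = j'" using e by simp
qed simp

text \<open>The rows \<open>0\<close> to \<open>d + 6\<close> end at address
  \<open>(d + 7) * d\<close>, which is at most \<open>8 * d\<^sup>2\<close> for positive
  \<open>d\<close>.\<close>

lemma loc_less: "k < d + 7 \<Longrightarrow> j < d \<Longrightarrow> loc d k j < 9 * d\<^sup>2"
proof -
  assume k: "k < d + 7" and j: "j < d"
  have "Suc k * d \<le> (d + 7) * d" using k by (intro mult_right_mono) auto
  moreover have "loc d k j \<le> Suc k * d" using j by (simp add: loc_def)
  moreover have "(d + 7) * d \<le> 8 * d * d" using j by (intro mult_right_mono) auto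
  moreover have "8 * d * d < 9 * d\<^sup>2" using j by (simp add: power2_eq_square)
  ultimately show ?thesis by linarith
qed

text \<open>The loop counters and cell \<open>0\<close> are left out, so that \<open>For\<close> and
  the row stores can ignore them; the rows of \<open>f\<close> matter only on columns below
  \<open>d\<close>.\<close>

definition St :: "nat \<Rightarrow> nat \<Rightarrow> nat \<Rightarrow> nat \<Rightarrow> (nat \<Rightarrow> nat \<Rightarrow> real) \<Rightarrow> nat set \<Rightarrow> state \<Rightarrow> bool" where
  "St d t m p f S s \<longleftrightarrow> reg s 0 = t \<and> reg s (Suc 0) = m \<and> reg s 2 = p \<and> selected s = S \<and>
     (\<forall>k. \<forall>j<d. cell s (loc d k j) = f k j)"

lemma St_reg_irrelevant [simp]:
  "3 \<le> v \<Longrightarrow> St d t m p f S (s\<lparr>reg := (reg s)(v := n)\<rparr>) \<longleftrightarrow> St d t m p f S s"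
  by (auto simp: St_def)

lemma St_cell: "St d t m p f S s \<Longrightarrow> j < d \<Longrightarrow> cell s (loc d k j) = f k j"
  by (simp add: St_def)

lemma St_regs:
  "St d t m p f S s \<Longrightarrow> reg s 0 = t" "St d t m p f S s \<Longrightarrow> reg s (Suc 0) = m"
  "St d t m p f S s \<Longrightarrow> reg s 2 = p"
  by (simp_all add: St_def)

lemma St_upd:
  "St d t m p f S s \<Longrightarrow> j < d \<Longrightarrow> (\<And>k j'. j' < d \<Longrightarrow> g k j' = (if k = r \<and> j' = j then y else f k j')) \<Longrightarrow>
   St d t m p g S (s\<lparr>cell := (cell s)(loc d r j := y)\<rparr>)"
  by (simp add: St_def)

section \<open>The program and its specification\<close>

definition In :: "iexp \<Rightarrow> rexp" where
  "In j = RSub (RInput j) (RCell (Loc (INum 1) j))"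

abbreviation "ri \<equiv> IReg 3"
abbreviation "rj \<equiv> IReg 4"
abbreviation "rp \<equiv> IReg 2"
abbreviation "Row k j \<equiv> Loc (INum k) j"
abbreviation "Mat i j \<equiv> Loc (IAdd (INum 7) i) j"

text \<open>The time has already been incremented, so the guard holds exactly for the first
  point.\<close>

definition load_first :: com where
  "load_first = Cond (ILess (IReg 0) (INum 2)) (For 3 (SetCell (Row 1 ri) (RInput ri))) Skip"

text \<open>Row \<open>2\<close> starts with the shifted input itself because the stored matrix is
  the inverse minus the identity.\<close>

definition compute_coordinates :: com where
  "compute_coordinates = For 3 (Seq (SetCell (Row 2 ri) (In ri))
     (For 4 (SetCell (Row 2 ri)
        (RAdd (RCell (Row 2 ri)) (RMul (RCell (Mat ri rj)) (In rj))))))"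

text \<open>5 is a sentinel above both thresholds, 0 and 4: it survives exactly when no slot
  qualifies.\<close>

definition find_pivot :: com where
  "find_pivot = Seq (SetReg 2 (INum 0)) (Seq (SetCell (Row 6 (INum 0)) (RNum 5))
     (For 3 (Cond
        (BAnd (RLess (RCell (Row 3 ri)) (RMul (RCell (Row 2 ri)) (RCell (Row 2 ri))))
              (RLess (RCell (Row 3 ri)) (RCell (Row 6 (INum 0)))))
        (Seq (SetCell (Row 6 (INum 0)) (RCell (Row 3 ri))) (SetReg 2 ri))
        Skip)))"

text \<open>A Gauss-Jordan exchange. Row \<open>p\<close> of the inverse, with its identity part
  restored, is divided by the pivot coordinate and kept in row \<open>4\<close>. Lowering coordinate
  \<open>p\<close> by 1 afterwards lets one subtraction serve all rows: the others lose their
  coordinate times row \<open>4\<close>, and row \<open>p\<close> itself becomes row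
  \<open>4\<close>.\<close>

definition pivot :: com where
  "pivot = Seq (SetReg 1 (IAdd (IReg 1) (INum 1)))
    (Seq (Insert_Index (IReg 0))
    (Seq (For 4 (SetCell (Row 4 rj) (RDiv (RCell (Mat rp rj)) (RCell (Row 2 rp)))))
    (Seq (SetCell (Row 4 rp) (RAdd (RCell (Row 4 rp)) (RDiv (RNum 1) (RCell (Row 2 rp)))))
    (Seq (SetCell (Row 2 rp) (RSub (RCell (Row 2 rp)) (RNum 1)))
    (Seq (SetCell (Row 3 rp) (RNum 4))
    (Seq (For 3 (For 4 (SetCell (Mat ri rj)
            (RSub (RCell (Mat ri rj)) (RMul (RCell (Row 2 ri)) (RCell (Row 4 rj)))))))
    (For 4 (SetCell (Row 5 rj) (RAdd (RCell (Row 5 rj)) (In rj))))))))))"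

text \<open>Register \<open>1\<close> counts the selected points other than the first. Each of them
  gets weight \<open>1 / (2 * (m + 1))\<close> in the center, so the first point keeps at least half
  of the weight.\<close>

definition write_output :: com where
  "write_output = Seq
    (For 4 (SetCell (Row 0 rj) (RAdd (RCell (Row 1 rj))
       (RDiv (RCell (Row 5 rj)) (RIndex (IMul (INum 2) (IAdd (IReg 1) (INum 1))))))))
    (SetCell (INum 0) (RDiv (RNum 1) (RIndex (IAdd (INum 5) (IMul (INum 4) (IReg 1))))))"

text \<open>Index 1 is inserted in every round to save a case distinction; the first point, being
  the origin of the shifted coordinates, triggers no pivot.\<close>

definition coreset_program :: com where
  "coreset_program = Seq (SetReg 0 (IAdd (IReg 0) (INum 1)))
    (Seq load_first (Seq (Insert_Index (INum 1)) (Seq compute_coordinates (Seq find_pivot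
    (Seq (Cond (RLess (RCell (Row 6 (INum 0))) (RNum 5)) pivot Skip) write_output)))))"

text \<open>The squared threshold is \<open>0\<close> for slots that still hold a unit vector and \<open>4\<close> for slots that
  hold a point. Preferring the smallest threshold ensures that a point outside the span of the
  previous ones replaces a unit vector.\<close>

definition step_update ::
  "nat \<Rightarrow> nat \<Rightarrow> nat \<Rightarrow> (nat \<Rightarrow> nat \<Rightarrow> real) \<Rightarrow> nat set \<Rightarrow> (nat \<Rightarrow> real) \<Rightarrow> (nat \<Rightarrow> real) \<Rightarrow>
   nat \<Rightarrow> (nat \<Rightarrow> nat \<Rightarrow> real) \<Rightarrow> nat set \<Rightarrow> bool" where
  "step_update d t m f S y c m' f' S' \<longleftrightarrow>
    (\<forall>j<d. c j * c j \<le> f 3 j) \<and> m' = m \<and> f' 3 = f 3 \<and> f' 5 = f 5 \<and>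
      (\<forall>i<d. f' (7 + i) = f (7 + i)) \<and> S' = insert 1 S \<or>
    (\<exists>p<d. f 3 p < c p * c p \<and> (\<forall>j<d. f 3 j < c j * c j \<longrightarrow> f 3 p \<le> f 3 j) \<and>
      m' = Suc m \<and> f' 3 = (f 3)(p := 4) \<and> f' 5 = (\<lambda>j. f 5 j + y j) \<and>
      (\<forall>i<d. \<forall>j. f' (7 + i) j =
        f (7 + i) j - (c i - of_bool (i = p)) * ((f (7 + p) j + of_bool (j = p)) / c p)) \<and>
      S' = insert (Suc t) (insert 1 S))"

text \<open>The interface between program and mathematics: from the invariants on, a step is seen
  only through this relation. Here \<open>t\<close> is the time before the step, so
  \<open>t = 0\<close> belongs to the first point.\<close>

definition step_rel ::
  "nat \<Rightarrow> point \<Rightarrow> nat \<Rightarrow> nat \<Rightarrow> (nat \<Rightarrow> nat \<Rightarrow> real) \<Rightarrow> nat set \<Rightarrow> nat \<Rightarrow> (nat \<Rightarrow> nat \<Rightarrow> real) \<Rightarrow> nat set \<Rightarrow> bool" where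
  "step_rel d x t m f S m' f' S' \<longleftrightarrow>
    (\<exists>z1 y c. z1 = (if t = 0 then Poly_Mapping.lookup x else f 1) \<and>
      y = (\<lambda>j. Poly_Mapping.lookup x j - z1 j) \<and>
      c = (\<lambda>i. y i + (\<Sum>j<d. f (7 + i) j * y j)) \<and>
      f' 1 = z1 \<and> (\<forall>j. f' 0 j = z1 j + f' 5 j / (2 * (real m' + 1))) \<and>
      step_update d t m f S y c m' f' S')"

section \<open>Correctness and running time of the program\<close>

context
  fixes d M W :: nat and x :: point
  assumes d_pos: "1 \<le> d" and d_le_W: "d \<le> W" and M_ge: "9 * d\<^sup>2 \<le> M"
begin

lemma loc_less_M [simp]: "k < d + 7 \<Longrightarrow> j < d \<Longrightarrow> loc d k j < M"
  using loc_less[of k d j] M_ge by linarith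

text \<open>\<open>B\<close> carries facts about registers, such as the values of loop counters,
  past the store.\<close>

lemma triple_store:
  assumes "\<And>s. A s \<Longrightarrow> St d t m p f S s \<and> ival d s a = loc d r j \<and> raddr d s e \<subseteq> {..<M} \<and> rval d x s e = y"
    and "r < d + 7" "j < d"
    and "\<And>k i. i < d \<Longrightarrow> g k i = (if k = r \<and> i = j then y else f k i)"
    and "\<And>s c. A s \<Longrightarrow> B (s\<lparr>cell := c\<rparr>)"
    and T: "icost a + rcost e + 1 = T"
  shows "triple d x M W A T (SetCell a e) (\<lambda>s. St d t m p g S s \<and> B s)"
  unfolding T[symmetric]
proof (rule triple_SetCell)
  fix s assume A: "A s"
  note s = assms(1)[OF A]
  show "ival d s a < M" using s assms(2,3) by simp
  show "raddr d s e \<subseteq> {..<M}" using s by simp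
  show "St d t m p g S (s\<lparr>cell := (cell s)(ival d s a := rval d x s e)\<rparr>) \<and>
      B (s\<lparr>cell := (cell s)(ival d s a := rval d x s e)\<rparr>)"
    using s assms(3-5) A by (auto intro!: St_upd)
qed

text \<open>\<open>g\<close> is the memory in the middle of the loop: the expression may read other
  rows freely, but row \<open>r\<close> only from column \<open>j\<close> on, where it is not yet
  overwritten. This admits the in-place accumulation in row \<open>5\<close>.\<close>

lemma triple_store_row:
  assumes "r < d + 7" "3 \<le> v"
    and e: "\<And>s j g. St d t m p g S s \<Longrightarrow> reg s v = j \<Longrightarrow> j < d \<Longrightarrow>
      (\<And>k i. i < d \<Longrightarrow> k \<noteq> r \<or> j \<le> i \<Longrightarrow> g k i = f k i) \<Longrightarrow>
      raddr d s e \<subseteq> {..<M} \<and> rval d x s e = y j"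
  shows "triple d x M W (St d t m p f S) (5 + d * (rcost e + 15)) (For v (SetCell (Row r (IReg v)) e))
    (St d t m p (f(r := y)) S)"
proof -
  let ?I = "\<lambda>i. St d t m p (f(r := \<lambda>j. if j < i then y j else f r j)) S"
  have "triple d x M W (?I 0) (5 + d * (rcost e + 8 + 7)) (For v (SetCell (Row r (IReg v)) e)) (?I d)"
  proof (rule triple_For[OF d_le_W])
    fix i assume i: "i < d"
    show "triple d x M W (\<lambda>s. ?I i s \<and> reg s v = i) (rcost e + 8) (SetCell (Row r (IReg v)) e)
        (\<lambda>s. ?I (Suc i) s \<and> reg s v = i)"
    proof (rule triple_store)
      fix s assume s: "?I i s \<and> reg s v = i"
      have *: "raddr d s e \<subseteq> {..<M} \<and> rval d x s e = y i"
        using s i by (intro e[of "f(r := \<lambda>j. if j < i then y j else f r j)"]) auto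
      show "?I i s \<and> ival d s (Row r (IReg v)) = loc d r i \<and> raddr d s e \<subseteq> {..<M} \<and> rval d x s e = y i"
        using s * by simp
    qed (use i assms(1) in auto)
  qed (use assms(2) in simp)
  then show ?thesis
    by (rule triple_weaken) (auto simp: St_def algebra_simps)
qed

lemma triple_load_first:
  "triple d x M W (St d t m p f S) (3 + (5 + d * 17)) load_first
     (St d t m p (if t < 2 then f(1 := Poly_Mapping.lookup x) else f) S)" (is "triple _ _ _ _ _ _ _ ?B")
proof -
  have 1: "triple d x M W (St d t m p f S) (5 + d * 17) (For 3 (SetCell (Row 1 ri) (RInput ri)))
      (St d t m p (f(1 := Poly_Mapping.lookup x)) S)"
    using triple_store_row[where r = 1 and v = 3 and e = "RInput ri" and y = "Poly_Mapping.lookup x"]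
    by simp
  have 2: "triple d x M W (St d t m p f S) 1 Skip (St d t m p f S)"
    by (rule triple_Skip)
  have "triple d x M W (St d t m p f S) (bcost (ILess (IReg 0) (INum 2)) + (5 + d * 17)) load_first ?B"
    unfolding load_first_def
  proof (rule triple_Cond)
    show "triple d x M W (\<lambda>s. St d t m p f S s \<and> bval d x s (ILess (IReg 0) (INum 2))) (5 + d * 17)
        (For 3 (SetCell (Row 1 ri) (RInput ri))) ?B"
    proof (cases "t < 2")
      case True
      then show ?thesis by (intro triple_weaken[OF 1]) auto
    qed (auto simp: triple_def St_regs)
    show "triple d x M W (\<lambda>s. St d t m p f S s \<and> \<not> bval d x s (ILess (IReg 0) (INum 2))) (5 + d * 17)
        Skip ?B"
    proof (cases "t < 2")
      case False
      then show ?thesis by (intro triple_weaken[OF 2]) auto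
    qed (auto simp: triple_def St_regs)
  qed simp
  then show ?thesis by (simp add: numeral_3_eq_3)
qed

definition shifted :: "(nat \<Rightarrow> nat \<Rightarrow> real) \<Rightarrow> nat \<Rightarrow> real" where
  "shifted f j = Poly_Mapping.lookup x j - f 1 j"

definition coords :: "(nat \<Rightarrow> nat \<Rightarrow> real) \<Rightarrow> nat \<Rightarrow> real" where
  "coords f i = shifted f i + (\<Sum>j<d. f (7 + i) j * shifted f j)"

lemma In_eval:
  assumes "St d t m p g S s" "ival d s a = j" "j < d" "g 1 j = f 1 j"
  shows "rval d x s (In a) = shifted f j" "raddr d s (In a) \<subseteq> {..<M}"
  using assms St_cell[OF assms(1,3), of 1] by (auto simp: In_def shifted_def)

lemma rcost_In [simp]: "rcost (In a) = icost a + 1 + (1 + icost a + 5 + 1) + 1"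
  by (simp add: In_def)

lemma triple_compute_coordinates:
  "triple d x M W (St d t m p f S) (5 + d * (20 + (5 + d * 50) + 7)) compute_coordinates
     (St d t m p (f(2 := coords f)) S)"
proof -
  \<comment> \<open>\<open>F i j\<close> is the memory after \<open>j\<close> rounds of the inner
    loop for coordinate \<open>i\<close>, and \<open>G i\<close> the memory after \<open>i\<close>
    rounds of the outer loop.\<close>
  define F where "F i j = f(2 := \<lambda>l. if l < i then coords f l else
    if l = i then shifted f l + (\<Sum>j'<j. f (7 + l) j' * shifted f j') else f 2 l)" for i j
  define G where "G i = f(2 := \<lambda>l. if l < i then coords f l else f 2 l)" for i
  have inner: "triple d x M W (\<lambda>s. St d t m p (F i 0) S s \<and> reg s 3 = i) (5 + d * (43 + 7))
      (For 4 (SetCell (Row 2 ri) (RAdd (RCell (Row 2 ri)) (RMul (RCell (Mat ri rj)) (In rj)))))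
      (\<lambda>s. St d t m p (F i d) S s \<and> reg s 3 = i)" if i: "i < d" for i
  proof (rule triple_For[OF d_le_W])
    fix j assume j: "j < d"
    show "triple d x M W (\<lambda>s. (St d t m p (F i j) S s \<and> reg s 3 = i) \<and> reg s 4 = j) 43
        (SetCell (Row 2 ri) (RAdd (RCell (Row 2 ri)) (RMul (RCell (Mat ri rj)) (In rj))))
        (\<lambda>s. (St d t m p (F i (Suc j)) S s \<and> reg s 3 = i) \<and> reg s 4 = j)"
    proof (rule triple_weaken[OF triple_store[where r = 2 and j = i and f = "F i j"
          and g = "F i (Suc j)" and B = "\<lambda>s. reg s 3 = i \<and> reg s 4 = j"
          and y = "F i j 2 i + f (7 + i) j * shifted f j"]])
      fix s assume s: "(St d t m p (F i j) S s \<and> reg s 3 = i) \<and> reg s 4 = j"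
      then have s1: "St d t m p (F i j) S s" by simp
      have "ival d s rj = j" using s by simp
      note in_eval = In_eval[OF s1 this j, of f]
      have "F i j 1 j = f 1 j" by (simp add: F_def)
      note in_eval = in_eval[OF this]
      have "cell s (loc d (7 + i) j) = f (7 + i) j"
        using St_cell[OF s1 j] by (simp add: F_def)
      then show "St d t m p (F i j) S s \<and> ival d s (Row 2 ri) = loc d 2 i \<and>
          raddr d s (RAdd (RCell (Row 2 ri)) (RMul (RCell (Mat ri rj)) (In rj))) \<subseteq> {..<M} \<and>
          rval d x s (RAdd (RCell (Row 2 ri)) (RMul (RCell (Mat ri rj)) (In rj))) =
            F i j 2 i + f (7 + i) j * shifted f j"
        using s s1 in_eval i j St_cell[OF s1 i] by simp
    qed (use i in \<open>auto simp: F_def\<close>)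
  qed simp
  have "triple d x M W (St d t m p (G 0) S) (5 + d * (20 + (5 + d * 50) + 7)) compute_coordinates
      (St d t m p (G d) S)"
    unfolding compute_coordinates_def
  proof (rule triple_For[OF d_le_W])
    fix i assume i: "i < d"
    show "triple d x M W (\<lambda>s. St d t m p (G i) S s \<and> reg s 3 = i) (20 + (5 + d * 50))
       (Seq (SetCell (Row 2 ri) (In ri))
         (For 4 (SetCell (Row 2 ri) (RAdd (RCell (Row 2 ri)) (RMul (RCell (Mat ri rj)) (In rj))))))
       (\<lambda>s. St d t m p (G (Suc i)) S s \<and> reg s 3 = i)"
    proof (rule triple_Seq)
      show "triple d x M W (\<lambda>s. St d t m p (G i) S s \<and> reg s 3 = i) 20 (SetCell (Row 2 ri) (In ri))
          (\<lambda>s. St d t m p (F i 0) S s \<and> reg s 3 = i)"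
      proof (rule triple_weaken[OF triple_store[where r = 2 and j = i and f = "G i"
            and g = "F i 0" and B = "\<lambda>s. reg s 3 = i" and y = "shifted f i"]])
        fix s assume s: "St d t m p (G i) S s \<and> reg s 3 = i"
        then have "rval d x s (In ri) = shifted f i" "raddr d s (In ri) \<subseteq> {..<M}"
          by (intro In_eval[of t m p "G i" S s _ i f] i; simp add: G_def)+
        then show "St d t m p (G i) S s \<and> ival d s (Row 2 ri) = loc d 2 i \<and> raddr d s (In ri) \<subseteq> {..<M} \<and>
            rval d x s (In ri) = shifted f i"
          using s by simp
      qed (use i in \<open>auto simp: F_def G_def\<close>)
      have "F i d = G (Suc i)"
        by (auto simp: F_def G_def fun_eq_iff coords_def less_Suc_eq)
      then show "triple d x M W (\<lambda>s. St d t m p (F i 0) S s \<and> reg s 3 = i) (5 + d * 50)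
          (For 4 (SetCell (Row 2 ri) (RAdd (RCell (Row 2 ri)) (RMul (RCell (Mat ri rj)) (In rj)))))
          (\<lambda>s. St d t m p (G (Suc i)) S s \<and> reg s 3 = i)"
        using inner[OF i] by simp
    qed
  qed simp
  then show ?thesis
    by (rule triple_weaken) (auto simp: G_def St_def)
qed

text \<open>What the loop of \<open>find_pivot\<close> has found after \<open>i\<close> rounds; the
  slot is meaningless while the first component is still the sentinel.\<close>

primrec pick :: "(nat \<Rightarrow> real) \<Rightarrow> (nat \<Rightarrow> real) \<Rightarrow> nat \<Rightarrow> real \<times> nat" where
  "pick h c 0 = (5, 0)"
| "pick h c (Suc i) = (if h i < c i * c i \<and> h i < fst (pick h c i) then (h i, i) else pick h c i)"

lemma pick_props:
  "fst (pick h c i) < 5 \<Longrightarrow>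
    snd (pick h c i) < i \<and> h (snd (pick h c i)) = fst (pick h c i) \<and>
    h (snd (pick h c i)) < c (snd (pick h c i)) * c (snd (pick h c i))"
  "j < i \<Longrightarrow> h j < c j * c j \<Longrightarrow> fst (pick h c i) \<le> h j"
  by (induction i) (auto simp: less_Suc_eq)

lemma triple_find_pivot:
  "triple d x M W (St d t m p f S) (2 + (9 + (5 + d * 70))) find_pivot
     (St d t m (snd (pick (f 3) (f 2) d)) (f(6 := (f 6)(0 := fst (pick (f 3) (f 2) d)))) S)"
proof -
  let ?pk = "pick (f 3) (f 2)"
  define G where "G i = f(6 := (f 6)(0 := fst (?pk i)))" for i
  have loop: "triple d x M W (St d t m (snd (?pk 0)) (G 0) S) (5 + d * (63 + 7))
     (For 3 (Cond
        (BAnd (RLess (RCell (Row 3 ri)) (RMul (RCell (Row 2 ri)) (RCell (Row 2 ri))))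
              (RLess (RCell (Row 3 ri)) (RCell (Row 6 (INum 0)))))
        (Seq (SetCell (Row 6 (INum 0)) (RCell (Row 3 ri))) (SetReg 2 ri))
        Skip)) (St d t m (snd (?pk d)) (G d) S)"
  proof (rule triple_For[OF d_le_W])
    fix i assume i: "i < d"
    let ?b = "BAnd (RLess (RCell (Row 3 ri)) (RMul (RCell (Row 2 ri)) (RCell (Row 2 ri))))
              (RLess (RCell (Row 3 ri)) (RCell (Row 6 (INum 0))))"
    have cells: "cell s (loc d 3 i) = f 3 i" "cell s (loc d 2 i) = f 2 i" "cell s (loc d 6 0) = fst (?pk i)"
      if "St d t m (snd (?pk i)) (G i) S s" for s
      using St_cell[OF that] i by (auto simp: G_def)
    let ?A = "\<lambda>s. St d t m (snd (?pk i)) (G i) S s \<and> reg s 3 = i"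
    have "triple d x M W ?A (bcost ?b + (17 + 2)) (Cond ?b
        (Seq (SetCell (Row 6 (INum 0)) (RCell (Row 3 ri))) (SetReg 2 ri)) Skip)
        (\<lambda>s. St d t m (snd (?pk (Suc i))) (G (Suc i)) S s \<and> reg s 3 = i)"
    proof (rule triple_Cond)
      show "triple d x M W (\<lambda>s. ?A s \<and> bval d x s ?b) (17 + 2)
          (Seq (SetCell (Row 6 (INum 0)) (RCell (Row 3 ri))) (SetReg 2 ri))
          (\<lambda>s. St d t m (snd (?pk (Suc i))) (G (Suc i)) S s \<and> reg s 3 = i)"
      proof (cases "f 3 i < f 2 i * f 2 i \<and> f 3 i < fst (?pk i)")
        case True
        show ?thesis
        proof (rule triple_Seq)
          show "triple d x M W (\<lambda>s. ?A s \<and> bval d x s ?b) 17 (SetCell (Row 6 (INum 0)) (RCell (Row 3 ri)))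
              (\<lambda>s. St d t m (snd (?pk i)) (G (Suc i)) S s \<and> reg s 3 = i)"
            by (rule triple_weaken[OF triple_store[where r = 6 and j = 0 and f = "G i"
                 and g = "G (Suc i)" and B = "\<lambda>s. reg s 3 = i" and y = "f 3 i"
                 and A = "\<lambda>s. ?A s \<and> bval d x s ?b"]])
              (use i True cells in \<open>auto simp: G_def\<close>)
          show "triple d x M W (\<lambda>s. St d t m (snd (?pk i)) (G (Suc i)) S s \<and> reg s 3 = i) 2 (SetReg 2 ri)
              (\<lambda>s. St d t m (snd (?pk (Suc i))) (G (Suc i)) S s \<and> reg s 3 = i)"
            by (rule triple_weaken[OF triple_SetReg[where A =
                  "\<lambda>s. St d t m (snd (?pk i)) (G (Suc i)) S s \<and> reg s 3 = i"]])
              (use i True d_le_W in \<open>auto simp: St_def\<close>)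
        qed
      next
        case False
        then show ?thesis
          using cells i by (auto simp: triple_def)
      qed
      show "triple d x M W (\<lambda>s. ?A s \<and> \<not> bval d x s ?b) (17 + 2) Skip
          (\<lambda>s. St d t m (snd (?pk (Suc i))) (G (Suc i)) S s \<and> reg s 3 = i)"
        by (rule triple_weaken[OF triple_Skip[where A = "\<lambda>s. ?A s \<and> \<not> bval d x s ?b"]])
          (use cells i in \<open>auto simp: G_def\<close>)
    qed (use i d_pos in auto)
    then show "triple d x M W ?A 63 (Cond ?b
        (Seq (SetCell (Row 6 (INum 0)) (RCell (Row 3 ri))) (SetReg 2 ri)) Skip)
        (\<lambda>s. St d t m (snd (?pk (Suc i))) (G (Suc i)) S s \<and> reg s 3 = i)"
      by (rule triple_weaken) auto
  qed simp
  have r: "triple d x M W (St d t m p f S) 2 (SetReg 2 (INum 0)) (St d t m 0 f S)"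
    by (rule triple_weaken[OF triple_SetReg[where A = "St d t m p f S"]]) (auto simp: St_def)
  have c: "triple d x M W (St d t m 0 f S) 9 (SetCell (Row 6 (INum 0)) (RNum 5))
      (St d t m (snd (?pk 0)) (G 0) S)"
    by (rule triple_weaken[OF triple_store[where r = 6 and j = 0 and f = f
           and g = "G 0" and B = "\<lambda>s. True" and y = 5 and A = "St d t m 0 f S"]])
      (use d_pos in \<open>auto simp: G_def\<close>)
  show ?thesis
    unfolding find_pivot_def
    by (rule triple_weaken[OF triple_Seq[OF r triple_Seq[OF c loop]]]) (auto simp: G_def)
qed

definition pivot_row :: "(nat \<Rightarrow> nat \<Rightarrow> real) \<Rightarrow> nat \<Rightarrow> nat \<Rightarrow> real" where
  "pivot_row f p j = (f (7 + p) j + of_bool (j = p)) / f 2 p"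

text \<open>The pivot as one simultaneous assignment, in which every right-hand side refers to the
  memory before it; the sequence of stores in \<open>pivot\<close> is shown to amount to
  this.\<close>

definition pivoted :: "(nat \<Rightarrow> nat \<Rightarrow> real) \<Rightarrow> nat \<Rightarrow> nat \<Rightarrow> nat \<Rightarrow> real" where
  "pivoted f p k j =
     (if k = 2 then f 2 j - of_bool (j = p)
      else if k = 3 then (if j = p then 4 else f 3 j)
      else if k = 4 then pivot_row f p j
      else if k = 5 then f 5 j + shifted f j
      else if 7 \<le> k \<and> k < 7 + d then f k j - (f 2 (k - 7) - of_bool (k - 7 = p)) * pivot_row f p j
      else f k j)"

lemma triple_update_matrix:
  defines "upd f k j \<equiv> if 7 \<le> k \<and> k < 7 + d then f k j - f 2 (k - 7) * f 4 j else f k j"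
  shows "triple d x M W (St d t m p f S) (5 + d * ((5 + d * 50) + 7))
     (For 3 (For 4 (SetCell (Mat ri rj)
        (RSub (RCell (Mat ri rj)) (RMul (RCell (Row 2 ri)) (RCell (Row 4 rj)))))))
     (St d t m p (upd f) S)"
proof -
  define F where "F i l k j = (if 7 \<le> k \<and> k < 7 + i \<or> k = 7 + i \<and> j < l
    then f k j - f 2 (k - 7) * f 4 j else f k j)" for i l k j
  let ?e = "RSub (RCell (Mat ri rj)) (RMul (RCell (Row 2 ri)) (RCell (Row 4 rj)))"
  have F0: "F 0 0 = f" "F d 0 = upd f"
    by (auto simp: F_def upd_def fun_eq_iff)
  have "triple d x M W (St d t m p (F 0 0) S) (5 + d * ((5 + d * 50) + 7))
     (For 3 (For 4 (SetCell (Mat ri rj) ?e))) (St d t m p (F d 0) S)"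
  proof (rule triple_For[OF d_le_W])
    fix i assume i: "i < d"
    have "triple d x M W (\<lambda>s. St d t m p (F i 0) S s \<and> reg s 3 = i) (5 + d * (43 + 7))
        (For 4 (SetCell (Mat ri rj) ?e)) (\<lambda>s. St d t m p (F i d) S s \<and> reg s 3 = i)"
    proof (rule triple_For[OF d_le_W])
      fix j assume j: "j < d"
      show "triple d x M W (\<lambda>s. (St d t m p (F i j) S s \<and> reg s 3 = i) \<and> reg s 4 = j) 43
        (SetCell (Mat ri rj) ?e) (\<lambda>s. (St d t m p (F i (Suc j)) S s \<and> reg s 3 = i) \<and> reg s 4 = j)"
      proof (rule triple_weaken[OF triple_store[where r = "7 + i" and j = j and f = "F i j"
            and g = "F i (Suc j)" and B = "\<lambda>s. reg s 3 = i \<and> reg s 4 = j"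
            and y = "f (7 + i) j - f 2 i * f 4 j"]])
        fix s assume s: "(St d t m p (F i j) S s \<and> reg s 3 = i) \<and> reg s 4 = j"
        then have s1: "St d t m p (F i j) S s" by simp
        have "cell s (loc d (7 + i) j) = f (7 + i) j" "cell s (loc d 2 i) = f 2 i"
          "cell s (loc d 4 j) = f 4 j"
          using St_cell[OF s1 j] St_cell[OF s1 i] by (simp_all add: F_def)
        then show "St d t m p (F i j) S s \<and> ival d s (Mat ri rj) = loc d (7 + i) j \<and>
            raddr d s ?e \<subseteq> {..<M} \<and> rval d x s ?e = f (7 + i) j - f 2 i * f 4 j"
          using s i j by simp
      qed (use i j in \<open>auto simp: F_def\<close>)
    qed simp
    then show "triple d x M W (\<lambda>s. St d t m p (F i 0) S s \<and> reg s 3 = i) (5 + d * 50)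
        (For 4 (SetCell (Mat ri rj) ?e)) (\<lambda>s. St d t m p (F (Suc i) 0) S s \<and> reg s 3 = i)"
      by (rule triple_weaken) (auto simp: St_def F_def)
  qed simp
  then show ?thesis
    by (simp add: F0)
qed

lemma triple_pivot:
  assumes "p < d" "t \<le> W" "m < W"
  shows "triple d x M W (St d t m p f S)
     (4 + (2 + ((5 + d * 34) + (31 + (23 + (10 + ((5 + d * ((5 + d * 50) + 7)) + (5 + d * 50))))))))
     pivot (St d t (Suc m) p (pivoted f p) (insert t S))"
proof -
  define f1 where "f1 = f(4 := \<lambda>j. f (7 + p) j / f 2 p)"
  define f2 where "f2 = f1(4 := (f1 4)(p := f1 4 p + 1 / f 2 p))"
  define f3 where "f3 = f2(2 := (f 2)(p := f 2 p - 1))"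
  define f4 where "f4 = f3(3 := (f 3)(p := 4))"
  define f5 where "f5 k j = (if 7 \<le> k \<and> k < 7 + d then f4 k j - f4 2 (k - 7) * f4 4 j else f4 k j)" for k j
  \<comment> \<open>Here the two stores into row \<open>4\<close>, the quotient and the contribution
    of the identity part, are merged.\<close>
  have f6: "f5(5 := \<lambda>j. f5 5 j + shifted f5 j) = pivoted f p"
    by (auto simp: f5_def f4_def f3_def f2_def f1_def pivoted_def pivot_row_def shifted_def
        fun_eq_iff add_divide_distrib)
  have 1: "triple d x M W (St d t m p f S) 4 (SetReg 1 (IAdd (IReg 1) (INum 1))) (St d t (Suc m) p f S)"
    by (rule triple_weaken[OF triple_SetReg[where A = "St d t m p f S"]])
      (use assms in \<open>auto simp: St_def\<close>)
  let ?S = "insert t S"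
  have 2: "triple d x M W (St d t (Suc m) p f S) 2 (Insert_Index (IReg 0)) (St d t (Suc m) p f ?S)"
    by (rule triple_weaken[OF triple_Insert[where A = "St d t (Suc m) p f S"]]) (auto simp: St_def)
  have 3: "triple d x M W (St d t (Suc m) p f ?S) (5 + d * 34)
      (For 4 (SetCell (Row 4 rj) (RDiv (RCell (Mat rp rj)) (RCell (Row 2 rp)))))
      (St d t (Suc m) p f1 ?S)"
  proof -
    have "triple d x M W (St d t (Suc m) p f ?S)
        (5 + d * (rcost (RDiv (RCell (Mat rp rj)) (RCell (Row 2 rp))) + 15))
      (For 4 (SetCell (Row 4 rj) (RDiv (RCell (Mat rp rj)) (RCell (Row 2 rp)))))
      (St d t (Suc m) p f1 ?S)"
      unfolding f1_def
    proof (rule triple_store_row)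
      fix s j g assume a: "St d t (Suc m) p g ?S s" "reg s 4 = j" "j < d"
        and g: "\<And>k i. i < d \<Longrightarrow> k \<noteq> 4 \<or> j \<le> i \<Longrightarrow> g k i = f k i"
      show "raddr d s (RDiv (RCell (Mat rp rj)) (RCell (Row 2 rp))) \<subseteq> {..<M} \<and>
          rval d x s (RDiv (RCell (Mat rp rj)) (RCell (Row 2 rp))) = f (7 + p) j / f 2 p"
        using a assms(1) St_cell[OF a(1)] g by (simp add: St_regs)
    qed auto
    then show ?thesis by (rule triple_weaken) auto
  qed
  have 4: "triple d x M W (St d t (Suc m) p f1 ?S) 31
      (SetCell (Row 4 rp) (RAdd (RCell (Row 4 rp)) (RDiv (RNum 1) (RCell (Row 2 rp)))))
      (St d t (Suc m) p f2 ?S)"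
    by (rule triple_weaken[OF triple_store[where r = 4 and j = p and f = f1 and g = f2
           and B = "\<lambda>s. True" and y = "f1 4 p + 1 / f 2 p" and A = "St d t (Suc m) p f1 ?S"]])
      (use assms(1) in \<open>auto simp: f2_def f1_def St_regs St_cell\<close>)
  have 5: "triple d x M W (St d t (Suc m) p f2 ?S) 23
      (SetCell (Row 2 rp) (RSub (RCell (Row 2 rp)) (RNum 1))) (St d t (Suc m) p f3 ?S)"
    by (rule triple_weaken[OF triple_store[where r = 2 and j = p and f = f2 and g = f3
           and B = "\<lambda>s. True" and y = "f 2 p - 1" and A = "St d t (Suc m) p f2 ?S"]])
      (use assms(1) in \<open>auto simp: f3_def f2_def f1_def St_regs St_cell\<close>)
  have 6: "triple d x M W (St d t (Suc m) p f3 ?S) 10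
      (SetCell (Row 3 rp) (RNum 4)) (St d t (Suc m) p f4 ?S)"
    by (rule triple_weaken[OF triple_store[where r = 3 and j = p and f = f3 and g = f4
           and B = "\<lambda>s. True" and y = 4 and A = "St d t (Suc m) p f3 ?S"]])
      (use assms(1) in \<open>auto simp: f4_def f3_def f2_def f1_def St_regs St_cell\<close>)
  have "(\<lambda>k j. if 7 \<le> k \<and> k < 7 + d then f4 k j - f4 2 (k - 7) * f4 4 j else f4 k j) = f5"
    by (simp add: f5_def fun_eq_iff)
  note 7 = triple_update_matrix[of t "Suc m" p f4 ?S, unfolded this]
  have 8: "triple d x M W (St d t (Suc m) p f5 ?S) (5 + d * 50)
      (For 4 (SetCell (Row 5 rj) (RAdd (RCell (Row 5 rj)) (In rj))))
      (St d t (Suc m) p (pivoted f p) ?S)"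
  proof -
    have "triple d x M W (St d t (Suc m) p f5 ?S) (5 + d * (rcost (RAdd (RCell (Row 5 rj)) (In rj)) + 15))
      (For 4 (SetCell (Row 5 rj) (RAdd (RCell (Row 5 rj)) (In rj))))
      (St d t (Suc m) p (pivoted f p) ?S)"
      unfolding f6[symmetric]
    proof (rule triple_store_row)
      fix s j g assume a: "St d t (Suc m) p g ?S s" "reg s 4 = j" "j < d"
        and g: "\<And>k i. i < d \<Longrightarrow> k \<noteq> 5 \<or> j \<le> i \<Longrightarrow> g k i = f5 k i"
      have "rval d x s (In rj) = shifted f5 j" "raddr d s (In rj) \<subseteq> {..<M}"
        by (intro In_eval[OF a(1) _ a(3)]; simp add: a g)+
      then show "raddr d s (RAdd (RCell (Row 5 rj)) (In rj)) \<subseteq> {..<M} \<and>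
          rval d x s (RAdd (RCell (Row 5 rj)) (In rj)) = f5 5 j + shifted f5 j"
        using a g by (simp add: St_cell)
    qed auto
    then show ?thesis by (rule triple_weaken) auto
  qed
  show ?thesis
    unfolding pivot_def
    by (intro triple_Seq[OF 1] triple_Seq[OF 2] triple_Seq[OF 3] triple_Seq[OF 4] triple_Seq[OF 5]
        triple_Seq[OF 6] triple_Seq[OF 7] 8)
qed

lemma triple_write_output:
  "triple d x M W (St d t m p f S) ((5 + d * 50) + 20) write_output
    (\<lambda>s. St d t m p (f(0 := \<lambda>j. f 1 j + f 5 j / (2 * (real m + 1)))) S s \<and> cell s 0 = 1 / (5 + 4 * real m))"
proof -
  let ?f = "f(0 := \<lambda>j. f 1 j + f 5 j / (2 * (real m + 1)))"
  let ?e = "RAdd (RCell (Row 1 rj)) (RDiv (RCell (Row 5 rj)) (RIndex (IMul (INum 2) (IAdd (IReg 1) (INum 1)))))"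
  have "triple d x M W (St d t m p f S) (5 + d * (rcost ?e + 15))
      (For 4 (SetCell (Row 0 rj) ?e)) (St d t m p ?f S)"
  proof (rule triple_store_row)
    fix s j g assume a: "St d t m p g S s" "reg s 4 = j" "j < d"
      and g: "\<And>k i. i < d \<Longrightarrow> k \<noteq> 0 \<or> j \<le> i \<Longrightarrow> g k i = f k i"
    show "raddr d s ?e \<subseteq> {..<M} \<and> rval d x s ?e = f 1 j + f 5 j / (2 * (real m + 1))"
      using a g by (simp add: St_cell St_regs algebra_simps)
  qed auto
  then have 1: "triple d x M W (St d t m p f S) (5 + d * 50)
      (For 4 (SetCell (Row 0 rj) ?e)) (St d t m p ?f S)"
    by (rule triple_weaken) auto
  have "0 < M"
    by (rule le_less_trans[OF le0 loc_less_M[of 0 0]]) (use d_pos in auto)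
  have 2: "triple d x M W (St d t m p ?f S) 20
      (SetCell (INum 0) (RDiv (RNum 1) (RIndex (IAdd (INum 5) (IMul (INum 4) (IReg 1))))))
      (\<lambda>s. St d t m p ?f S s \<and> cell s 0 = 1 / (5 + 4 * real m))"
    by (rule triple_weaken[OF triple_SetCell[where A = "St d t m p ?f S"]])
      (use \<open>0 < M\<close> in \<open>auto simp: St_def loc_def\<close>)
  show ?thesis
    unfolding write_output_def by (rule triple_Seq[OF 1 2])
qed

text \<open>The assumption on row \<open>3\<close> keeps the thresholds below the sentinel, so that
  a failed search means that no slot qualifies.\<close>

lemma triple_coreset_program:
  assumes "t < W" "m < W" "\<forall>j<d. f 3 j \<le> 4"
  shows "triple d x M W (St d t m p f S) (2000 * d\<^sup>2) coreset_program
    (\<lambda>s. \<exists>m' p' f' S'. St d (Suc t) m' p' f' S' s \<and> cell s 0 = 1 / (5 + 4 * real m') \<and>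
      step_rel d x t m f S m' f' S')"
proof -
  define f0 where "f0 = (if Suc t < 2 then f(1 := Poly_Mapping.lookup x) else f)"
  define f1 where "f1 = f0(2 := coords f0)"
  define pk where "pk = pick (f1 3) (f1 2) d"
  define p1 where "p1 = snd pk"
  define f2 where "f2 = f1(6 := (f1 6)(0 := fst pk))"
  define piv where "piv \<longleftrightarrow> fst pk < 5"
  define m' where "m' = (if piv then Suc m else m)"
  define f3 where "f3 = (if piv then pivoted f2 p1 else f2)"
  define S1 where "S1 = insert 1 S"
  define S' where "S' = (if piv then insert (Suc t) S1 else S1)"
  define f' where "f' = f3(0 := \<lambda>j. f3 1 j + f3 5 j / (2 * (real m' + 1)))"
  let ?Tp = "4 + (2 + ((5 + d * 34) + (31 + (23 + (10 + ((5 + d * ((5 + d * 50) + 7)) + (5 + d * 50)))))))"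
  have 1: "triple d x M W (St d t m p f S) 4 (SetReg 0 (IAdd (IReg 0) (INum 1))) (St d (Suc t) m p f S)"
    by (rule triple_weaken[OF triple_SetReg[where A = "St d t m p f S"]])
      (use assms in \<open>auto simp: St_def\<close>)
  note 2 = triple_load_first[of "Suc t" m p f S, folded f0_def]
  have 3: "triple d x M W (St d (Suc t) m p f0 S) 2 (Insert_Index (INum 1)) (St d (Suc t) m p f0 S1)"
    by (rule triple_weaken[OF triple_Insert[where A = "St d (Suc t) m p f0 S"]])
      (auto simp: St_def S1_def)
  note 4 = triple_compute_coordinates[of "Suc t" m p f0 S1, folded f1_def]
  note 5 = triple_find_pivot[of "Suc t" m p f1 S1, folded pk_def, folded p1_def f2_def]
  have p1: "p1 < d" "f1 3 p1 = fst pk" "f1 3 p1 < f1 2 p1 * f1 2 p1" if piv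
    using pick_props(1)[of "f1 3" "f1 2" d] that by (auto simp: piv_def pk_def p1_def)
  have pk_le: "fst pk \<le> f1 3 j" if "j < d" "f1 3 j < f1 2 j * f1 2 j" for j
    using pick_props(2)[of j d "f1 3" "f1 2"] that by (simp add: pk_def)
  let ?b = "RLess (RCell (Row 6 (INum 0))) (RNum 5)"
  have b: "bval d x s ?b \<longleftrightarrow> piv" "baddr d s ?b \<subseteq> {..<M}" if "St d (Suc t) m p1 f2 S1 s" for s
    using St_cell[OF that, of 0 6] d_pos by (auto simp: f2_def piv_def)
  have 6: "triple d x M W (St d (Suc t) m p1 f2 S1) (bcost ?b + ?Tp) (Cond ?b pivot Skip)
      (St d (Suc t) m' p1 f3 S')"
  proof (rule triple_Cond)
    show "triple d x M W (\<lambda>s. St d (Suc t) m p1 f2 S1 s \<and> bval d x s ?b) ?Tp pivot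
        (St d (Suc t) m' p1 f3 S')"
    proof (cases piv)
      case True
      show ?thesis
        by (rule triple_weaken[OF triple_pivot[of p1 "Suc t" m f2 S1]])
          (use True p1 assms in \<open>auto simp: m'_def f3_def S'_def\<close>)
    next
      case False
      then show ?thesis using b by (auto simp: triple_def)
    qed
    show "triple d x M W (\<lambda>s. St d (Suc t) m p1 f2 S1 s \<and> \<not> bval d x s ?b) ?Tp Skip
        (St d (Suc t) m' p1 f3 S')"
    proof (cases piv)
      case True
      then show ?thesis using b by (auto simp: triple_def)
    next
      case False
      show ?thesis
        by (rule triple_weaken[OF triple_Skip[where A = "St d (Suc t) m p1 f2 S1"]])
          (use False in \<open>auto simp: m'_def f3_def S'_def\<close>)
    qed
  qed (use b in blast)
  note 7 = triple_write_output[of "Suc t" m' p1 f3 S', folded f'_def]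
  have row1: "f3 1 = (if t = 0 then Poly_Mapping.lookup x else f 1)"
    by (auto simp: f3_def pivoted_def fun_eq_iff f2_def f1_def f0_def)
  have f0: "f0 3 = f 3" "f0 5 = f 5" "\<And>i. f0 (7 + i) = f (7 + i)" "f0 1 = f3 1"
    using row1 by (auto simp: f0_def)
  have sh: "shifted f2 = (\<lambda>j. Poly_Mapping.lookup x j - f3 1 j)" "shifted f0 = shifted f2"
    using f0 by (auto simp: shifted_def fun_eq_iff f2_def f1_def)
  have c: "f2 2 = (\<lambda>i. shifted f2 i + (\<Sum>j<d. f (7 + i) j * shifted f2 j))"
    using f0 sh by (simp add: f2_def f1_def coords_def fun_eq_iff)
  have rows: "f2 3 = f 3" "f2 5 = f 5" "\<And>i. f2 (7 + i) = f (7 + i)" "f1 3 = f 3" "f1 2 = f2 2"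
    using f0 by (auto simp: f2_def f1_def)
  have rel: "step_rel d x t m f S m' f' S'"
    unfolding step_rel_def
  proof (rule exI[of _ "f3 1"], rule exI[of _ "shifted f2"], rule exI[of _ "f2 2"], intro conjI)
    let ?skip = "(\<forall>j<d. f2 2 j * f2 2 j \<le> f 3 j) \<and> m' = m \<and> f' 3 = f 3 \<and> f' 5 = f 5 \<and>
      (\<forall>i<d. f' (7 + i) = f (7 + i)) \<and> S' = insert 1 S"
    let ?pivot = "\<exists>p<d. f 3 p < f2 2 p * f2 2 p \<and> (\<forall>j<d. f 3 j < f2 2 j * f2 2 j \<longrightarrow> f 3 p \<le> f 3 j) \<and>
      m' = Suc m \<and> f' 3 = (f 3)(p := 4) \<and> f' 5 = (\<lambda>j. f 5 j + shifted f2 j) \<and>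
      (\<forall>i<d. \<forall>j. f' (7 + i) j = f (7 + i) j -
        (f2 2 i - of_bool (i = p)) * ((f (7 + p) j + of_bool (j = p)) / f2 2 p)) \<and>
      S' = insert (Suc t) (insert 1 S)"
    show "step_update d t m f S (shifted f2) (f2 2) m' f' S'"
    proof (cases piv)
      case True
      have ?pivot
      proof (intro exI[of _ p1] conjI)
        show "f 3 p1 < f2 2 p1 * f2 2 p1" "\<forall>j<d. f 3 j < f2 2 j * f2 2 j \<longrightarrow> f 3 p1 \<le> f 3 j"
          using True p1 pk_le rows by auto
        show "f' 3 = (f 3)(p1 := 4)" "f' 5 = (\<lambda>j. f 5 j + shifted f2 j)"
          using True rows by (auto simp: f'_def f3_def pivoted_def fun_eq_iff)
        show "\<forall>i<d. \<forall>j. f' (7 + i) j = f (7 + i) j -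
            (f2 2 i - of_bool (i = p1)) * ((f (7 + p1) j + of_bool (j = p1)) / f2 2 p1)"
          using True rows by (auto simp: f'_def f3_def pivoted_def pivot_row_def)
      qed (use True p1 in \<open>auto simp: m'_def S'_def S1_def\<close>)
      then show ?thesis unfolding step_update_def by (rule disjI2)
    next
      case False
      have "f2 2 j * f2 2 j \<le> f 3 j" if "j < d" for j
        using False pk_le[OF that] assms(3) that rows by (force simp: piv_def)
      then have ?skip
        using False rows by (auto simp: f'_def f3_def m'_def S'_def S1_def)
      then show ?thesis unfolding step_update_def by (rule disjI1)
    qed
  qed (use row1 sh c in \<open>auto simp: f'_def\<close>)
  have "triple d x M W (St d t m p f S)
     (4 + ((3 + (5 + d * 17)) + (2 + ((5 + d * (20 + (5 + d * 50) + 7)) + ((2 + (9 + (5 + d * 70))) +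
      ((bcost ?b + ?Tp) + ((5 + d * 50) + 20)))))))
     coreset_program (\<lambda>s. St d (Suc t) m' p1 f' S' s \<and> cell s 0 = 1 / (5 + 4 * real m'))"
    unfolding coreset_program_def
    by (intro triple_Seq[OF 1] triple_Seq[OF 2] triple_Seq[OF 3] triple_Seq[OF 4] triple_Seq[OF 5]
        triple_Seq[OF 6] 7)
  then show ?thesis
  proof (rule triple_weaken)
    \<comment> \<open>The coordinates and the rank-one update contribute
      \<open>100 * d\<^sup>2\<close>; linear and constant terms are absorbed because
      \<open>d\<close> is positive.\<close>
    have "d \<le> d\<^sup>2" "1 \<le> d\<^sup>2" using d_pos by (simp_all add: power2_eq_square)
    moreover have "d * (d * 50) = 50 * d\<^sup>2" by (simp add: power2_eq_square)
    ultimately show "4 + ((3 + (5 + d * 17)) + (2 + ((5 + d * (20 + (5 + d * 50) + 7)) +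
       ((2 + (9 + (5 + d * 70))) + ((bcost ?b + ?Tp) + ((5 + d * 50) + 20)))))) \<le> 2000 * d\<^sup>2"
      by (simp add: add_mult_distrib2)
  qed (use rel in blast)+
qed

end

section \<open>Inscribed and enclosing balls\<close>

definition nrm :: "nat \<Rightarrow> point \<Rightarrow> real" where
  "nrm d x = sqrt (ip d x x)"

lemma nrm_nonneg [simp]: "0 \<le> nrm d x"
  by (simp add: nrm_def)

lemma nrm_power2: "(nrm d x)\<^sup>2 = ip d x x"
  by (simp add: nrm_def)

lemma nrm_scale [simp]: "nrm d (a *\<^sub>R x) = \<bar>a\<bar> * nrm d x"
  by (simp add: nrm_def real_sqrt_mult mult.assoc[symmetric])

lemma nrm_triangle: "nrm d (x + y) \<le> nrm d x + nrm d y"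
  using L2_set_triangle_ineq[of "Poly_Mapping.lookup x" "Poly_Mapping.lookup y" "{..<d}"]
  by (simp only: nrm_def L2_set_eq_ip[symmetric] plus_poly_mapping.rep_eq)

lemma nrm_minus [simp]: "nrm d (- x) = nrm d x"
  by (simp add: nrm_def ip_def)

lemma nrm_triangle_diff: "nrm d (x - y) \<le> nrm d x + nrm d y"
  using nrm_triangle[of d x "- y"] by simp

lemma nrm_eq_0_iff: "x \<in> Rd d \<Longrightarrow> nrm d x = 0 \<longleftrightarrow> x = 0"
  by (simp add: nrm_def ip_eq_0_iff)

lemma unit_ball_iff: "x \<in> unit_ball d \<longleftrightarrow> x \<in> Rd d \<and> nrm d x \<le> 1"
  by (simp add: unit_ball_def nrm_def L2_set_eq_ip)

lemma lookup_unit_ball: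
  assumes "u \<in> unit_ball d" "j < d"
  shows "\<bar>Poly_Mapping.lookup u j\<bar> \<le> 1"
proof -
  have "\<bar>Poly_Mapping.lookup u j\<bar> \<le> L2_set (\<lambda>j. \<bar>Poly_Mapping.lookup u j\<bar>) {..<d}"
    using assms(2) by (intro member_le_L2_set) auto
  also have "\<dots> = L2_set (Poly_Mapping.lookup u) {..<d}"
    by (simp add: L2_set_def)
  also have "\<dots> \<le> 1"
    using assms(1) by (simp add: unit_ball_def)
  finally show ?thesis .
qed

text \<open>The missing weight \<open>1 - sum w F\<close> goes to \<open>a\<close>.\<close>

lemma sum_in_convex_hull:
  assumes "finite F" "\<And>s. s \<in> F \<Longrightarrow> 0 \<le> w s" "sum w F \<le> 1"
  shows "a + (\<Sum>s\<in>F. w s *\<^sub>R (g s - a)) \<in> convex hull (insert a (g ` F))"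
proof -
  let ?C = "convex hull (insert a (g ` F))"
  have "a + (\<Sum>s\<in>F. w s *\<^sub>R (g s - a)) = (1 - sum w F) *\<^sub>R a + (\<Sum>s\<in>F. w s *\<^sub>R g s)"
    by (simp add: algebra_simps sum_subtractf scaleR_sum_left)
  moreover have "\<dots> \<in> ?C"
  proof (cases "sum w F = 0")
    case True
    then have "\<forall>s\<in>F. w s = 0"
      using assms by (simp add: sum_nonneg_eq_0_iff)
    then show ?thesis using True by (simp add: hull_inc)
  next
    case False
    then have pos: "0 < sum w F"
      using assms(2) by (simp add: less_le sum_nonneg)
    have "(\<Sum>s\<in>F. (w s / sum w F) *\<^sub>R g s) \<in> ?C"
      using assms pos by (intro convex_sum) (auto simp: sum_divide_distrib[symmetric] hull_inc)
    moreover have "a \<in> ?C" by (simp add: hull_inc)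
    ultimately have "(1 - sum w F) *\<^sub>R a + sum w F *\<^sub>R (\<Sum>s\<in>F. (w s / sum w F) *\<^sub>R g s) \<in> ?C"
      using assms pos by (intro convexD[OF convex_convex_hull]) auto
    then show ?thesis
      using pos by (simp add: scaleR_sum_right)
  qed
  ultimately show ?thesis by simp
qed

lemma dilate_convex: "convex A \<Longrightarrow> convex (dilate c a A)"
  using convex_affinity[of A "c - a *\<^sub>R c" a] by (simp add: dilate_def algebra_simps)

text \<open>The dilation moves \<open>y\<close> to \<open>x\<close>, and the \<open>v s\<close> are
  the weights of \<open>y\<close>. Their nonnegativity for \<open>l s = -2\<close> requires
  \<open>w * A \<ge> 2 + w\<close>, which for \<open>w = 1 / (2 * (m + 1))\<close> means exactly
  \<open>A \<ge> 5 + 4 * m\<close>; this is the origin of the scaling factor.\<close>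

lemma in_dilated_hull:
  fixes a c x :: point
  assumes "finite F" "x = a + (\<Sum>s\<in>F. l s *\<^sub>R (g s - a))" "\<And>s. s \<in> F \<Longrightarrow> \<bar>l s\<bar> \<le> 2"
    and c: "c = a + (1 / (2 * (real (card F) + 1))) *\<^sub>R (\<Sum>s\<in>F. g s - a)"
  shows "x \<in> dilate c (5 + 4 * real (card F)) (convex hull (insert a (g ` F)))"
proof -
  define m where "m = real (card F)"
  define w where "w = 1 / (2 * (m + 1))"
  define A where "A = 5 + 4 * m"
  define v where "v s = w + (l s - w) / A" for s
  have m: "0 \<le> m" by (simp add: m_def)
  have A: "0 < A" "1 \<le> A" using m by (auto simp: A_def)
  have wA: "w * A = 2 + w" using m by (simp add: w_def A_def field_simps)
  define y where "y = a + (\<Sum>s\<in>F. v s *\<^sub>R (g s - a))"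
  have "y \<in> convex hull (insert a (g ` F))"
    unfolding y_def
  proof (rule sum_in_convex_hull[OF assms(1)])
    fix s assume "s \<in> F"
    then have "l s \<ge> -2" using assms(3)[of s] by simp
    then have "0 \<le> w * A + (l s - w)" using wA by simp
    then show "0 \<le> v s" using A by (simp add: v_def field_simps)
  next
    have "sum v F = m * w - m * w / A + sum l F / A"
      by (simp add: v_def m_def sum.distrib sum_divide_distrib[symmetric] sum_subtractf diff_divide_distrib)
    also have "\<dots> \<le> m * w + 2 * m / A"
    proof -
      have "sum l F \<le> (\<Sum>s\<in>F. 2)"
        using assms(3) by (intro sum_mono) (metis abs_le_D1)
      then have "sum l F / A \<le> 2 * m / A"
        using A by (intro divide_right_mono) (auto simp: m_def)
      moreover have "0 \<le> m * w / A" using m A by (simp add: w_def)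
      ultimately show ?thesis by linarith
    qed
    \<comment> \<open>Leaving half of the weight to \<open>a\<close> in the center makes room for
      the second summand, \<open>2 * m / A\<close>, which is below 1/2 as well.\<close>
    also have "\<dots> \<le> 1 / 2 + 1 / 2"
      using m A by (intro add_mono) (auto simp: w_def A_def field_simps)
    finally show "sum v F \<le> 1" by simp
  qed
  moreover have "x = c + A *\<^sub>R (y - c)"
  proof -
    have "A * v s = A * w + (l s - w)" for s
      using A by (simp add: v_def field_simps)
    then have "A *\<^sub>R y = A *\<^sub>R a + (\<Sum>s\<in>F. (A * w + (l s - w)) *\<^sub>R (g s - a))"
      by (simp add: y_def scaleR_add_right scaleR_sum_right)
    also have "(\<Sum>s\<in>F. (A * w + (l s - w)) *\<^sub>R (g s - a)) =
        (\<Sum>s\<in>F. ((A - 1) * w) *\<^sub>R (g s - a) + l s *\<^sub>R (g s - a))"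
      by (intro sum.cong) (auto simp: algebra_simps)
    also have "\<dots> = ((A - 1) * w) *\<^sub>R (\<Sum>s\<in>F. g s - a) + (x - a)"
      by (simp only: sum.distrib scaleR_sum_right assms(2) add_diff_cancel_left')
    also have "c = a + w *\<^sub>R (\<Sum>s\<in>F. g s - a)"
      by (simp add: c w_def m_def)
    then have "((A - 1) * w) *\<^sub>R (\<Sum>s\<in>F. g s - a) = (A - 1) *\<^sub>R (c - a)"
      by simp
    finally show ?thesis by (simp add: algebra_simps)
  qed
  ultimately show ?thesis
    unfolding dilate_def A_def m_def by blast
qed

section \<open>Enclosing balls and the pyramid bound\<close>

text \<open>Only the outer half of \<open>sandwiched\<close>. It passes to subsets, so that an
  enclosing ball at time \<open>t\<close> serves for all earlier prefixes.\<close>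

definition enclosed :: "nat \<Rightarrow> point set \<Rightarrow> real \<Rightarrow> bool" where
  "enclosed d X R \<longleftrightarrow> 0 \<le> R \<and> (\<exists>c\<in>Rd d. convex hull X \<subseteq> (\<lambda>u. c + R *\<^sub>R u) ` unit_ball d)"

lemma sandwiched_enclosed: "sandwiched d X c r R \<Longrightarrow> enclosed d X R"
  by (auto simp: sandwiched_def enclosed_def)

lemma enclosed_mono: "enclosed d X R \<Longrightarrow> Y \<subseteq> X \<Longrightarrow> enclosed d Y R"
  unfolding enclosed_def by (meson hull_mono order_trans)

lemma enclosed_dist:
  assumes "enclosed d X R" "x \<in> convex hull X" "y \<in> convex hull X"
  shows "nrm d (x - y) \<le> 2 * R"
proof -
  obtain c where R: "0 \<le> R" "convex hull X \<subseteq> (\<lambda>u. c + R *\<^sub>R u) ` unit_ball d"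
    using assms(1) by (auto simp: enclosed_def)
  obtain u v where uv: "u \<in> unit_ball d" "x = c + R *\<^sub>R u" "v \<in> unit_ball d" "y = c + R *\<^sub>R v"
    using R assms(2,3) by blast
  have "x - y = R *\<^sub>R (u - v)" using uv by (simp add: algebra_simps)
  moreover have "nrm d (u - v) \<le> 2"
    using nrm_triangle_diff[of d u v] uv by (simp add: unit_ball_iff)
  ultimately show ?thesis
    using R(1) mult_left_mono[of "nrm d (u - v)" 2 R] by (simp add: mult.commute)
qed

text \<open>Both radii range over complete sandwiches, so an inscribed ball counts only together
  with an enclosing ball of the same center. For a finite set a large enough radius always
  works.\<close>

lemma sandwiched_exists:
  assumes "finite X" "c \<in> convex hull X" "X \<subseteq> Rd d" "0 \<le> r"
    and "(\<lambda>u. c + r *\<^sub>R u) ` (unit_ball d \<inter> span ((\<lambda>x. x - c) ` X)) \<subseteq> convex hull X"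
  shows "\<exists>R. sandwiched d X c r R"
proof -
  \<comment> \<open>The summand 1 makes \<open>R\<close> positive even if \<open>X\<close> is a
    single point.\<close>
  define R where "R = 1 + (\<Sum>x\<in>X. nrm d (x - c))"
  have R: "1 \<le> R" by (simp add: R_def sum_nonneg)
  have hull_Rd: "convex hull X \<subseteq> Rd d"
    using assms(3) convex_Rd by (intro hull_minimal)
  then have c: "c \<in> Rd d" using assms(2) by blast
  let ?B = "{x \<in> Rd d. nrm d (x - c) \<le> R}"
  have "convex ?B"
  proof (rule convexI)
    fix x y and u v :: real
    assume xy: "x \<in> ?B" "y \<in> ?B" and uv: "0 \<le> u" "0 \<le> v" "u + v = 1"
    have "u *\<^sub>R x + v *\<^sub>R y - c = u *\<^sub>R (x - c) + v *\<^sub>R (y - c) + (u + v - 1) *\<^sub>R c"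
      by (simp add: algebra_simps)
    then have "nrm d (u *\<^sub>R x + v *\<^sub>R y - c) \<le> u * nrm d (x - c) + v * nrm d (y - c)"
      using nrm_triangle[of d "u *\<^sub>R (x - c)" "v *\<^sub>R (y - c)"] uv by simp
    also have "\<dots> \<le> u * R + v * R"
      using xy uv by (intro add_mono mult_left_mono) auto
    also have "\<dots> = R" using uv by (simp flip: distrib_right)
    finally show "u *\<^sub>R x + v *\<^sub>R y \<in> ?B" using xy by simp
  qed
  moreover have "X \<subseteq> ?B"
  proof
    fix x assume x: "x \<in> X"
    have "nrm d (x - c) \<le> (\<Sum>x\<in>X. nrm d (x - c))"
      using assms(1) x by (intro member_le_sum) auto
    then show "x \<in> ?B" using x assms(3) by (auto simp: R_def)
  qed
  ultimately have sub: "convex hull X \<subseteq> ?B" by (intro hull_minimal)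
  have "convex hull X \<subseteq> (\<lambda>u. c + R *\<^sub>R u) ` unit_ball d"
  proof
    fix x assume "x \<in> convex hull X"
    then have x: "x \<in> Rd d" "nrm d (x - c) \<le> R" using sub by auto
    show "x \<in> (\<lambda>u. c + R *\<^sub>R u) ` unit_ball d"
    proof (rule image_eqI)
      show "x = c + R *\<^sub>R ((1 / R) *\<^sub>R (x - c))" using R by simp
      have "nrm d ((1 / R) *\<^sub>R (x - c)) \<le> 1"
        using x R by (simp only: nrm_scale) (simp add: divide_le_eq)
      then show "(1 / R) *\<^sub>R (x - c) \<in> unit_ball d"
        using x c by (simp only: unit_ball_iff Rd_diff Rd_scale)
    qed
  qed
  then have "sandwiched d X c r R"
    using assms c R by (simp add: sandwiched_def)
  then show ?thesis ..
qed

text \<open>The new point is the apex of a pyramid over the old hull whose height is the length of the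
  residual, so an inscribed ball has at most this diameter. Comparing the slice of the pyramid
  through the center of the ball with its base shows that the ball is also smaller, by a constant
  factor, than any enclosing ball.\<close>

lemma inner_radius_pyramid:
  fixes X :: "point set"
  assumes X: "X \<subseteq> Rd d" "a \<in> X" "x \<in> Rd d"
    and r: "r \<in> Rd d" "r \<noteq> 0" "x - a - r \<in> span ((\<lambda>y. y - a) ` X)" "\<And>y. y \<in> X \<Longrightarrow> ip d r (y - a) = 0"
  shows "inner_radius d (insert x X) \<le> ereal (nrm d r / 2)"
    and "(\<exists>b\<in>X. b \<noteq> a) \<Longrightarrow> enclosed d (insert x X) R \<Longrightarrow> inner_radius d (insert x X) \<le> ereal (2 * R / 3)"
proof -
  let ?X = "insert x X"
  define e where "e = nrm d r"
  have e: "0 < e"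
    using r(1,2) nrm_eq_0_iff[of r d] nrm_nonneg[of d r] by (simp add: e_def less_le)
  have ee: "ip d r r = e * e"
    using nrm_power2[of d r] by (simp add: e_def power2_eq_square)
  define u where "u = (1 / e) *\<^sub>R r"
  have u: "u \<in> Rd d" "ip d u u = 1" using r(1) e ee by (simp_all add: u_def)
  \<comment> \<open>The height above the base: 0 on the old hull and \<open>e\<close> at the apex
    \<open>x\<close>.\<close>
  define h where "h y = ip d (y - a) u" for y
  have h_X: "h y = 0" if "y \<in> X" for y
    using r(4)[OF that] by (simp add: h_def u_def ip_commute[of d _ r])
  have h_x: "h x = e"
  proof -
    have "ip d r (x - a - r) = 0"
      by (rule ip_orthogonal_span[OF _ r(3)]) (use r(4) in auto)
    then have "ip d r (x - a) = e * e" using ee by simp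
    then have "ip d (x - a) r = e * e" by (simp only: ip_commute[of d _ r])
    then show ?thesis using e by (simp add: h_def u_def)
  qed
  have h_affine: "h (p *\<^sub>R y + q *\<^sub>R w) = p * h y + q * h w" if "p + q = 1" for p q y w
  proof -
    have "p *\<^sub>R y + q *\<^sub>R w - a = p *\<^sub>R (y - a) + q *\<^sub>R (w - a) + (p + q - 1) *\<^sub>R a"
      by (simp add: algebra_simps)
    then show ?thesis using that by (simp add: h_def del: ip_diff)
  qed
  have h_hull_X: "h y = 0" if "y \<in> convex hull X" for y
  proof -
    have "convex {y. h y = 0}" by (rule convexI) (simp add: h_affine)
    then have "convex hull X \<subseteq> {y. h y = 0}" using h_X by (intro hull_minimal) auto
    then show ?thesis using that by auto
  qed
  have h_hull: "0 \<le> h y \<and> h y \<le> e" if "y \<in> convex hull ?X" for y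
  proof -
    have "convex {y. 0 \<le> h y \<and> h y \<le> e}"
    proof (rule convexI)
      fix y w and p q :: real
      assume yw: "y \<in> {y. 0 \<le> h y \<and> h y \<le> e}" "w \<in> {y. 0 \<le> h y \<and> h y \<le> e}"
        and pq: "0 \<le> p" "0 \<le> q" "p + q = 1"
      have "p * h y + q * h w \<le> p * e + q * e" using yw pq by (intro add_mono mult_left_mono) auto
      also have "\<dots> = e" using pq by (simp flip: distrib_right)
      finally show "p *\<^sub>R y + q *\<^sub>R w \<in> {y. 0 \<le> h y \<and> h y \<le> e}"
        using yw pq by (simp add: h_affine)
    qed
    then have "convex hull ?X \<subseteq> {y. 0 \<le> h y \<and> h y \<le> e}"
      using h_X h_x e by (intro hull_minimal) auto
    then show ?thesis using that by auto
  qed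
  \<comment> \<open>\<open>sandwiched\<close> takes directions relative to the center of the ball,
    whereas the residual is known in directions relative to \<open>a\<close>.\<close>
  have span_c: "v \<in> span ((\<lambda>y. y - c) ` ?X)" if "v \<in> span ((\<lambda>y. y - a) ` ?X)" for v c
  proof -
    have "y - a \<in> span ((\<lambda>y. y - c) ` ?X)" if "y \<in> ?X" for y
      using span_diff[of "y - c" "(\<lambda>y. y - c) ` ?X" "a - c"] that X(2) by (auto intro: span_base)
    then have "span ((\<lambda>y. y - a) ` ?X) \<subseteq> span ((\<lambda>y. y - c) ` ?X)"
      by (intro span_minimal) auto
    then show ?thesis using that by blast
  qed
  have sub: "span ((\<lambda>y. y - a) ` X) \<subseteq> span ((\<lambda>y. y - a) ` ?X)"
    by (intro span_mono) auto
  have "r \<in> span ((\<lambda>y. y - a) ` ?X)"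
    using span_diff[of "x - a" "(\<lambda>y. y - a) ` ?X" "x - a - r"] subsetD[OF sub r(3)]
    by (auto intro: span_base)
  then have u_span: "u \<in> span ((\<lambda>y. y - a) ` ?X)" "- u \<in> span ((\<lambda>y. y - a) ` ?X)"
    by (auto simp: u_def span_neg span_scale)
  have u_ball: "u \<in> unit_ball d" "- u \<in> unit_ball d"
    using u subspace_neg[OF subspace_Rd u(1)] by (auto simp: unit_ball_iff nrm_def ip_def)
  have pts: "c + r' *\<^sub>R v \<in> convex hull ?X"
    if "sandwiched d ?X c r' R'" "v \<in> unit_ball d" "v \<in> span ((\<lambda>y. y - a) ` ?X)" for c r' R' v
    using that span_c unfolding sandwiched_def by blast
  have h_shift: "h (c + p *\<^sub>R v) = h c + p * ip d v u" for c p v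
    by (simp add: h_def)
  \<comment> \<open>The ball reaches \<open>r'\<close> above and below its center, and heights in
    the pyramid lie between 0 and \<open>e\<close>.\<close>
  have bounds: "r' \<le> h c" "h c + r' \<le> e" if "sandwiched d ?X c r' R'" for c r' R'
    using h_hull[OF pts[OF that u_ball(1) u_span(1)]] h_hull[OF pts[OF that u_ball(2) u_span(2)]] u(2)
    by (simp_all only: h_shift) (simp_all add: ip_def sum_negf)
  show "inner_radius d ?X \<le> ereal (nrm d r / 2)"
    unfolding inner_radius_def
  proof (rule Sup_least)
    fix y assume "y \<in> {ereal r |r. \<exists>c R. sandwiched d ?X c r R}"
    then obtain r' c R' where y: "y = ereal r'" "sandwiched d ?X c r' R'" by blast
    then show "y \<le> ereal (nrm d r / 2)"
      using bounds[OF y(2)] by (simp add: e_def)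
  qed
  show "inner_radius d ?X \<le> ereal (2 * R / 3)"
    if "\<exists>b\<in>X. b \<noteq> a" and R: "enclosed d ?X R"
    unfolding inner_radius_def
  proof (rule Sup_least)
    fix y assume "y \<in> {ereal r |r. \<exists>c R. sandwiched d ?X c r R}"
    then obtain r' c R' where y: "y = ereal r'" and s: "sandwiched d ?X c r' R'" by blast
    obtain b where b: "b \<in> X" "b \<noteq> a" using \<open>\<exists>b\<in>X. b \<noteq> a\<close> by blast
    \<comment> \<open>A horizontal unit direction; it exists because the base is not a single
      point.\<close>
    define v where "v = (1 / nrm d (b - a)) *\<^sub>R (b - a)"
    have b_Rd: "b - a \<in> Rd d" using b X by auto
    have nb: "0 < nrm d (b - a)"
      using nrm_eq_0_iff[OF b_Rd] b nrm_nonneg[of d "b - a"] by (simp add: less_le)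
    have v: "nrm d v = 1" "v \<in> unit_ball d" "- v \<in> unit_ball d" "ip d v u = 0"
      using nb b_Rd subspace_neg[OF subspace_Rd] h_X[OF b(1)]
      by (auto simp: v_def unit_ball_iff h_def simp del: ip_diff scaleR_minus_left)
    have "v \<in> span ((\<lambda>y. y - a) ` ?X)" "- v \<in> span ((\<lambda>y. y - a) ` ?X)"
      using b by (auto simp: v_def span_neg span_scale span_base)
    then have cv: "c + r' *\<^sub>R v \<in> convex hull ?X" "c + r' *\<^sub>R (- v) \<in> convex hull ?X"
      using pts[OF s] v by blast+
    \<comment> \<open>The slice at height \<open>h y\<close> is a translated copy of the base,
      shrunk by \<open>1 - h y / e\<close>.\<close>
    have decomp: "\<exists>w\<in>convex hull X. y = (1 - h y / e) *\<^sub>R w + (h y / e) *\<^sub>R x"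
      if "y \<in> convex hull ?X" for y
    proof -
      obtain p q w where w: "0 \<le> p" "0 \<le> q" "p + q = 1" "w \<in> convex hull X" "y = p *\<^sub>R x + q *\<^sub>R w"
        using \<open>y \<in> convex hull ?X\<close> convex_hull_insert[of X x] X(2) by blast
      then have "h y = p * e" using h_affine[of p q x w] h_x h_hull_X by simp
      then have "p = h y / e" using e by simp
      moreover have "q = 1 - h y / e" using w(3) calculation by simp
      ultimately have "y = (h y / e) *\<^sub>R x + (1 - h y / e) *\<^sub>R w"
        using w(5) by metis
      then have "y = (1 - h y / e) *\<^sub>R w + (h y / e) *\<^sub>R x"
        by (metis add.commute)
      then show ?thesis using w(4) by blast
    qed
    have hc: "h (c + r' *\<^sub>R v) = h c" "h (c + r' *\<^sub>R (- v)) = h c"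
      using v(4) by (simp_all only: h_shift) (simp_all add: ip_def sum_negf)
    define l where "l = 1 - h c / e"
    obtain w1 w2 where w: "w1 \<in> convex hull X" "c + r' *\<^sub>R v = l *\<^sub>R w1 + (h c / e) *\<^sub>R x"
      "w2 \<in> convex hull X" "c + r' *\<^sub>R (- v) = l *\<^sub>R w2 + (h c / e) *\<^sub>R x"
      using decomp[OF cv(1)] decomp[OF cv(2)] hc by (auto simp: l_def)
    have r': "0 \<le> r'" using s by (simp add: sandwiched_def)
    \<comment> \<open>The center has height at least \<open>r'\<close>, so the slice through it is
      the base shrunk by at most \<open>1 - r' / e\<close>; a horizontal diameter of the ball has to
      fit into this slice.\<close>
    have l: "0 \<le> l" "l \<le> 1 - r' / e"
      using bounds[OF s] r' e by (auto simp: l_def field_simps)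
    have "(2 * r') *\<^sub>R v = (c + r' *\<^sub>R v) - (c + r' *\<^sub>R (- v))"
      by (simp add: algebra_simps flip: scaleR_2)
    also have "\<dots> = l *\<^sub>R (w1 - w2)"
      unfolding w(2,4) by (simp add: algebra_simps)
    finally have "2 * r' = l * nrm d (w1 - w2)"
      using nrm_scale[of d "2 * r'" v] r' v(1) l(1) by simp
    also have "nrm d (w1 - w2) \<le> 2 * R"
      using w(1,3) hull_mono[of X ?X convex] by (intro enclosed_dist[OF R]) auto
    then have "l * nrm d (w1 - w2) \<le> l * (2 * R)" using l(1) by (intro mult_left_mono)
    finally have 1: "r' \<le> l * R" by simp
    have R0: "0 \<le> R" using R by (simp add: enclosed_def)
    have "e \<le> nrm d (x - a)"
    proof -
      have "e * e = ip d r r" using ee by simp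
      have "e * e = ip d (x - a) r"
        using h_x e by (simp add: h_def u_def field_simps del: ip_diff)
      have "0 \<le> ip d (x - a - r) (x - a - r)" by (rule ip_nonneg)
      also have "\<dots> = ip d (x - a) (x - a) - 2 * ip d (x - a) r + ip d r r"
      proof -
        have "ip d (q - r) (q - r) = ip d q q - 2 * ip d q r + ip d r r" for q
          using ip_commute[of d q r] by simp
        then show ?thesis .
      qed
      finally have "e * e \<le> ip d (x - a) (x - a)"
        using \<open>e * e = ip d (x - a) r\<close> ee by linarith
      then show ?thesis
        using e by (simp add: nrm_def real_le_rsqrt power2_eq_square del: ip_diff)
    qed
    also have "\<dots> \<le> 2 * R"
      using X(2) by (intro enclosed_dist[OF R]) (auto intro: hull_inc)
    finally have eR: "e \<le> 2 * R" .
    \<comment> \<open>Since \<open>e \<le> 2 * R\<close>, the term \<open>r' * R / e\<close> is at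
      least \<open>r' / 2\<close>; solving \<open>r' \<le> R - r' / 2\<close> gives the constant
      2/3.\<close>
    have "l * R \<le> (1 - r' / e) * R" using l R0 by (intro mult_right_mono)
    also have "\<dots> \<le> R - r' / 2"
      using eR e r' mult_left_mono[OF eR, of r'] by (simp add: field_simps)
    finally show "y \<le> ereal (2 * R / 3)" using 1 y by simp
  qed
qed

section \<open>Invariants of the algorithm\<close>

text \<open>The functional given by row \<open>i\<close> of the identity plus \<open>N\<close>, that
  is, the coordinate belonging to slot \<open>i\<close>.\<close>

definition phi :: "nat \<Rightarrow> (nat \<Rightarrow> nat \<Rightarrow> real) \<Rightarrow> nat \<Rightarrow> point \<Rightarrow> real" where
  "phi d N i v = Poly_Mapping.lookup v i + (\<Sum>j<d. N i j * Poly_Mapping.lookup v j)"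

lemma phi_add [simp]: "phi d N i (u + v) = phi d N i u + phi d N i v"
  by (simp add: phi_def lookup_add algebra_simps sum.distrib)

lemma phi_scale [simp]: "phi d N i (a *\<^sub>R v) = a * phi d N i v"
  by (simp add: phi_def algebra_simps sum_distrib_left)

lemma phi_0 [simp]: "phi d N i 0 = 0"
  by (simp add: phi_def)

lemma phi_sum: "phi d N i (\<Sum>k\<in>I. g k) = (\<Sum>k\<in>I. phi d N i (g k))"
  by (induction I rule: infinite_finite_induct) simp_all

lemma phi_span:
  assumes "\<And>b. b \<in> B \<Longrightarrow> phi d N i b = 0" "x \<in> span B"
  shows "phi d N i x = 0"
  using assms(2) by (induction rule: span_induct_alt) (auto simp: assms(1))

text \<open>Expresses without matrices that the identity plus \<open>N\<close> is the inverse of the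
  basis matrix: the functionals are dual to \<open>b\<close> and expand every vector in it.\<close>

definition dual_basis :: "nat \<Rightarrow> (nat \<Rightarrow> nat \<Rightarrow> real) \<Rightarrow> (nat \<Rightarrow> point) \<Rightarrow> bool" where
  "dual_basis d N b \<longleftrightarrow> (\<forall>i<d. \<forall>p<d. phi d N i (b p) = of_bool (i = p)) \<and>
     (\<forall>x\<in>Rd d. x = (\<Sum>p<d. phi d N p x *\<^sub>R b p))"

lemma dual_basis_cong:
  assumes "\<And>i. i < d \<Longrightarrow> N i = N' i" "\<And>p. p < d \<Longrightarrow> b p = b' p"
  shows "dual_basis d N b \<longleftrightarrow> dual_basis d N' b'"
  unfolding dual_basis_def phi_def using assms by simp

text \<open>The stored rank-one update, read as the change of coordinates when \<open>y\<close>
  takes slot \<open>p\<close>: the new coordinate \<open>p\<close> is the old one divided by that of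
  \<open>y\<close>, and the other coordinates lose what \<open>y\<close> now accounts for.\<close>

lemma phi_pivot:
  assumes "i < d" "p < d" "y \<in> Rd d"
    and N': "\<And>j. N' i j = N i j - (phi d N i y - of_bool (i = p)) * ((N p j + of_bool (j = p)) / phi d N p y)"
  shows "phi d N' i v = phi d N i v - (phi d N i y - of_bool (i = p)) * phi d N p v / phi d N p y"
proof -
  have split_term: "(n - a * ((m + o') / q)) * l = n * l - a / q * (m * l) - a / q * (o' * l)"
    for n a m o' q l :: real
    by (simp add: algebra_simps add_divide_distrib)
  have collect: "l + (A - a / q * B - a / q * l') = l + A - a * (l' + B) / q" for l A a q B l' :: real
    by (simp add: algebra_simps add_divide_distrib)
  let ?c = "(phi d N i y - of_bool (i = p)) / phi d N p y"
  have "phi d N' i v = Poly_Mapping.lookup v i +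
      (\<Sum>j<d. N i j * Poly_Mapping.lookup v j - ?c * (N p j * Poly_Mapping.lookup v j)
        - ?c * (of_bool (j = p) * Poly_Mapping.lookup v j))"
    unfolding phi_def[of d N'] N' by (simp only: split_term)
  also have "(\<Sum>j<d. N i j * Poly_Mapping.lookup v j - ?c * (N p j * Poly_Mapping.lookup v j)
        - ?c * (of_bool (j = p) * Poly_Mapping.lookup v j)) =
      (\<Sum>j<d. N i j * Poly_Mapping.lookup v j) - ?c * (\<Sum>j<d. N p j * Poly_Mapping.lookup v j)
      - ?c * (\<Sum>j<d. of_bool (j = p) * Poly_Mapping.lookup v j)"
    by (simp only: sum_subtractf sum_distrib_left)
  also have "(\<Sum>j<d. of_bool (j = p) * Poly_Mapping.lookup v j) = Poly_Mapping.lookup v p"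
    using assms(2) by (simp add: of_bool_def if_distrib if_distribR cong: if_cong)
  finally show ?thesis
    by (simp only: phi_def[of d N i v] phi_def[of d N p v] collect)
qed

text \<open>Steinitz exchange: a vector with nonzero coordinate \<open>p\<close> may take slot
  \<open>p\<close>.\<close>

lemma dual_basis_pivot:
  assumes b: "dual_basis d N b" and y: "y \<in> Rd d" and p: "p < d" "phi d N p y \<noteq> 0"
    and N': "\<And>i j. i < d \<Longrightarrow>
      N' i j = N i j - (phi d N i y - of_bool (i = p)) * ((N p j + of_bool (j = p)) / phi d N p y)"
  shows "dual_basis d N' (b(p := y))"
  unfolding dual_basis_def
proof (intro conjI allI impI ballI)
  have phi': "phi d N' i v = phi d N i v - (phi d N i y - of_bool (i = p)) * phi d N p v / phi d N p y"
    if "i < d" for i v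
    by (rule phi_pivot[OF that p(1) y]) (rule N'[OF that])
  fix i q assume iq: "i < d" "q < d"
  show "phi d N' i ((b(p := y)) q) = of_bool (i = q)"
    using b iq p by (auto simp: phi' dual_basis_def)
next
  have phi': "phi d N' i v = phi d N i v - (phi d N i y - of_bool (i = p)) * phi d N p v / phi d N p y"
    if "i < d" for i v
    by (rule phi_pivot[OF that p(1) y]) (rule N'[OF that])
  fix x assume x: "x \<in> Rd d"
  let ?r = "phi d N p x / phi d N p y"
  have "(\<Sum>i<d. phi d N' i x *\<^sub>R (b(p := y)) i) =
      phi d N' p x *\<^sub>R y + (\<Sum>i\<in>{..<d} - {p}. phi d N' i x *\<^sub>R b i)"
    using p(1) by (subst sum.remove[of _ p]) auto
  also have "phi d N' p x = ?r"
    using p by (simp add: phi' field_simps)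
  also have "(\<Sum>i\<in>{..<d} - {p}. phi d N' i x *\<^sub>R b i) =
      (\<Sum>i\<in>{..<d} - {p}. phi d N i x *\<^sub>R b i - ?r *\<^sub>R (phi d N i y *\<^sub>R b i))"
    by (intro sum.cong) (auto simp: phi' scaleR_diff_left mult.commute)
  \<comment> \<open>The term \<open>i = p\<close> may be included because \<open>?r\<close> is the
    factor that makes it 0.\<close>
  also have "\<dots> = (\<Sum>i<d. phi d N i x *\<^sub>R b i - ?r *\<^sub>R (phi d N i y *\<^sub>R b i))"
    using p by (subst sum.remove[of "{..<d}" p]) auto
  also have "\<dots> = x - ?r *\<^sub>R y"
    using b x y by (simp add: sum_subtractf scaleR_sum_right[symmetric] dual_basis_def del: scaleR_scaleR)
  finally show "x = (\<Sum>i<d. phi d N' i x *\<^sub>R (b(p := y)) i)" by simp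
qed

lemma dual_basis_unit: "dual_basis d (\<lambda>_ _. 0) (\<lambda>p. Poly_Mapping.single p 1)"
  unfolding dual_basis_def
proof (intro conjI allI impI ballI)
  fix x assume x: "x \<in> Rd d"
  show "x = (\<Sum>p<d. phi d (\<lambda>_ _. 0) p x *\<^sub>R Poly_Mapping.single p 1)"
  proof (rule poly_mapping_eqI)
    fix k
    show "Poly_Mapping.lookup x k =
        Poly_Mapping.lookup (\<Sum>p<d. phi d (\<lambda>_ _. 0) p x *\<^sub>R Poly_Mapping.single p 1) k"
      using x by (auto simp: phi_def lookup_sum lookup_single when_def Rd_iff if_distrib cong: if_cong)
  qed
qed (auto simp: phi_def lookup_single when_def)

abbreviation dif :: "(nat \<Rightarrow> point) \<Rightarrow> nat \<Rightarrow> point" where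
  "dif z i \<equiv> z i - z 1"

section \<open>The basis and the certificates of the skipped points\<close>

text \<open>\<open>R\<close> is the set of slots that hold points. The coefficients in the last
  conjunct refer to \<open>S\<close> and not to the current basis: coordinates in the basis may grow
  beyond 2 after an exchange, whereas a combination of selected points remains one.\<close>

definition basis_inv ::
  "nat \<Rightarrow> (nat \<Rightarrow> point) \<Rightarrow> nat \<Rightarrow> (nat \<Rightarrow> nat \<Rightarrow> real) \<Rightarrow> nat set \<Rightarrow> (nat \<Rightarrow> nat) \<Rightarrow> nat set \<Rightarrow> bool" where
  "basis_inv d z t N R idx S \<longleftrightarrow>
     R \<subseteq> {..<d} \<and> dual_basis d N (\<lambda>p. if p \<in> R then dif z (idx p) else Poly_Mapping.single p 1) \<and>
     idx ` R \<subseteq> S - {1} \<and> S \<subseteq> {1..t} \<and> 1 \<in> S \<and>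
     (\<forall>i\<in>{1..t}. \<forall>q<d. q \<notin> R \<longrightarrow> phi d N q (dif z i) = 0) \<and>
     (\<forall>i\<in>{1..t}. \<exists>l. dif z i = (\<Sum>s\<in>S - {1}. l s *\<^sub>R dif z s) \<and> (\<forall>s. \<bar>l s\<bar> \<le> 2))"

lemma basis_inv_coords:
  assumes "basis_inv d z t N R idx S" "v \<in> Rd d" "\<And>q. q < d \<Longrightarrow> q \<notin> R \<Longrightarrow> phi d N q v = 0"
  shows "v = (\<Sum>p\<in>R. phi d N p v *\<^sub>R dif z (idx p))"
proof -
  have "v = (\<Sum>p<d. phi d N p v *\<^sub>R (if p \<in> R then dif z (idx p) else Poly_Mapping.single p 1))"
    using assms(1,2) by (simp add: basis_inv_def dual_basis_def)
  also have "\<dots> = (\<Sum>p\<in>R. phi d N p v *\<^sub>R dif z (idx p))"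
    using assms(1,3) by (intro sum.mono_neutral_cong_right) (auto simp: basis_inv_def)
  finally show ?thesis .
qed

lemma basis_inv_phi:
  assumes "basis_inv d z t N R idx S" "p \<in> R" "q \<in> R"
  shows "phi d N p (dif z (idx q)) = of_bool (p = q)"
proof -
  let ?b = "\<lambda>p. if p \<in> R then dif z (idx p) else Poly_Mapping.single p 1"
  have "R \<subseteq> {..<d}" "dual_basis d N ?b" using assms(1) by (simp_all add: basis_inv_def)
  then have "phi d N p (?b q) = of_bool (p = q)"
    using assms(2,3) unfolding dual_basis_def subset_iff lessThan_iff by blast
  then show ?thesis using assms(3) by simp
qed

lemma basis_inv_inj:
  assumes "basis_inv d z t N R idx S"
  shows "inj_on idx R" "inj_on (\<lambda>p. dif z (idx p)) R"
proof -
  have eq: "p = q" if "p \<in> R" "q \<in> R" "dif z (idx p) = dif z (idx q)" for p q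
    using basis_inv_phi[OF assms that(1,1)] basis_inv_phi[OF assms that(1,2)] that(3)
    by (cases "p = q") auto
  show "inj_on idx R"
    by (rule inj_onI, rule eq) simp_all
  show "inj_on (\<lambda>p. dif z (idx p)) R"
    by (rule inj_onI, rule eq)
qed

lemma basis_inv_span:
  assumes "basis_inv d z t N R idx S" "\<And>i. i \<in> {1..t} \<Longrightarrow> z i \<in> Rd d" "1 \<le> t"
  shows "span (dif z ` {1..t}) = span ((\<lambda>p. dif z (idx p)) ` R)"
proof (rule span_eq[THEN iffD2], intro conjI subsetI)
  fix v assume "v \<in> dif z ` {1..t}"
  then obtain i where i: "i \<in> {1..t}" "v = dif z i" by blast
  have "v = (\<Sum>p\<in>R. phi d N p v *\<^sub>R dif z (idx p))"
    by (rule basis_inv_coords[OF assms(1)]) (use assms i in \<open>auto simp: basis_inv_def\<close>)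
  moreover have "\<dots> \<in> span ((\<lambda>p. dif z (idx p)) ` R)"
    by (intro span_sum span_scale span_base) auto
  ultimately show "v \<in> span ((\<lambda>p. dif z (idx p)) ` R)" by simp
next
  fix v assume "v \<in> (\<lambda>p. dif z (idx p)) ` R"
  then show "v \<in> span (dif z ` {1..t})"
    using assms(1) by (auto simp: basis_inv_def intro!: span_base)
qed

text \<open>The functional of a slot is 1 on its own vector and 0 on the other ones.\<close>

lemma basis_inv_independent:
  assumes "basis_inv d z t N R idx S"
  shows "independent ((\<lambda>p. dif z (idx p)) ` R)"
  unfolding dependent_def
proof (rule notI)
  assume "\<exists>a\<in>(\<lambda>p. dif z (idx p)) ` R. a \<in> span ((\<lambda>p. dif z (idx p)) ` R - {a})"
  then obtain p where p: "p \<in> R"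
    "dif z (idx p) \<in> span ((\<lambda>p. dif z (idx p)) ` R - {dif z (idx p)})" by blast
  have "phi d N p (dif z (idx p)) = 0"
    by (rule phi_span[OF _ p(2)]) (use basis_inv_phi[OF assms p(1)] in auto)
  then show False using basis_inv_phi[OF assms p(1) p(1)] by simp
qed

text \<open>This links the number of occupied slots to the dimension in which the bounds are
  stated.\<close>

lemma basis_inv_affine_dim:
  assumes "basis_inv d z t N R idx S" "\<And>i. i \<in> {1..t} \<Longrightarrow> z i \<in> Rd d" "1 \<le> t"
  shows "affine_dim (z ` {1..t}) = card R"
proof -
  let ?V = "span ((\<lambda>x. - z 1 + x) ` z ` {1..t})"
  have "{x - y |x y. x \<in> affine hull (z ` {1..t}) \<and> y \<in> affine hull (z ` {1..t})} = ?V"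
  proof -
    have "z 1 \<in> affine hull (z ` {1..t})"
      using assms(3) by (intro hull_inc) auto
    then have *: "affine hull (z ` {1..t}) = (\<lambda>x. z 1 + x) ` ?V"
      by (rule affine_hull_span_gen)
    show ?thesis
      unfolding *
    proof (intro equalityI subsetI)
      fix v assume "v \<in> ?V"
      then show "v \<in> {x - y |x y. x \<in> (\<lambda>x. z 1 + x) ` ?V \<and> y \<in> (\<lambda>x. z 1 + x) ` ?V}"
        using span_0 by (intro CollectI exI[of _ "z 1 + v"] exI[of _ "z 1 + 0"]) (auto simp del: add_0_right)
    qed (auto intro: span_diff)
  qed
  also have "?V = span (dif z ` {1..t})"
    by (simp add: image_image)
  also have "\<dots> = span ((\<lambda>p. dif z (idx p)) ` R)"
    by (rule basis_inv_span[OF assms])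
  finally show ?thesis
    using dim_span_eq_card_independent[OF basis_inv_independent[OF assms(1)]]
      card_image[OF basis_inv_inj(2)[OF assms(1)]]
    by (simp add: affine_dim_def)
qed

text \<open>A skipped point is certified by its own coordinates in the current basis.\<close>

lemma basis_inv_skip:
  assumes inv: "basis_inv d z t N R idx S" and y: "dif z (Suc t) \<in> Rd d"
    and N': "\<And>i. i < d \<Longrightarrow> N' i = N i"
    and small: "\<And>q. q < d \<Longrightarrow> q \<notin> R \<Longrightarrow> phi d N q (dif z (Suc t)) = 0"
      "\<And>p. p \<in> R \<Longrightarrow> \<bar>phi d N p (dif z (Suc t))\<bar> \<le> 2"
  shows "basis_inv d z (Suc t) N' R idx S"
proof -
  let ?y = "dif z (Suc t)"
  have R: "R \<subseteq> {..<d}" "idx ` R \<subseteq> S - {1}" "S \<subseteq> {1..t}"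
    using inv by (simp_all add: basis_inv_def)
  have fin: "finite R" "finite S"
    using R(1,3) by (auto intro: finite_subset)
  \<comment> \<open>The coordinate of a slot is assigned to the index of its point; selected points
    that have left the basis get 0.\<close>
  define l where "l s = (if s \<in> idx ` R then phi d N (inv_into R idx s) ?y else 0)" for s
  have "?y = (\<Sum>p\<in>R. phi d N p ?y *\<^sub>R dif z (idx p))"
    by (rule basis_inv_coords[OF inv y small(1)])
  also have "\<dots> = (\<Sum>p\<in>R. l (idx p) *\<^sub>R dif z (idx p))"
    using basis_inv_inj(1)[OF inv] by (intro sum.cong) (auto simp: l_def)
  also have "\<dots> = (\<Sum>s\<in>idx ` R. l s *\<^sub>R dif z s)"
    using basis_inv_inj(1)[OF inv] by (simp add: sum.reindex)
  also have "\<dots> = (\<Sum>s\<in>S - {1}. l s *\<^sub>R dif z s)"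
    using R fin by (intro sum.mono_neutral_left) (auto simp: l_def)
  finally have "?y = (\<Sum>s\<in>S - {1}. l s *\<^sub>R dif z s)" .
  moreover have "\<bar>l s\<bar> \<le> 2" for s
    using small(2) inv_into_into[of s idx R] by (simp add: l_def)
  ultimately have "\<exists>l. ?y = (\<Sum>s\<in>S - {1}. l s *\<^sub>R dif z s) \<and> (\<forall>s. \<bar>l s\<bar> \<le> 2)" by blast
  moreover have "phi d N' q v = phi d N q v" if "q < d" for q v
    using N'[OF that] by (simp add: phi_def)
  moreover have "dual_basis d N' b \<longleftrightarrow> dual_basis d N b" for b
    by (rule dual_basis_cong) (use N' in auto)
  ultimately show ?thesis
    using inv small(1) R(3) unfolding basis_inv_def
    by (auto simp: atLeastAtMostSuc_conv simp del: One_nat_def)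
qed

text \<open>Coordinates on the remaining unit vectors stay 0: if slot \<open>p\<close> held a unit
  vector, old points have coordinate 0 there and are not affected; if it held a point,
  \<open>free\<close> excludes components of the new point on unit vectors. Old certificates are
  extended by 0, and the new point certifies itself.\<close>

lemma basis_inv_pivot:
  assumes inv: "basis_inv d z t N R idx S" and t: "1 \<le> t" and y: "dif z (Suc t) \<in> Rd d"
    and p: "p < d" "phi d N p (dif z (Suc t)) \<noteq> 0"
    and N': "\<And>i j. i < d \<Longrightarrow> N' i j = N i j - (phi d N i (dif z (Suc t)) - of_bool (i = p)) *
      ((N p j + of_bool (j = p)) / phi d N p (dif z (Suc t)))"
    and free: "\<And>q. q < d \<Longrightarrow> q \<notin> R \<Longrightarrow> p \<in> R \<Longrightarrow> phi d N q (dif z (Suc t)) = 0"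
  shows "basis_inv d z (Suc t) N' (insert p R) (idx(p := Suc t)) (insert (Suc t) S)"
proof -
  let ?y = "dif z (Suc t)"
  have phi': "phi d N' i v = phi d N i v - (phi d N i ?y - of_bool (i = p)) * phi d N p v / phi d N p ?y"
    if "i < d" for i v
    by (rule phi_pivot[OF that p(1) y]) (rule N'[OF that])
  have S1: "S \<subseteq> {1..t}" using inv by (simp add: basis_inv_def)
  then have S: "S \<subseteq> {1..t}" "finite S" "Suc t \<notin> S"
    by (auto intro: finite_subset)
  have "dual_basis d N' ((\<lambda>p. if p \<in> R then dif z (idx p) else Poly_Mapping.single p 1)(p := ?y))"
    by (rule dual_basis_pivot[OF _ y p N']) (use inv in \<open>auto simp: basis_inv_def\<close>)
  also have "(\<lambda>p. if p \<in> R then dif z (idx p) else Poly_Mapping.single p 1)(p := ?y) =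
      (\<lambda>q. if q \<in> insert p R then dif z ((idx(p := Suc t)) q) else Poly_Mapping.single q 1)"
    by (auto simp: fun_eq_iff)
  finally have dual: "dual_basis d N' \<dots>" .
  have zero: "phi d N' q (dif z i) = 0"
    if i: "i \<in> {1..Suc t}" and q: "q < d" "q \<notin> insert p R" for i q
  proof (cases "i = Suc t")
    case True
    then show ?thesis using q p by (simp add: phi'[OF q(1)])
  next
    case False
    then have i': "i \<in> {1..t}" using i by auto
    have "phi d N q (dif z i) = 0" "p \<in> R \<or> phi d N p (dif z i) = 0"
      using inv i' q p(1) by (auto simp: basis_inv_def)
    then show ?thesis using q free[OF q(1)] by (auto simp: phi'[OF q(1)])
  qed
  have S': "insert (Suc t) S - {1} = insert (Suc t) (S - {1})" using t by auto
  have cert: "\<exists>l. dif z i = (\<Sum>s\<in>insert (Suc t) S - {1}. l s *\<^sub>R dif z s) \<and> (\<forall>s. \<bar>l s\<bar> \<le> 2)"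
    if i: "i \<in> {1..Suc t}" for i
  proof (cases "i = Suc t")
    case True
    have "(\<Sum>s\<in>insert (Suc t) S - {1}. of_bool (s = Suc t) *\<^sub>R dif z s) = dif z (Suc t)"
      using S t by (subst S', subst sum.insert) (auto intro!: sum.neutral)
    then show ?thesis
      using True by (intro exI[of _ "\<lambda>s. of_bool (s = Suc t)"]) auto
  next
    case False
    then have "i \<in> {1..t}" using i by auto
    then obtain l where l: "dif z i = (\<Sum>s\<in>S - {1}. l s *\<^sub>R dif z s)" "\<forall>s. \<bar>l s\<bar> \<le> 2"
      using inv unfolding basis_inv_def by blast
    have "(\<Sum>s\<in>insert (Suc t) S - {1}. (l(Suc t := 0)) s *\<^sub>R dif z s) = dif z i"
      using S l(1) by (subst S', subst sum.insert) (auto intro!: sum.cong)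
    then show ?thesis
      using l(2) by (intro exI[of _ "l(Suc t := 0)"]) auto
  qed
  have old: "R \<subseteq> {..<d}" "idx ` R \<subseteq> S - {1}" "1 \<in> S"
    using inv by (simp_all add: basis_inv_def)
  have "insert p R \<subseteq> {..<d}" "insert (Suc t) S \<subseteq> {1..Suc t}" "1 \<in> insert (Suc t) S"
    using old p(1) S1 by auto
  moreover have "(idx(p := Suc t)) ` insert p R \<subseteq> insert (Suc t) S - {1}"
    using old(2) t by (auto simp: image_subset_iff)
  ultimately show ?thesis
    unfolding basis_inv_def using dual zero cert by blast
qed

text \<open>\<open>ys\<close> are the points that raised the dimension, \<open>ds\<close> their distances from the preceding span,
  and \<open>s\<close> is the number of pivots in which a point replaced another point.\<close>

definition volume_inv :: "nat \<Rightarrow> (nat \<Rightarrow> point) \<Rightarrow> nat \<Rightarrow> point list \<Rightarrow> nat \<Rightarrow> bool" where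
  "volume_inv d z t bs s \<longleftrightarrow> (\<exists>ys ds. length ys = length bs \<and> length ds = length bs \<and>
     set ys \<subseteq> dif z ` {1..t} \<and> span (set ys) = span (dif z ` {1..t}) \<and>
     4 ^ s * gram d ys \<le> gram d bs \<and> gram d ys = (\<Prod>e\<leftarrow>ds. e\<^sup>2) \<and>
     (\<forall>e\<in>set ds. 0 < e \<and> (\<exists>\<tau>\<in>{1..t}. inner_radius d (z ` {1..\<tau>}) \<le> ereal (e / 2))) \<and>
     (2 \<le> length bs \<longrightarrow> (\<exists>\<tau>\<in>{1..t}. \<forall>R. enclosed d (z ` {1..\<tau>}) R \<longrightarrow>
        inner_radius d (z ` {1..\<tau>}) \<le> ereal (2 * R / 3))))"

section \<open>Gram determinants along the stream\<close>

text \<open>While the span does not change, the reference list and its heights are kept; each factor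
  4 gained by the basis pays for one increment of \<open>s\<close>.\<close>

lemma volume_inv_span_step:
  assumes "volume_inv d z t bs s" "dif z (Suc t) \<in> span (dif z ` {1..t})"
    and "4 ^ (s' - s) * gram d bs \<le> gram d bs'" "length bs' = length bs" "s \<le> s'"
  shows "volume_inv d z (Suc t) bs' s'"
proof -
  have sp: "span (dif z ` {1..Suc t}) = span (dif z ` {1..t})"
    using assms(2) by (simp add: atLeastAtMostSuc_conv span_redundant)
  obtain ys ds where *: "length ys = length bs" "length ds = length bs"
     "set ys \<subseteq> dif z ` {1..t}" "span (set ys) = span (dif z ` {1..t})"
     "4 ^ s * gram d ys \<le> gram d bs" "gram d ys = (\<Prod>e\<leftarrow>ds. e\<^sup>2)"
     "\<forall>e\<in>set ds. 0 < e \<and> (\<exists>\<tau>\<in>{1..t}. inner_radius d (z ` {1..\<tau>}) \<le> ereal (e / 2))"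
     "2 \<le> length bs \<longrightarrow> (\<exists>\<tau>\<in>{1..t}. \<forall>R. enclosed d (z ` {1..\<tau>}) R \<longrightarrow>
        inner_radius d (z ` {1..\<tau>}) \<le> ereal (2 * R / 3))"
    using assms(1) unfolding volume_inv_def by blast
  have mono: "{1..t} \<subseteq> {1..Suc t}" by auto
  have "4 ^ s' * gram d ys = 4 ^ (s' - s) * (4 ^ s * gram d ys)"
    using assms(5) by (simp add: power_add[symmetric] mult.assoc[symmetric])
  also have "\<dots> \<le> 4 ^ (s' - s) * gram d bs"
    using *(5) by (intro mult_left_mono) auto
  also note assms(3)
  finally have vol: "4 ^ s' * gram d ys \<le> gram d bs'" .
  show ?thesis
    unfolding volume_inv_def
  proof (intro exI[of _ ys] exI[of _ ds] conjI)
    show "set ys \<subseteq> dif z ` {1..Suc t}" using *(3) mono by blast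
    show "\<forall>e\<in>set ds. 0 < e \<and> (\<exists>\<tau>\<in>{1..Suc t}. inner_radius d (z ` {1..\<tau>}) \<le> ereal (e / 2))"
      using *(7) mono by blast
    show "2 \<le> length bs' \<longrightarrow> (\<exists>\<tau>\<in>{1..Suc t}. \<forall>R. enclosed d (z ` {1..\<tau>}) R \<longrightarrow>
        inner_radius d (z ` {1..\<tau>}) \<le> ereal (2 * R / 3))"
      using *(8) mono assms(4) by fastforce
  qed (use * sp vol assms(4) in auto)
qed

lemma volume_inv_swap:
  assumes "volume_inv d z t bs s" "dif z (Suc t) \<in> span (dif z ` {1..t})"
    and "k < length bs" "dif z (Suc t) = (\<Sum>j<length bs. c j *\<^sub>R bs ! j)" "4 \<le> (c k)\<^sup>2" "set bs \<subseteq> Rd d"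
  shows "volume_inv d z (Suc t) (bs[k := dif z (Suc t)]) (Suc s)"
proof (rule volume_inv_span_step[OF assms(1,2)])
  show "4 ^ (Suc s - s) * gram d bs \<le> gram d (bs[k := dif z (Suc t)])"
    using gram_list_update[OF assms(3,4), of d] gram_bounds[OF assms(6)] assms(5)
    by (simp add: mult_right_mono)
qed auto

text \<open>Basis and reference list span the same space, so appending the new point multiplies both
  Gram determinants by the same squared height, and the factor \<open>4 ^ s\<close> between them
  persists.\<close>

lemma volume_inv_append:
  assumes inv: "volume_inv d z t bs s" and new: "dif z (Suc t) \<notin> span (dif z ` {1..t})"
    and bs: "span (set bs) = span (dif z ` {1..t})" and t: "1 \<le> t"
    and z: "\<And>i. i \<in> {1..Suc t} \<Longrightarrow> z i \<in> Rd d"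
  shows "volume_inv d z (Suc t) (bs @ [dif z (Suc t)]) s"
proof -
  let ?y = "dif z (Suc t)" and ?D = "dif z ` {1..t}"
  obtain ys ds where *: "length ys = length bs" "length ds = length bs"
     "set ys \<subseteq> ?D" "span (set ys) = span ?D"
     "4 ^ s * gram d ys \<le> gram d bs" "gram d ys = (\<Prod>e\<leftarrow>ds. e\<^sup>2)"
     "\<forall>e\<in>set ds. 0 < e \<and> (\<exists>\<tau>\<in>{1..t}. inner_radius d (z ` {1..\<tau>}) \<le> ereal (e / 2))"
    using inv unfolding volume_inv_def by blast
  have D: "?D \<subseteq> Rd d" using z t by auto
  have y: "?y \<in> Rd d" using z t by auto
  obtain r where r: "r \<in> Rd d" "?y - r \<in> span ?D" "\<forall>b\<in>?D. ip d r b = 0"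
    using orthogonal_residual_exists[OF _ D y] by auto
  have "r \<noteq> 0" using r(2) new by auto
  then have e: "0 < nrm d r"
    using r(1) nrm_eq_0_iff[of r d] nrm_nonneg[of d r] by (simp add: less_le)
  have orth: "ip d r b = 0" if "b \<in> span ?D" for b
    using r(3) by (intro ip_orthogonal_span[OF _ that]) blast
  have gram: "gram d (xs @ [?y]) = gram d xs * (nrm d r)\<^sup>2" if "span (set xs) = span ?D" for xs
    unfolding nrm_power2 using that r(2) orth
    by (intro gram_snoc) (auto intro: span_base)
  have X: "insert (z (Suc t)) (z ` {1..t}) = z ` {1..Suc t}"
    by (simp add: atLeastAtMostSuc_conv)
  have conds: "z ` {1..t} \<subseteq> Rd d" "z 1 \<in> z ` {1..t}" "z (Suc t) \<in> Rd d"
    using z t by auto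
  have y_r: "?y - r \<in> span ((\<lambda>y. y - z 1) ` z ` {1..t})"
    using r(2) by (simp only: image_image)
  have orth_X: "ip d r (y - z 1) = 0" if "y \<in> z ` {1..t}" for y
    using r(3) that by blast
  have pyr: "inner_radius d (z ` {1..Suc t}) \<le> ereal (nrm d r / 2)"
    unfolding X[symmetric] using conds r(1) \<open>r \<noteq> 0\<close> y_r orth_X by (rule inner_radius_pyramid(1))
  have pyr': "inner_radius d (z ` {1..Suc t}) \<le> ereal (2 * R / 3)"
    if "\<exists>b\<in>z ` {1..t}. b \<noteq> z 1" "enclosed d (z ` {1..Suc t}) R" for R
    unfolding X[symmetric] using conds r(1) \<open>r \<noteq> 0\<close> y_r orth_X that[folded X] by (rule inner_radius_pyramid(2))
  \<comment> \<open>If all previous points coincided, the reference list would contain the zero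
    vector and have Gram determinant 0, although this determinant is a product of positive
    squares.\<close>
  have nondeg: "\<exists>b\<in>z ` {1..t}. b \<noteq> z 1" if ne: "bs \<noteq> []"
  proof (rule ccontr)
    assume "\<not> ?thesis"
    then have "dif z i = 0" if "i \<in> {1..t}" for i
      using that by (metis imageI right_minus_eq)
    then have "?D \<subseteq> {0}" by blast
    moreover obtain y0 ys' where "ys = y0 # ys'" using *(1) ne by (cases ys) auto
    ultimately have "y0 = 0" using *(3) by (metis list.set_intros(1) singletonD subsetD)
    then have "ip d y0 y0 = 0" by simp
    then have "(\<Prod>b\<leftarrow>ys. ip d b b) = 0" using \<open>ys = y0 # ys'\<close> by simp
    moreover have "gram d ys \<le> (\<Prod>b\<leftarrow>ys. ip d b b)"
      using gram_bounds[of ys d] *(3) D by auto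
    moreover have "0 < (\<Prod>e\<leftarrow>ds. e\<^sup>2)"
      using *(7) by (induction ds) auto
    ultimately show False using *(6) by linarith
  qed
  show ?thesis
    unfolding volume_inv_def
  proof (rule exI[of _ "ys @ [?y]"], rule exI[of _ "ds @ [nrm d r]"], intro conjI)
    show "set (ys @ [?y]) \<subseteq> dif z ` {1..Suc t}"
      using *(3) by (auto simp: atLeastAtMostSuc_conv)
    show "span (set (ys @ [?y])) = span (dif z ` {1..Suc t})"
    proof -
      have "span (insert ?y (set ys)) = span (insert ?y ?D)"
        by (simp only: span_insert *(4))
      moreover have "set (ys @ [?y]) = insert ?y (set ys)" by simp
      moreover have "dif z ` {1..Suc t} = insert ?y ?D" by (simp add: atLeastAtMostSuc_conv)
      ultimately show ?thesis by simp
    qed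
    show "4 ^ s * gram d (ys @ [?y]) \<le> gram d (bs @ [?y])"
      unfolding gram[OF *(4)] gram[OF bs]
      using mult_right_mono[OF *(5), of "(nrm d r)\<^sup>2"] by (simp add: mult.assoc)
    show "gram d (ys @ [?y]) = (\<Prod>e\<leftarrow>ds @ [nrm d r]. e\<^sup>2)"
      unfolding gram[OF *(4)] using *(6) by simp
    show "\<forall>e\<in>set (ds @ [nrm d r]). 0 < e \<and> (\<exists>\<tau>\<in>{1..Suc t}. inner_radius d (z ` {1..\<tau>}) \<le> ereal (e / 2))"
    proof
      fix e' assume "e' \<in> set (ds @ [nrm d r])"
      then consider "e' \<in> set ds" | "e' = nrm d r" by auto
      then show "0 < e' \<and> (\<exists>\<tau>\<in>{1..Suc t}. inner_radius d (z ` {1..\<tau>}) \<le> ereal (e' / 2))"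
      proof cases
        case 1
        then obtain \<tau> where "\<tau> \<in> {1..t}" "inner_radius d (z ` {1..\<tau>}) \<le> ereal (e' / 2)" "0 < e'"
          using *(7) by blast
        then show ?thesis by (intro conjI bexI[of _ \<tau>]) auto
      next
        case 2
        then show ?thesis using e pyr by (intro conjI bexI[of _ "Suc t"]) auto
      qed
    qed
    show "2 \<le> length (bs @ [?y]) \<longrightarrow> (\<exists>\<tau>\<in>{1..Suc t}. \<forall>R. enclosed d (z ` {1..\<tau>}) R \<longrightarrow>
        inner_radius d (z ` {1..\<tau>}) \<le> ereal (2 * R / 3))"
    proof
      assume "2 \<le> length (bs @ [?y])"
      then have "bs \<noteq> []" by auto
      then show "\<exists>\<tau>\<in>{1..Suc t}. \<forall>R. enclosed d (z ` {1..\<tau>}) R \<longrightarrow>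
        inner_radius d (z ` {1..\<tau>}) \<le> ereal (2 * R / 3)"
        using pyr'[OF nondeg] by (intro bexI[of _ "Suc t"]) auto
    qed
  qed (use * in auto)
qed

section \<open>The invariant of the whole stream\<close>

text \<open>The quantified \<open>R\<close>, \<open>idx\<close>, \<open>ord\<close> and
  \<open>s\<close> are ghost data: the program records neither which points sit in the slots nor how
  many pivots were exchanges. \<open>ord\<close> lists the occupied slots in the order of their
  first occupation.\<close>

definition stream_inv ::
  "nat \<Rightarrow> (nat \<Rightarrow> point) \<Rightarrow> nat \<Rightarrow> nat \<Rightarrow> (nat \<Rightarrow> nat \<Rightarrow> real) \<Rightarrow> nat set \<Rightarrow> bool" where
  "stream_inv d z t m f S \<longleftrightarrow> (\<exists>R idx ord s. basis_inv d z t (\<lambda>i. f (7 + i)) R idx S \<and>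
     distinct ord \<and> set ord = R \<and> m = length ord + s \<and>
     volume_inv d z t (map (\<lambda>p. dif z (idx p)) ord) s \<and> card S = Suc m \<and>
     (\<forall>p<d. f 3 p = (if p \<in> R then 4 else 0)) \<and> f 1 = Poly_Mapping.lookup (z 1) \<and>
     (\<forall>j. f 5 j = (\<Sum>s\<in>S. Poly_Mapping.lookup (dif z s) j)))"

lemma stream_inv_first:
  assumes "step_rel d (z 1) 0 0 (\<lambda>_ _. 0) {} m f S"
  shows "stream_inv d z 1 m f S" "S = {1}"
proof -
  \<comment> \<open>The shifted first point is 0, so no coordinate exceeds the threshold 0 and a
    pivot is excluded.\<close>
  have *: "m = 0" "f 3 = (\<lambda>_. 0)" "f 5 = (\<lambda>_. 0)" "\<And>i. i < d \<Longrightarrow> f (7 + i) = (\<lambda>_. 0)"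
    "f 1 = Poly_Mapping.lookup (z 1)" "S = {1}"
    using assms by (auto simp: step_rel_def step_update_def)
  then show "S = {1}" by simp
  have "dual_basis d (\<lambda>i. f (7 + i)) (\<lambda>p. Poly_Mapping.single p 1)"
    using dual_basis_unit[of d] dual_basis_cong[of d "\<lambda>_ _. 0" "\<lambda>i. f (7 + i)"] *(4) by metis
  then have "basis_inv d z 1 (\<lambda>i. f (7 + i)) {} id S"
    using * by (auto simp: basis_inv_def intro: exI[of _ "\<lambda>_. 0"])
  moreover have "volume_inv d z 1 [] 0"
    by (auto simp: volume_inv_def intro!: exI[of _ "[]"])
  ultimately show "stream_inv d z 1 m f S"
    unfolding stream_inv_def using * by (intro exI[of _ "{}"] exI[of _ id] exI[of _ "[]"] exI[of _ 0]) auto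
qed

lemma stream_inv_step:
  assumes "stream_inv d z t m f S" and t: "1 \<le> t" and z: "\<And>i. i \<in> {1..Suc t} \<Longrightarrow> z i \<in> Rd d"
    and "step_rel d (z (Suc t)) t m f S m' f' S'"
  shows "stream_inv d z (Suc t) m' f' S' \<and> (S' = S \<or> S' = S \<union> {Suc t})"
proof -
  obtain R idx ord s where inv: "basis_inv d z t (\<lambda>i. f (7 + i)) R idx S"
    and ord: "distinct ord" "set ord = R" and m: "m = length ord + s"
    and vol: "volume_inv d z t (map (\<lambda>p. dif z (idx p)) ord) s" and card: "card S = Suc m"
    and th: "\<forall>p<d. f 3 p = (if p \<in> R then 4 else 0)" and f1: "f 1 = Poly_Mapping.lookup (z 1)"
    and f5: "\<forall>j. f 5 j = (\<Sum>s\<in>S. Poly_Mapping.lookup (dif z s) j)"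
    using assms(1) unfolding stream_inv_def by blast
  let ?y = "dif z (Suc t)" and ?N = "\<lambda>i. f (7 + i)" and ?N' = "\<lambda>i. f' (7 + i)"
  define c where "c i = phi d ?N i ?y" for i
  have y: "?y \<in> Rd d" using z t by auto
  have S: "S \<subseteq> {1..t}" "1 \<in> S" "R \<subseteq> {..<d}" using inv by (simp_all add: basis_inv_def)
  then have fin: "finite S" "Suc t \<notin> S" "insert 1 S = S" by (auto intro: finite_subset)
  have dif_Rd: "dif z (idx p) \<in> Rd d" if p: "p \<in> R" for p
  proof -
    have "idx ` R \<subseteq> S - {1}" using inv by (simp add: basis_inv_def)
    then have "idx p \<in> {1..t}" using S(1) p by blast
    then show ?thesis using z[of "idx p"] z[of 1] t by simp
  qed
  have lookup_y: "(\<lambda>j. Poly_Mapping.lookup (z (Suc t)) j - f 1 j) = Poly_Mapping.lookup ?y"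
    using f1 by (simp add: lookup_minus fun_eq_iff)
  have c_eq: "(\<lambda>i. Poly_Mapping.lookup ?y i + (\<Sum>j<d. f (7 + i) j * Poly_Mapping.lookup ?y j)) = c"
    by (simp add: c_def phi_def fun_eq_iff)
  obtain z1 y1 c1 where r: "z1 = (if t = 0 then Poly_Mapping.lookup (z (Suc t)) else f 1)"
    "y1 = (\<lambda>j. Poly_Mapping.lookup (z (Suc t)) j - z1 j)"
    "c1 = (\<lambda>i. y1 i + (\<Sum>j<d. f (7 + i) j * y1 j))" "f' 1 = z1"
    "step_update d t m f S y1 c1 m' f' S'"
    using assms(4) unfolding step_rel_def by blast
  have z1: "z1 = f 1" using r(1) t by simp
  have y1: "y1 = Poly_Mapping.lookup ?y" unfolding r(2) z1 lookup_y ..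
  have "c1 = c" unfolding r(3) y1 c_eq ..
  then have rel: "f' 1 = f 1" "step_update d t m f S (Poly_Mapping.lookup ?y) c m' f' S'"
    using r(4,5) z1 y1 by simp_all
  have sp: "span (dif z ` {1..t}) = span (set (map (\<lambda>p. dif z (idx p)) ord))"
    using basis_inv_span[OF inv _ t] z ord by simp
  from rel(2) show ?thesis
    unfolding step_update_def
  proof (elim disjE exE conjE)
    assume a: "\<forall>j<d. c j * c j \<le> f 3 j" "m' = m" "f' 3 = f 3" "f' 5 = f 5"
      "\<forall>i<d. f' (7 + i) = f (7 + i)" "S' = insert 1 S"
    \<comment> \<open>Slots holding a unit vector have threshold 0.\<close>
    have zero: "c q = 0" if "q < d" "q \<notin> R" for q
      using a(1) th that by (metis less_eq_real_def mult_eq_0_iff not_square_less_zero)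
    have small: "\<bar>c p\<bar> \<le> 2" if "p \<in> R" for p
      using a(1) th that S(3) abs_le_square_iff[of "c p" 2] by (auto simp: power2_eq_square)
    have inv': "basis_inv d z (Suc t) ?N' R idx S"
      using a(5) zero small unfolding c_def by (intro basis_inv_skip[OF inv y]) auto
    have "?y = (\<Sum>p\<in>R. c p *\<^sub>R dif z (idx p))"
      unfolding c_def by (rule basis_inv_coords[OF inv y]) (use zero in \<open>auto simp: c_def\<close>)
    also have "\<dots> \<in> span (dif z ` {1..t})"
      unfolding sp using ord by (intro span_sum span_scale span_base) auto
    finally have "volume_inv d z (Suc t) (map (\<lambda>p. dif z (idx p)) ord) s"
      by (intro volume_inv_span_step[OF vol]) auto
    then have "stream_inv d z (Suc t) m' f' S'"
      unfolding stream_inv_def using inv' a ord m card th f1 f5 rel(1) fin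
      by (intro exI[of _ R] exI[of _ idx] exI[of _ ord] exI[of _ s]) auto
    then show ?thesis using a(6) fin(3) by simp
  next
    fix p assume p: "p < d" "f 3 p < c p * c p" "\<forall>j<d. f 3 j < c j * c j \<longrightarrow> f 3 p \<le> f 3 j"
      and m': "m' = Suc m" and f'3: "f' 3 = (f 3)(p := 4)"
      and f'5: "f' 5 = (\<lambda>j. f 5 j + Poly_Mapping.lookup ?y j)"
      and N': "\<forall>i<d. \<forall>j. f' (7 + i) j = f (7 + i) j - (c i - of_bool (i = p)) * ((f (7 + p) j + of_bool (j = p)) / c p)"
      and S': "S' = insert (Suc t) (insert 1 S)"
    let ?idx = "idx(p := Suc t)"
    have cp: "c p \<noteq> 0" using p(1,2) th by (auto split: if_splits)
    \<comment> \<open>A nonzero coordinate on a unit vector would be a candidate with threshold 0,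
      and it would have been preferred to \<open>p\<close> with threshold 4.\<close>
    have free: "c q = 0" if "q < d" "q \<notin> R" "p \<in> R" for q
    proof (rule ccontr)
      assume "c q \<noteq> 0"
      then have "0 < c q * c q" by (auto simp: zero_less_mult_iff)
      then show False using p(1,3) th that by auto
    qed
    have inv': "basis_inv d z (Suc t) ?N' (insert p R) ?idx (insert (Suc t) S)"
      by (rule basis_inv_pivot[OF inv t y p(1)]) (use cp N' free in \<open>auto simp: c_def\<close>)
    have rest: "card S' = Suc m'" "\<forall>q<d. f' 3 q = (if q \<in> insert p R then 4 else 0)"
      "\<forall>j. f' 5 j = (\<Sum>s\<in>S'. Poly_Mapping.lookup (dif z s) j)" "S' = insert (Suc t) S"
      using S' fin card m' f'3 th f5 f'5 by (auto simp: add.commute)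
    have "\<exists>ord' s'. distinct ord' \<and> set ord' = insert p R \<and> m' = length ord' + s' \<and>
        volume_inv d z (Suc t) (map (\<lambda>p. dif z (?idx p)) ord') s'"
    proof (cases "p \<in> R")
      case True
      then obtain k where k: "k < length ord" "ord ! k = p"
        using ord by (metis in_set_conv_nth)
      have yc: "?y = (\<Sum>p\<in>R. c p *\<^sub>R dif z (idx p))"
        unfolding c_def by (rule basis_inv_coords[OF inv y]) (use free True in \<open>auto simp: c_def\<close>)
      also have "\<dots> = (\<Sum>j<length ord. c (ord ! j) *\<^sub>R dif z (idx (ord ! j)))"
        using ord by (intro sum.reindex_bij_betw[symmetric]) (metis bij_betw_nth)
      finally have yc': "?y = (\<Sum>j<length (map (\<lambda>p. dif z (idx p)) ord).
          c (ord ! j) *\<^sub>R map (\<lambda>p. dif z (idx p)) ord ! j)"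
        by simp
      have y_span: "?y \<in> span (dif z ` {1..t})"
        unfolding sp yc using ord by (intro span_sum span_scale span_base) auto
      have upd: "(map (\<lambda>p. dif z (idx p)) ord)[k := ?y] = map (\<lambda>p. dif z (?idx p)) ord"
        using k ord(1) by (intro nth_equalityI) (auto simp: nth_list_update nth_eq_iff_index_eq)
      have "volume_inv d z (Suc t) (map (\<lambda>p. dif z (?idx p)) ord) (Suc s)"
        unfolding upd[symmetric]
      proof (rule volume_inv_swap[OF vol y_span _ yc'])
        show "k < length (map (\<lambda>p. dif z (idx p)) ord)" using k by simp
        show "4 \<le> (c (ord ! k))\<^sup>2"
          using p th True k by (simp add: power2_eq_square)
        show "set (map (\<lambda>p. dif z (idx p)) ord) \<subseteq> Rd d"
          using dif_Rd ord(2) by auto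
      qed
      then show ?thesis
        using ord m m' True by (intro exI[of _ ord] exI[of _ "Suc s"]) auto
    next
      case False
      \<comment> \<open>The functional of slot \<open>p\<close> vanishes on the old span but not on
        the new point.\<close>
      have new: "?y \<notin> span (dif z ` {1..t})"
      proof
        assume "?y \<in> span (dif z ` {1..t})"
        moreover have "phi d ?N p b = 0" if "b \<in> dif z ` {1..t}" for b
          using inv p(1) False that by (auto simp: basis_inv_def)
        ultimately have "c p = 0"
          unfolding c_def by (metis phi_span)
        then show False using cp by simp
      qed
      have map_eq: "map (\<lambda>p. dif z (?idx p)) (ord @ [p]) = map (\<lambda>p. dif z (idx p)) ord @ [?y]"
        using False ord by auto
      have "volume_inv d z (Suc t) (map (\<lambda>p. dif z (?idx p)) (ord @ [p])) s"
        unfolding map_eq by (rule volume_inv_append[OF vol new sp[symmetric] t z])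
      then show ?thesis
        using ord m m' False by (intro exI[of _ "ord @ [p]"] exI[of _ s]) auto
    qed
    then obtain ord' s' where "distinct ord'" "set ord' = insert p R" "m' = length ord' + s'"
      "volume_inv d z (Suc t) (map (\<lambda>p. dif z (?idx p)) ord') s'" by blast
    then have "stream_inv d z (Suc t) m' f' S'"
      unfolding stream_inv_def using inv' rest f1 rel(1)
      by (intro exI[of _ "insert p R"] exI[of _ ?idx] exI[of _ ord'] exI[of _ s']) simp
    then show ?thesis using rest(4) by simp
  qed
qed

section \<open>Radii and aspect ratio\<close>

text \<open>An explicit ball around the barycenter of the simplex formed by \<open>z 1\<close> and
  the points in the basis, whose weights are all \<open>w = 1 / (k + 1)\<close>. The coordinates of
  a unit vector have absolute values of sum at most \<open>C\<close>, so a move by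
  \<open>w / (C + 1)\<close> times it keeps all weights nonnegative. Positivity makes the quotients
  in \<open>aspect_ratio\<close> finite.\<close>

lemma basis_inv_inner_radius_pos:
  assumes inv: "basis_inv d z t N R idx S" and t: "1 \<le> t" and z: "\<And>i. i \<in> {1..t} \<Longrightarrow> z i \<in> Rd d"
  shows "0 < inner_radius d (z ` {1..t})"
proof -
  let ?X = "z ` {1..t}"
  have R: "R \<subseteq> {..<d}" "idx ` R \<subseteq> {1..t}" using inv by (auto simp: basis_inv_def)
  then have fin: "finite R" by (auto intro: finite_subset)
  have D: "dif z (idx p) \<in> Rd d" if "p \<in> R" for p using R that z t by auto
  define k where "k = real (card R)"
  define w where "w = 1 / (k + 1)"
  define C where "C = (\<Sum>p\<in>R. 1 + (\<Sum>j<d. \<bar>N p j\<bar>))"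
  define e where "e = w / (C + 1)"
  have w: "0 < w" "k * w + w = 1" by (auto simp: w_def k_def field_simps)
  have C: "0 \<le> C" unfolding C_def by (intro sum_nonneg add_nonneg_nonneg) auto
  have e: "0 < e" "e * C \<le> w" using w C by (auto simp: e_def field_simps)
  define c where "c = z 1 + (\<Sum>p\<in>R. w *\<^sub>R (z (idx p) - z 1))"
  have hull: "z 1 + (\<Sum>p\<in>R. v p *\<^sub>R (z (idx p) - z 1)) \<in> convex hull ?X"
    if "\<And>p. p \<in> R \<Longrightarrow> 0 \<le> v p" "sum v R \<le> 1" for v
  proof -
    have "insert (z 1) ((\<lambda>p. z (idx p)) ` R) \<subseteq> ?X" using R t by auto
    then have "convex hull (insert (z 1) ((\<lambda>p. z (idx p)) ` R)) \<subseteq> convex hull ?X"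
      by (rule hull_mono)
    moreover have "z 1 + (\<Sum>p\<in>R. v p *\<^sub>R (z (idx p) - z 1)) \<in>
        convex hull (insert (z 1) ((\<lambda>p. z (idx p)) ` R))"
      by (rule sum_in_convex_hull[OF fin that])
    ultimately show ?thesis by blast
  qed
  have phi_c: "phi d N q (z i - c) = 0" if "i \<in> {1..t}" "q < d" "q \<notin> R" for i q
  proof -
    have zero: "phi d N q (dif z i) = 0" if "i \<in> {1..t}" for i
      using inv that \<open>q < d\<close> \<open>q \<notin> R\<close> by (simp add: basis_inv_def)
    have "dif z i = (z i - c) + (\<Sum>p\<in>R. w *\<^sub>R dif z (idx p))" by (simp add: c_def)
    then have "phi d N q (dif z i) = phi d N q (z i - c) + (\<Sum>p\<in>R. w * phi d N q (dif z (idx p)))"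
      by (metis (no_types, lifting) phi_add phi_scale phi_sum sum.cong)
    moreover have "(\<Sum>p\<in>R. w * phi d N q (dif z (idx p))) = 0"
      using zero R by (intro sum.neutral) auto
    ultimately show ?thesis using zero[OF that(1)] by simp
  qed
  have "(\<lambda>u. c + e *\<^sub>R u) ` (unit_ball d \<inter> span ((\<lambda>x. x - c) ` ?X)) \<subseteq> convex hull ?X"
  proof (rule image_subsetI)
    fix u assume u: "u \<in> unit_ball d \<inter> span ((\<lambda>x. x - c) ` ?X)"
    then have u_Rd: "u \<in> Rd d" by (simp add: unit_ball_iff)
    have "phi d N q u = 0" if "q < d" "q \<notin> R" for q
      by (rule phi_span[of "(\<lambda>x. x - c) ` ?X"]) (use u phi_c that in auto)
    then have u_eq: "u = (\<Sum>p\<in>R. phi d N p u *\<^sub>R dif z (idx p))"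
      by (intro basis_inv_coords[OF inv u_Rd]) auto
    have phi_le: "\<bar>phi d N p u\<bar> \<le> 1 + (\<Sum>j<d. \<bar>N p j\<bar>)" if "p \<in> R" for p
    proof -
      have "\<bar>phi d N p u\<bar> \<le> \<bar>Poly_Mapping.lookup u p\<bar> + (\<Sum>j<d. \<bar>N p j * Poly_Mapping.lookup u j\<bar>)"
        unfolding phi_def by (rule order_trans[OF abs_triangle_ineq]) simp
      also have "\<dots> \<le> 1 + (\<Sum>j<d. \<bar>N p j\<bar>)"
        using u lookup_unit_ball[of u d] that R(1)
        by (intro add_mono sum_mono) (auto simp: abs_mult mult_left_le)
      finally show ?thesis .
    qed
    have sum_le: "(\<Sum>p\<in>R. \<bar>phi d N p u\<bar>) \<le> C"
      unfolding C_def by (rule sum_mono[OF phi_le])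
    have phi_C: "\<bar>phi d N p u\<bar> \<le> C" if "p \<in> R" for p
      using member_le_sum[OF that, of "\<lambda>p. \<bar>phi d N p u\<bar>"] fin sum_le by simp
    let ?v = "\<lambda>p. w + e * phi d N p u"
    have "c + e *\<^sub>R u = z 1 + (\<Sum>p\<in>R. w *\<^sub>R dif z (idx p)) + e *\<^sub>R (\<Sum>p\<in>R. phi d N p u *\<^sub>R dif z (idx p))"
      using u_eq by (simp add: c_def)
    also have "\<dots> = z 1 + (\<Sum>p\<in>R. ?v p *\<^sub>R (z (idx p) - z 1))"
      by (simp only: scaleR_sum_right scaleR_scaleR scaleR_add_left sum.distrib add.assoc)
    also have "\<dots> \<in> convex hull ?X"
    proof (rule hull)
      fix p assume "p \<in> R"
      then have "e * \<bar>phi d N p u\<bar> \<le> e * C" using phi_C e(1) by (intro mult_left_mono) auto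
      moreover have "\<bar>e * phi d N p u\<bar> = e * \<bar>phi d N p u\<bar>" using e(1) by (simp add: abs_mult)
      ultimately have "\<bar>e * phi d N p u\<bar> \<le> w" using e(2) by linarith
      then show "0 \<le> ?v p" by linarith
    next
      have "sum ?v R = k * w + e * (\<Sum>p\<in>R. phi d N p u)"
        by (simp add: sum.distrib k_def sum_distrib_left)
      also have "\<dots> \<le> k * w + e * C"
      proof (intro add_left_mono mult_left_mono)
        have "(\<Sum>p\<in>R. phi d N p u) \<le> (\<Sum>p\<in>R. \<bar>phi d N p u\<bar>)" by (intro sum_mono) auto
        then show "(\<Sum>p\<in>R. phi d N p u) \<le> C" using sum_le by linarith
      qed (use e(1) in auto)
      finally show "sum ?v R \<le> 1" using e w by linarith
    qed
    finally show "c + e *\<^sub>R u \<in> convex hull ?X" .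
  qed
  moreover have "c \<in> convex hull ?X"
    unfolding c_def using w by (intro hull) (auto simp: k_def)
  moreover have "?X \<subseteq> Rd d" using z by auto
  ultimately obtain R' where "sandwiched d ?X c e R'"
    using sandwiched_exists[of ?X c d e] e(1) by auto
  then have "ereal e \<le> inner_radius d ?X"
    unfolding inner_radius_def by (intro Sup_upper) blast
  then show ?thesis using e(1) by (metis ereal_less(2) less_le_trans)
qed

lemma outer_radius_geI:
  assumes "\<And>R. enclosed d X R \<Longrightarrow> a \<le> R"
  shows "ereal a \<le> outer_radius d X"
  unfolding outer_radius_def using assms sandwiched_enclosed by (intro Inf_greatest) fastforce

text \<open>The degenerate ball of radius 0 around a point of \<open>X\<close> belongs to a
  sandwich, which makes the infimum finite.\<close>

lemma outer_radius_real:
  assumes "finite X" "X \<subseteq> Rd d" "X \<noteq> {}"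
  obtains \<rho> where "outer_radius d X = ereal \<rho>" "0 \<le> \<rho>"
proof -
  obtain a where a: "a \<in> X" using assms(3) by blast
  then have "\<exists>R. sandwiched d X a 0 R"
    by (intro sandwiched_exists[OF assms(1) _ assms(2)]) (auto intro: hull_inc)
  then obtain R where "sandwiched d X a 0 R" ..
  then have "outer_radius d X \<le> ereal R"
    unfolding outer_radius_def by (intro Inf_lower) blast
  moreover have "ereal 0 \<le> outer_radius d X"
    by (rule outer_radius_geI) (simp add: enclosed_def)
  ultimately show ?thesis
    using that by (cases "outer_radius d X") auto
qed

text \<open>\<open>real_of_ereal\<close> would turn an infinite maximum into 0, so all quotients are
  first shown to be finite.\<close>

lemma aspect_ratio_ge:
  assumes outer: "outer_radius d (z ` {1..t}) = ereal \<rho>" "0 \<le> \<rho>"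
    and pos: "\<And>i. i \<in> {1..t} \<Longrightarrow> 0 < inner_radius d (z ` {1..i})"
    and \<tau>: "\<tau> \<in> {1..t}" "inner_radius d (z ` {1..\<tau>}) \<le> ereal x" "0 < x"
  shows "\<rho> / x \<le> aspect_ratio d z t"
proof -
  let ?q = "\<lambda>i. outer_radius d (z ` {1..t}) / inner_radius d (z ` {1..i})"
  have fin: "\<exists>v. ?q i = ereal v" if "i \<in> {1..t}" for i
    using pos[OF that] outer by (cases "inner_radius d (z ` {1..i})") auto
  have "Max (?q ` {1..t}) \<in> ?q ` {1..t}" using \<tau>(1) by (intro Max_in) auto
  then obtain v where v: "Max (?q ` {1..t}) = ereal v" using fin by force
  have "ereal (\<rho> / x) \<le> ?q \<tau>"
    using pos[OF \<tau>(1)] \<tau>(2,3) outer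
    by (cases "inner_radius d (z ` {1..\<tau>})") (auto intro: divide_left_mono)
  also have "\<dots> \<le> ereal v" unfolding v[symmetric] using \<tau>(1) by (intro Max_ge) auto
  finally show ?thesis unfolding aspect_ratio_def v by simp
qed

lemma prod_list_bound:
  fixes g :: "'a \<Rightarrow> real"
  assumes "\<And>x. x \<in> set xs \<Longrightarrow> 0 \<le> g x \<and> g x \<le> b"
  shows "(\<Prod>x\<leftarrow>xs. g x) \<le> b ^ length xs"
proof -
  have "0 \<le> (\<Prod>x\<leftarrow>xs. g x) \<and> (\<Prod>x\<leftarrow>xs. g x) \<le> b ^ length xs"
    using assms
  proof (induction xs)
    case (Cons x xs)
    have "0 \<le> g x" "g x \<le> b" using Cons.prems[of x] by auto
    moreover from this have "0 \<le> b" by linarith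
    ultimately show ?case using Cons by (auto intro!: mult_mono)
  qed simp
  then show ?thesis ..
qed

text \<open>Let \<open>k\<close> be the length of \<open>bs\<close> and \<open>a\<close> the aspect
  ratio. The Gram determinant of the basis is at least \<open>4 ^ s\<close> times the product of the
  squared heights and at most \<open>(2 * \<rho>) ^ (2 * k)\<close>. Each height \<open>e\<close>
  satisfies \<open>2 * \<rho> \<le> a * e\<close>, so the heights cancel and only powers of
  \<open>a\<close> remain.\<close>

lemma volume_inv_aspect_ratio:
  assumes vol: "volume_inv d z t bs s" and bs: "set bs \<subseteq> dif z ` {1..t}"
    and z: "\<And>i. i \<in> {1..t} \<Longrightarrow> z i \<in> Rd d" and t: "1 \<le> t"
    and pos: "\<And>i. i \<in> {1..t} \<Longrightarrow> 0 < inner_radius d (z ` {1..i})"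
  shows "4 ^ s \<le> (aspect_ratio d z t ^ length bs)\<^sup>2"
    and "bs \<noteq> [] \<Longrightarrow> 0 \<le> aspect_ratio d z t"
    and "2 \<le> length bs \<Longrightarrow> 3 / 2 \<le> aspect_ratio d z t"
proof -
  let ?a = "aspect_ratio d z t"
  obtain ys ds where ds: "length ds = length bs"
     "4 ^ s * gram d ys \<le> gram d bs" "gram d ys = (\<Prod>e\<leftarrow>ds. e\<^sup>2)"
     "\<forall>e\<in>set ds. 0 < e \<and> (\<exists>\<tau>\<in>{1..t}. inner_radius d (z ` {1..\<tau>}) \<le> ereal (e / 2))"
     and large: "2 \<le> length bs \<longrightarrow> (\<exists>\<tau>\<in>{1..t}. \<forall>R. enclosed d (z ` {1..\<tau>}) R \<longrightarrow>
        inner_radius d (z ` {1..\<tau>}) \<le> ereal (2 * R / 3))"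
    using vol unfolding volume_inv_def by blast
  have "finite (z ` {1..t})" "z ` {1..t} \<subseteq> Rd d" "z ` {1..t} \<noteq> {}"
    using z t by auto
  then obtain \<rho> where \<rho>: "outer_radius d (z ` {1..t}) = ereal \<rho>" "0 \<le> \<rho>"
    by (rule outer_radius_real)
  have ratio: "\<rho> / x \<le> ?a" if "\<tau> \<in> {1..t}" "inner_radius d (z ` {1..\<tau>}) \<le> ereal x" "0 < x" for \<tau> x
    by (rule aspect_ratio_ge[OF \<rho> _ that]) (rule pos)
  have e_ratio: "0 < e \<and> 2 * \<rho> \<le> ?a * e" if "e \<in> set ds" for e
  proof -
    have "0 < e" using ds(4) that by blast
    moreover have "\<rho> / (e / 2) \<le> ?a" using ds(4) that ratio[where x = "e / 2"] by force
    ultimately show ?thesis by (simp add: field_simps)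
  qed
  have dist: "nrm d b \<le> 2 * \<rho>" if b: "b \<in> set bs" for b
  proof -
    obtain i where i: "i \<in> {1..t}" "b = dif z i" using bs b by blast
    have "ereal (nrm d b / 2) \<le> outer_radius d (z ` {1..t})"
    proof (rule outer_radius_geI)
      fix R assume "enclosed d (z ` {1..t}) R"
      then have "nrm d (z i - z 1) \<le> 2 * R"
        using i t by (intro enclosed_dist) (auto intro: hull_inc)
      then show "nrm d b / 2 \<le> R" using i by simp
    qed
    then show ?thesis using \<rho> by simp
  qed
  have "ip d b b \<le> (2 * \<rho>)\<^sup>2" if "b \<in> set bs" for b
    unfolding nrm_power2[symmetric] using dist[OF that] by (intro power_mono) auto
  then have "(\<Prod>b\<leftarrow>bs. ip d b b) \<le> ((2 * \<rho>)\<^sup>2) ^ length bs"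
    by (intro prod_list_bound) auto
  moreover have "gram d bs \<le> (\<Prod>b\<leftarrow>bs. ip d b b)"
    using gram_bounds[of bs d] bs z t by fastforce
  moreover have "((2 * \<rho>)\<^sup>2) ^ length ds \<le> (?a\<^sup>2) ^ length ds * (\<Prod>e\<leftarrow>ds. e\<^sup>2)"
    using e_ratio
  proof (induction ds)
    case (Cons e es)
    have "(2 * \<rho>)\<^sup>2 \<le> (?a * e)\<^sup>2" using Cons.prems[of e] \<rho>(2) by (intro power_mono) auto
    then have "(2 * \<rho>)\<^sup>2 * ((2 * \<rho>)\<^sup>2) ^ length es \<le> (?a * e)\<^sup>2 * ((?a\<^sup>2) ^ length es * (\<Prod>e\<leftarrow>es. e\<^sup>2))"
      using Cons by (intro mult_mono) auto
    then show ?case by (simp add: power_mult_distrib mult_ac)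
  qed simp
  ultimately have "4 ^ s * (\<Prod>e\<leftarrow>ds. e\<^sup>2) \<le> (?a\<^sup>2) ^ length bs * (\<Prod>e\<leftarrow>ds. e\<^sup>2)"
    using ds(1-3) by simp
  moreover have "0 < (\<Prod>e\<leftarrow>ds. e\<^sup>2)" using e_ratio by (induction ds) fastforce+
  ultimately have "4 ^ s \<le> (?a\<^sup>2) ^ length bs" by simp
  then show "4 ^ s \<le> (?a ^ length bs)\<^sup>2" by (simp add: power_mult[symmetric] mult.commute)
  show "0 \<le> ?a" if ne: "bs \<noteq> []"
  proof -
    obtain e where "e \<in> set ds" using ne ds(1) by (cases ds) auto
    then have "0 < e" "0 \<le> ?a * e" using e_ratio \<rho>(2) by fastforce+
    then show ?thesis by (simp add: zero_le_mult_iff)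
  qed
  show "3 / 2 \<le> ?a" if len: "2 \<le> length bs"
  proof -
    obtain \<tau> where \<tau>: "\<tau> \<in> {1..t}" "\<And>R. enclosed d (z ` {1..\<tau>}) R \<Longrightarrow>
        inner_radius d (z ` {1..\<tau>}) \<le> ereal (2 * R / 3)"
      using large len by blast
    have sub: "z ` {1..\<tau>} \<subseteq> z ` {1..t}" using \<tau>(1) by auto
    have enc: "inner_radius d (z ` {1..\<tau>}) \<le> ereal (2 * R / 3)" if "enclosed d (z ` {1..t}) R" for R
      using \<tau>(2) enclosed_mono[OF that sub] by blast
    \<comment> \<open>Without an enclosing ball \<open>enc\<close> would be vacuous and the inner
      radius might be infinite; the finite outer radius provides one.\<close>
    have "\<exists>R. enclosed d (z ` {1..t}) R"
    proof (rule ccontr)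
      assume "\<not> ?thesis"
      then have "ereal (\<rho> + 1) \<le> outer_radius d (z ` {1..t})" by (intro outer_radius_geI) auto
      then show False using \<rho> by simp
    qed
    then obtain r where r: "inner_radius d (z ` {1..\<tau>}) = ereal r" "0 < r"
      using enc pos[OF \<tau>(1)] by (cases "inner_radius d (z ` {1..\<tau>})") force+
    have "ereal (3 / 2 * r) \<le> outer_radius d (z ` {1..t})"
      using enc r(1) by (intro outer_radius_geI) fastforce
    then have "3 / 2 \<le> \<rho> / r" using \<rho> r(2) by (simp add: field_simps)
    also have "\<dots> \<le> ?a" using ratio[OF \<tau>(1), of r] r by simp
    finally show ?thesis .
  qed
qed

text \<open>The Gram determinant of the reference list is a positive integer and hence at least 1,
  which replaces the lower bounds on the heights. The differences have coordinates of absolute value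
  at most \<open>2 * N\<close>.\<close>

lemma volume_inv_Ints:
  assumes vol: "volume_inv d z t bs s" and bs: "set bs \<subseteq> dif z ` {1..t}"
    and z: "\<And>i. i \<in> {1..t} \<Longrightarrow> z i \<in> Rd d" and t: "1 \<le> t"
    and Z: "\<And>i j. i \<in> {1..t} \<Longrightarrow> j < d \<Longrightarrow> Poly_Mapping.lookup (z i) j \<in> \<int> \<and> \<bar>Poly_Mapping.lookup (z i) j\<bar> \<le> N"
  shows "4 ^ s \<le> (4 * N\<^sup>2 * real d) ^ length bs"
proof -
  obtain ys ds where ds: "set ys \<subseteq> dif z ` {1..t}" 
     "4 ^ s * gram d ys \<le> gram d bs" "gram d ys = (\<Prod>e\<leftarrow>ds. e\<^sup>2)" "\<forall>e\<in>set ds. 0 < e"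
    using vol unfolding volume_inv_def by blast
  have "0 < gram d ys" unfolding ds(3) using ds(4) by (induction ds) auto
  moreover have "gram d ys \<in> \<int>"
    using ds(1) Z t by (intro gram_Ints) (fastforce simp: lookup_minus)
  ultimately have "1 \<le> gram d ys"
    by (metis Ints_cases of_int_0_less_iff of_int_1_le_iff int_one_le_iff_zero_less)
  then have "4 ^ s \<le> 4 ^ s * gram d ys" by simp
  also note ds(2)
  also have "gram d bs \<le> (\<Prod>b\<leftarrow>bs. ip d b b)"
    using gram_bounds[of bs d] bs z t by fastforce
  also have "\<dots> \<le> (4 * N\<^sup>2 * real d) ^ length bs"
  proof (rule prod_list_bound)
    fix b assume "b \<in> set bs"
    then obtain i where i: "i \<in> {1..t}" "b = dif z i" using bs by blast
    have "ip d b b \<le> (\<Sum>j<d. (2 * N)\<^sup>2)"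
      unfolding ip_def
    proof (rule sum_mono)
      fix j assume "j \<in> {..<d}"
      then have "\<bar>Poly_Mapping.lookup (z i) j\<bar> \<le> N" "\<bar>Poly_Mapping.lookup (z 1) j\<bar> \<le> N"
        using Z i t by auto
      then have "\<bar>Poly_Mapping.lookup b j\<bar> \<le> 2 * N" using i by (simp add: lookup_minus)
      then have "\<bar>Poly_Mapping.lookup b j\<bar>\<^sup>2 \<le> (2 * N)\<^sup>2" by (intro power_mono) auto
      then show "Poly_Mapping.lookup b j * Poly_Mapping.lookup b j \<le> (2 * N)\<^sup>2"
        by (simp add: power2_eq_square)
    qed
    then show "0 \<le> ip d b b \<and> ip d b b \<le> 4 * N\<^sup>2 * real d"
      by (simp add: power_mult_distrib mult.commute)
  qed
  finally show ?thesis .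
qed

section \<open>Size bounds and conclusion\<close>

lemma ln_3_halves_ge: "1 / 3 \<le> ln (3 / 2 :: real)"
proof -
  have "ln (2 / 3 :: real) \<le> 2 / 3 - 1" by (rule ln_le_minus_one) simp
  moreover have "ln (2 / 3 :: real) = - ln (3 / 2)" by (simp add: ln_div)
  ultimately show ?thesis by simp
qed

text \<open>With \<open>L = k * ln a\<close>, logarithms give \<open>2 * s \<le> 3 * L\<close>, and
  for \<open>k \<ge> 2\<close> the estimate \<open>ln a \<ge> 1 / 3\<close> gives
  \<open>k \<le> 3 * L\<close>, so \<open>5 + 4 * (k + s)\<close> is at most
  \<open>5 + 18 * L\<close>. For \<open>k \<le> 1\<close> the maximum with 1 absorbs
  \<open>k\<close>, and 30 is a rounded constant.\<close>

lemma coreset_size_bounds: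
  fixes a :: real and k s :: nat
  assumes "4 ^ s \<le> (a ^ k)\<^sup>2" "k \<noteq> 0 \<Longrightarrow> 0 \<le> a" "2 \<le> k \<Longrightarrow> 3 / 2 \<le> a"
  shows "5 + 4 * real (k + s) \<le> 30 * max 1 (real k * ln (real k * a))"
    and "1 + real (k + s) \<le> 30 * max 1 (real k * ln a)"
proof -
  let ?L = "real k * ln a"
  have main: "5 + 4 * real (k + s) \<le> 30 * max 1 ?L"
  proof (cases "k = 0")
    case True
    have "s = 0"
    proof (rule ccontr)
      assume "s \<noteq> 0"
      then have "(4 :: real) ^ 1 \<le> 4 ^ s" by (intro power_increasing) auto
      then show False using assms(1) True by simp
    qed
    then show ?thesis using True by simp
  next
    case False
    then have a0: "0 \<le> a" using assms(2) by simp
    have "a \<noteq> 0"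
    proof
      assume "a = 0"
      then have "(4 :: real) ^ s \<le> 0" using assms(1) False by (simp add: zero_power)
      then show False by (metis not_le zero_less_numeral zero_less_power)
    qed
    then have a: "0 < a" using a0 by simp
    have "(4 :: real) ^ s = (2 ^ s)\<^sup>2" by (simp add: power2_eq_square flip: power_mult_distrib)
    then have "((2 :: real) ^ s)\<^sup>2 \<le> (a ^ k)\<^sup>2" using assms(1) by metis
    then have "(2 :: real) ^ s \<le> a ^ k"
      by (rule power2_le_imp_le) (use a in simp)
    then have "ln ((2 :: real) ^ s) \<le> ln (a ^ k)" using a by (subst ln_le_cancel_iff) auto
    then have "real s * ln 2 \<le> ?L" using a by (simp add: ln_realpow)
    moreover have "real s * (2 / 3) \<le> real s * ln 2"
      using ln2_ge_two_thirds by (intro mult_left_mono) auto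
    ultimately have s: "real s * 2 \<le> 3 * ?L" by linarith
    show ?thesis
    proof (cases "k = 1")
      case True
      then show ?thesis using s by auto
    next
      case False
      then have "2 \<le> k" using \<open>k \<noteq> 0\<close> by simp
      then have "1 / 3 \<le> ln a"
        using assms(3) a ln_3_halves_ge ln_le_cancel_iff[of "3 / 2" a] by linarith
      then have "real k * (1 / 3) \<le> ?L" by (intro mult_left_mono) auto
      then show ?thesis using s by auto
    qed
  qed
  have "1 + real (k + s) \<le> 5 + 4 * real (k + s)" by simp
  also note main
  finally show "1 + real (k + s) \<le> 30 * max 1 ?L" .
  \<comment> \<open>If \<open>?L\<close> is not positive, its maximum with 1 is 1 and nothing is to
    be shown.\<close>
  have "?L \<le> real k * ln (real k * a)" if "0 < ?L"
  proof -
    have k: "1 \<le> k" and "0 < ln a" using that by (auto simp: zero_less_mult_iff)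
    moreover have "0 \<le> a" using assms(2) k by simp
    ultimately have "0 < a" by (cases "a = 0") auto
    then have "ln a \<le> ln (real k * a)" using k by (subst ln_le_cancel_iff) auto
    then show ?thesis by (intro mult_left_mono) auto
  qed
  then have "max 1 ?L \<le> max 1 (real k * ln (real k * a))" by fastforce
  with main show "5 + 4 * real (k + s) \<le> 30 * max 1 (real k * ln (real k * a))" by linarith
qed

text \<open>As \<open>4 * N\<^sup>2 * d\<close> is at most \<open>(2 * d * N)\<^sup>2\<close>,
  logarithms bound \<open>s\<close> by \<open>k\<close> plus a multiple of
  \<open>k * ln (d * N)\<close>. For \<open>k \<ge> 2\<close> also \<open>d * N \<ge> 2\<close>, so
  that \<open>k\<close> is absorbed.\<close>

lemma coreset_size_bounds_Ints:
  fixes k s N d :: nat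
  assumes "4 ^ s \<le> (4 * (real N)\<^sup>2 * real d) ^ k" "k \<le> d" "1 \<le> N" "1 \<le> d"
  shows "5 + 4 * real (k + s) \<le> 30 * max 1 (real k * ln (real d * real N))"
proof -
  let ?q = "real d * real N"
  let ?L = "real k * ln ?q"
  have q: "1 \<le> ?q" "0 < ?q" using assms(3,4) by (simp_all add: mult_ge1_I)
  have "real d \<le> (real d)\<^sup>2" using assms(4) by (simp add: power2_eq_square)
  then have "(real N)\<^sup>2 * real d \<le> (real N)\<^sup>2 * (real d)\<^sup>2" by (intro mult_left_mono) auto
  then have "4 * (real N)\<^sup>2 * real d \<le> (2 * ?q)\<^sup>2"
    by (simp add: power_mult_distrib mult.commute)
  then have "(4 * (real N)\<^sup>2 * real d) ^ k \<le> ((2 * ?q)\<^sup>2) ^ k" by (intro power_mono) auto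
  also have "\<dots> = ((2 * ?q) ^ k)\<^sup>2" by (simp only: power_mult[symmetric] mult.commute)
  finally have "4 ^ s \<le> ((2 * ?q) ^ k)\<^sup>2" using assms(1) by simp
  moreover have "(4 :: real) ^ s = (2 ^ s)\<^sup>2" by (simp add: power2_eq_square flip: power_mult_distrib)
  ultimately have "((2 :: real) ^ s)\<^sup>2 \<le> ((2 * ?q) ^ k)\<^sup>2" by metis
  then have "(2 :: real) ^ s \<le> (2 * ?q) ^ k"
    by (rule power2_le_imp_le) (use q in simp)
  then have "ln ((2 :: real) ^ s) \<le> ln ((2 * ?q) ^ k)" using q by (subst ln_le_cancel_iff) auto
  also have "\<dots> = real k * (ln 2 + ln ?q)"
    using q by (simp add: ln_realpow ln_mult_pos distrib_left)
  finally have "real s * ln 2 \<le> real k * ln 2 + ?L" by (simp add: ln_realpow distrib_left)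
  \<comment> \<open>\<open>s - k\<close> may be negative, and then multiplication by it would
    reverse the estimate of \<open>ln 2\<close>.\<close>
  moreover have "(real s - real k) * (2 / 3) \<le> (real s - real k) * ln 2 \<or> real s \<le> real k"
    using mult_left_mono[OF ln2_ge_two_thirds, of "real s - real k"] by linarith
  moreover have L: "0 \<le> ?L" using q by simp
  ultimately have s: "2 * real s \<le> 2 * real k + 3 * ?L" by (auto simp: left_diff_distrib)
  have mx: "1 \<le> max 1 ?L" "?L \<le> max 1 ?L" by simp_all
  show ?thesis
  proof (cases "k \<le> 1")
    case True
    then have "real k \<le> 1" by simp
    then show ?thesis using s L mx unfolding of_nat_add by argo
  next
    case False
    then have "2 \<le> d" using assms(2) by simp
    then have "2 * 1 \<le> ?q" using assms(3) by (intro mult_mono) auto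
    then have "2 / 3 \<le> ln ?q" using ln2_ge_two_thirds ln_le_cancel_iff[of 2 ?q] by linarith
    then have "real k * (2 / 3) \<le> ?L" by (intro mult_left_mono) auto
    then show ?thesis using s L mx unfolding of_nat_add by argo
  qed
qed

section \<open>Runs of the program and their output\<close>

text \<open>Before the first point there is no origin for the shifted coordinates, so time 0 is
  described by the zero memory instead.\<close>

definition run_inv :: "nat \<Rightarrow> (nat \<Rightarrow> point) \<Rightarrow> nat \<Rightarrow> state \<Rightarrow> bool" where
  "run_inv d z t s \<longleftrightarrow> (\<exists>m p f S. St d t m p f S s \<and>
     (if t = 0 then m = 0 \<and> f = (\<lambda>_ _. 0) \<and> S = {}
      else stream_inv d z t m f S \<and> cell s 0 = 1 / (5 + 4 * real m) \<and>
        (\<forall>j. f 0 j = Poly_Mapping.lookup (z 1) j + f 5 j / (2 * (real m + 1)))))"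

lemma run_inv_initial: "run_inv d z 0 initial_state"
  unfolding run_inv_def by (intro exI[of _ 0] exI[of _ "\<lambda>_ _. 0"] exI[of _ "{}"]) (simp add: St_def initial_state_def)

text \<open>That \<open>m\<close> is below \<open>t\<close> keeps the pivot counter within the
  register bound.\<close>

lemma stream_inv_basic:
  assumes "stream_inv d z t m f S"
  shows "m < t" "\<forall>j<d. f 3 j \<le> 4" "f 1 = Poly_Mapping.lookup (z 1)"
proof -
  have S: "card S = Suc m" "S \<subseteq> {1..t}"
    using assms unfolding stream_inv_def basis_inv_def by blast+
  then have "Suc m \<le> t" using card_mono[of "{1..t}" S] by simp
  then show "m < t" by simp
  show "\<forall>j<d. f 3 j \<le> 4" "f 1 = Poly_Mapping.lookup (z 1)"
    using assms unfolding stream_inv_def by force+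
qed

lemma run_inv_step:
  assumes run_inv: "run_inv d z t s" and z: "\<And>i. i \<in> {1..Suc t} \<Longrightarrow> z i \<in> Rd d"
    and d: "1 \<le> d" "d \<le> W" "9 * d\<^sup>2 \<le> M" "t < W"
  shows "\<exists>k s'. k \<le> 2000 * d\<^sup>2 \<and> exec d (z (Suc t)) M W coreset_program s k s' \<and> run_inv d z (Suc t) s' \<and>
    (selected s' = selected s \<or> selected s' = selected s \<union> {Suc t})"
proof -
  obtain m p f S where s: "St d t m p f S s"
    and f: "if t = 0 then m = 0 \<and> f = (\<lambda>_ _. 0) \<and> S = {} else stream_inv d z t m f S"
    using run_inv unfolding run_inv_def by (metis (full_types))
  have "m < W" "\<forall>j<d. f 3 j \<le> 4"
    using f stream_inv_basic[of d z t m f S] d by (auto split: if_splits)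
  then obtain k s' m' p' f' S' where k: "k \<le> 2000 * d\<^sup>2"
    "exec d (z (Suc t)) M W coreset_program s k s'"
    and s': "St d (Suc t) m' p' f' S' s'" "cell s' 0 = 1 / (5 + 4 * real m')"
    and rel: "step_rel d (z (Suc t)) t m f S m' f' S'"
    using triple_coreset_program[OF d(1,2,3,4), of m f "z (Suc t)" p S] s
    unfolding triple_def by blast
  have inv: "stream_inv d z (Suc t) m' f' S' \<and> (S' = S \<or> S' = S \<union> {Suc t})"
  proof (cases "t = 0")
    case True
    then show ?thesis
      using f rel stream_inv_first[of d z m' f' S'] by auto
  next
    case False
    then have "stream_inv d z t m f S" "1 \<le> t" using f by auto
    from stream_inv_step[OF this _ rel] show ?thesis using z by blast
  qed
  have "\<forall>j. f' 0 j = f' 1 j + f' 5 j / (2 * (real m' + 1))"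
    using rel unfolding step_rel_def by (elim exE conjE) (simp only: simp_thms)
  then have "run_inv d z (Suc t) s'"
    unfolding run_inv_def using s' inv stream_inv_basic(3)[of d z "Suc t" m' f' S']
    by (intro exI[of _ m'] exI[of _ p'] exI[of _ f'] exI[of _ S']) auto
  moreover have "selected s = S" "selected s' = S'" using s s' by (simp_all add: St_def)
  ultimately show ?thesis using k inv by blast
qed

lemma run_inv_inner_radius_pos:
  assumes "run_inv d z t s" "1 \<le> t" "\<And>i. i \<in> {1..t} \<Longrightarrow> z i \<in> Rd d"
  shows "0 < inner_radius d (z ` {1..t})"
proof -
  obtain m f S where "stream_inv d z t m f S"
    using assms(1,2) unfolding run_inv_def by auto
  then obtain R idx where "basis_inv d z t (\<lambda>i. f (7 + i)) R idx S"
    unfolding stream_inv_def by blast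
  then show ?thesis using assms(2,3) by (rule basis_inv_inner_radius_pos)
qed

lemma lookup_point_of: "Poly_Mapping.lookup (point_of d g) j = (if j < d then g j else 0)"
  by (simp add: point_of_def lookup_sum lookup_single when_def)

lemma run_inv_output:
  assumes run_inv: "run_inv d z t s" and t: "1 \<le> t" and d: "1 \<le> d"
    and z_Rd: "\<forall>i\<in>{1..t}. z i \<in> Rd d"
    and inner_pos: "\<forall>i\<in>{1..t}. 0 < inner_radius d (z ` {1..i})"
  defines "k \<equiv> real (affine_dim (z ` {1..t}))"
  shows "selected s \<subseteq> {1..t}" "center d s \<in> Rd d" "0 < scaling s" "scaling s \<le> 1"
    and "convex hull (z ` {1..t}) \<subseteq> dilate (center d s) (1 / scaling s) (convex hull (z ` selected s))"
    and "1 / scaling s \<le> 30 * max 1 (k * ln (k * aspect_ratio d z t))"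
    and "real (card (selected s)) \<le> 30 * max 1 (k * ln (aspect_ratio d z t))"
    and "1 \<le> N \<Longrightarrow> (\<And>i j. i \<in> {1..t} \<Longrightarrow> j < d \<Longrightarrow>
        Poly_Mapping.lookup (z i) j \<in> \<int> \<and> \<bar>Poly_Mapping.lookup (z i) j\<bar> \<le> real N) \<Longrightarrow>
      1 / scaling s \<le> 30 * max 1 (k * ln (real d * real N)) \<and>
      real (card (selected s)) \<le> 30 * max 1 (k * ln (real d * real N))"
proof -
  have z: "z i \<in> Rd d" and pos: "0 < inner_radius d (z ` {1..i})" if "i \<in> {1..t}" for i
    using z_Rd inner_pos that by blast+
  obtain m p f S where s: "St d t m p f S s" and inv: "stream_inv d z t m f S"
    and c0: "cell s 0 = 1 / (5 + 4 * real m)"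
    and f0: "\<And>j. f 0 j = Poly_Mapping.lookup (z 1) j + f 5 j / (2 * (real m + 1))"
    using run_inv t unfolding run_inv_def by auto
  obtain R idx ord s' where basis: "basis_inv d z t (\<lambda>i. f (7 + i)) R idx S"
    and ord: "distinct ord" "set ord = R" "m = length ord + s'"
    and vol: "volume_inv d z t (map (\<lambda>p. dif z (idx p)) ord) s'" and card: "card S = Suc m"
    and f5: "\<forall>j. f 5 j = (\<Sum>s\<in>S. Poly_Mapping.lookup (dif z s) j)"
    using inv unfolding stream_inv_def by blast
  have S: "S \<subseteq> {1..t}" "1 \<in> S" "R \<subseteq> {..<d}" "idx ` R \<subseteq> S - {1}"
    using basis by (simp_all add: basis_inv_def)
  have finS: "finite S" using S(1) by (auto intro: finite_subset)
  have sel: "selected s = S" using s by (simp add: St_def)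
  then show "selected s \<subseteq> {1..t}" using S by simp
  have scal: "scaling s = 1 / (5 + 4 * real m)" by (simp add: scaling_def c0)
  then show "0 < scaling s" "scaling s \<le> 1" by simp_all
  have k: "k = real (length ord)"
    using basis_inv_affine_dim[OF basis z t] ord(1,2) by (simp add: k_def distinct_card[symmetric])
  have k_le: "length ord \<le> d"
    using card_mono[of "{..<d}" R] S(3) ord(1,2) by (simp add: distinct_card[symmetric])
  define bs where "bs = map (\<lambda>p. dif z (idx p)) ord"
  have bs: "set bs \<subseteq> dif z ` {1..t}" "length bs = length ord"
  proof -
    have "set bs = dif z ` idx ` R" by (simp add: bs_def ord(2) image_image)
    moreover have "idx ` R \<subseteq> {1..t}" using S(1,4) by blast
    ultimately show "set bs \<subseteq> dif z ` {1..t}" by (simp add: image_mono)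
  qed (simp add: bs_def)
  note vol = vol[folded bs_def]
  note ratio = volume_inv_aspect_ratio[OF vol bs(1) z t pos]
  have "4 ^ s' \<le> (aspect_ratio d z t ^ length ord)\<^sup>2"
    "length ord \<noteq> 0 \<Longrightarrow> 0 \<le> aspect_ratio d z t" "2 \<le> length ord \<Longrightarrow> 3 / 2 \<le> aspect_ratio d z t"
  proof -
    show "4 ^ s' \<le> (aspect_ratio d z t ^ length ord)\<^sup>2" using ratio(1) bs(2) by simp
    show "0 \<le> aspect_ratio d z t" if "length ord \<noteq> 0"
    proof (rule ratio(2))
      show "bs \<noteq> []" using that bs(2) by auto
    qed
    show "3 / 2 \<le> aspect_ratio d z t" if "2 \<le> length ord"
    proof (rule ratio(3))
      show "2 \<le> length bs" using that bs(2) by simp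
    qed
  qed
  note bounds = coreset_size_bounds[OF this]
  show "1 / scaling s \<le> 30 * max 1 (k * ln (k * aspect_ratio d z t))"
    using bounds(1) by (simp add: scal k ord(3))
  show "real (card (selected s)) \<le> 30 * max 1 (k * ln (aspect_ratio d z t))"
    using bounds(2) by (simp add: sel card k ord(3))
  show "1 / scaling s \<le> 30 * max 1 (k * ln (real d * real N)) \<and>
      real (card (selected s)) \<le> 30 * max 1 (k * ln (real d * real N))"
    if N: "1 \<le> N" and Z: "\<And>i j. i \<in> {1..t} \<Longrightarrow> j < d \<Longrightarrow>
        Poly_Mapping.lookup (z i) j \<in> \<int> \<and> \<bar>Poly_Mapping.lookup (z i) j\<bar> \<le> real N"
  proof -
    have "4 ^ s' \<le> (4 * (real N)\<^sup>2 * real d) ^ length ord"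
      using volume_inv_Ints[OF vol bs(1) z t Z] bs(2) by simp
    from coreset_size_bounds_Ints[OF this k_le N d]
    have *: "5 + 4 * real m \<le> 30 * max 1 (k * ln (real d * real N))"
      by (simp add: k ord(3))
    moreover have "real (card S) \<le> 5 + 4 * real m" by (simp add: card)
    ultimately show ?thesis by (simp add: scal sel)
  qed
  show center_Rd: "center d s \<in> Rd d"
    by (simp add: Rd_iff center_def lookup_point_of)
  let ?F = "S - {1}"
  have F: "finite ?F" "card ?F = m" using finS S(2) card by simp_all
  have center: "center d s = z 1 + (1 / (2 * (real (card ?F) + 1))) *\<^sub>R (\<Sum>s\<in>?F. z s - z 1)"
  proof (rule Rd_eqI[OF center_Rd])
    show "z 1 + (1 / (2 * (real (card ?F) + 1))) *\<^sub>R (\<Sum>s\<in>?F. z s - z 1) \<in> Rd d"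
      using z S(1) t by (intro Rd_add Rd_scale Rd_sum Rd_diff) auto
    fix j assume j: "j < d"
    \<comment> \<open>The summand of index 1 is 0, so the sum maintained by the program is the one
      over the other selected points.\<close>
    have "f 5 j = (\<Sum>s\<in>?F. Poly_Mapping.lookup (dif z s) j)"
      using f5 sum.remove[OF finS S(2), of "\<lambda>s. Poly_Mapping.lookup (dif z s) j"] by simp
    \<comment> \<open>Row \<open>0\<close> begins at cell 1, where the output convention expects the
      center.\<close>
    moreover have "Poly_Mapping.lookup (center d s) j = f 0 j"
      using St_cell[OF s j, of 0] j by (simp add: center_def lookup_point_of loc_def)
    ultimately show "Poly_Mapping.lookup (center d s) j =
        Poly_Mapping.lookup (z 1 + (1 / (2 * (real (card ?F) + 1))) *\<^sub>R (\<Sum>s\<in>?F. z s - z 1)) j"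
      unfolding F(2) f0 by (simp add: lookup_add lookup_sum)
  qed
  have zS: "insert (z 1) (z ` ?F) = z ` S" using S(2) by blast
  have "z i \<in> dilate (center d s) (1 / scaling s) (convex hull (z ` S))" if i: "i \<in> {1..t}" for i
  proof -
    obtain l where l: "dif z i = (\<Sum>s\<in>?F. l s *\<^sub>R dif z s)" "\<forall>s. \<bar>l s\<bar> \<le> 2"
      using basis i unfolding basis_inv_def by blast
    have "z i = z 1 + (\<Sum>s\<in>?F. l s *\<^sub>R (z s - z 1))"
      using l(1) by (metis add.commute diff_add_cancel)
    from in_dilated_hull[OF F(1) this _ center]
    have "z i \<in> dilate (center d s) (5 + 4 * real (card ?F)) (convex hull (insert (z 1) (z ` ?F)))"
      using l(2) by blast
    then show ?thesis unfolding zS F(2) by (simp add: scal)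
  qed
  \<comment> \<open>A dilated convex set is convex, so containing the points is enough.\<close>
  then have "z ` {1..t} \<subseteq> dilate (center d s) (1 / scaling s) (convex hull (z ` S))" by blast
  then show "convex hull (z ` {1..t}) \<subseteq> dilate (center d s) (1 / scaling s) (convex hull (z ` selected s))"
    unfolding sel by (intro hull_minimal dilate_convex convex_convex_hull)
qed

text \<open>The step lemma yields only the existence of a next state, so the run is assembled by
  dependent choice over pairs of a state and the time just spent. Beyond time \<open>n\<close> the
  conditions are vacuous, which lets the choice range over all natural numbers.\<close>

lemma run_inv_run_exists:
  assumes d: "1 \<le> d" "d \<le> W" "9 * d\<^sup>2 \<le> M" "n \<le> W" and z: "\<And>i. i \<in> {1..n} \<Longrightarrow> z i \<in> Rd d"
  obtains \<sigma> \<tau> where "\<sigma> 0 = initial_state" "\<And>t. t \<le> n \<Longrightarrow> run_inv d z t (\<sigma> t)"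
    "\<And>t. t < n \<Longrightarrow> exec d (z (Suc t)) M W coreset_program (\<sigma> t) (\<tau> (Suc t)) (\<sigma> (Suc t)) \<and>
      \<tau> (Suc t) \<le> 2000 * d\<^sup>2 \<and>
      (selected (\<sigma> (Suc t)) = selected (\<sigma> t) \<or> selected (\<sigma> (Suc t)) = selected (\<sigma> t) \<union> {Suc t})"
proof -
  let ?P = "\<lambda>t (s, k :: nat). (t = 0 \<longrightarrow> s = initial_state) \<and> (t \<le> n \<longrightarrow> run_inv d z t s)"
  let ?Q = "\<lambda>t (s, k :: nat) (s', k'). t < n \<longrightarrow>
    exec d (z (Suc t)) M W coreset_program s k' s' \<and> k' \<le> 2000 * d\<^sup>2 \<and>
      (selected s' = selected s \<or> selected s' = selected s \<union> {Suc t})"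
  have "\<exists>g. \<forall>t. ?P t (g t) \<and> ?Q t (g t) (g (Suc t))"
  proof (rule dependent_nat_choice)
    show "\<exists>x. ?P 0 x" using run_inv_initial by auto
    fix x t assume P: "?P t x"
    obtain s k where x: "x = (s, k)" by force
    show "\<exists>y. ?P (Suc t) y \<and> ?Q t x y"
    proof (cases "t < n")
      case True
      then have "run_inv d z t s" using P x by simp
      from run_inv_step[OF this _ d(1-3)] obtain k' s' where "k' \<le> 2000 * d\<^sup>2"
        "exec d (z (Suc t)) M W coreset_program s k' s'" "run_inv d z (Suc t) s'"
        "selected s' = selected s \<or> selected s' = selected s \<union> {Suc t}"
        using z d(4) True by force
      then show ?thesis using x by (intro exI[of _ "(s', k')"]) simp
    qed (auto simp: x)
  qed
  then obtain g where g: "\<And>t. ?P t (g t) \<and> ?Q t (g t) (g (Suc t))" by blast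
  show ?thesis
    by (rule that[of "\<lambda>t. fst (g t)" "\<lambda>t. snd (g t)"])
      (use g in \<open>force simp: case_prod_beta\<close>)+
qed

theorem theorem4:
  shows "\<exists>(P :: com) (K :: nat). \<forall>(d :: nat) (n :: nat) (z :: nat \<Rightarrow> point).
    1 \<le> d \<longrightarrow> 1 \<le> n \<longrightarrow> (\<forall>i\<in>{1..n}. z i \<in> Rd d) \<longrightarrow>
    (\<exists>\<sigma> \<tau>.
      stream_run P d z n (K * d\<^sup>2) (K * (n * d) ^ K) \<sigma> \<tau> \<and>
      real (\<Sum>t=1..n. \<tau> t) \<le> real K * (real n * (real d)\<^sup>2) * (1 + ln (real n * (real d)\<^sup>2)) ^ K \<and>
      (\<forall>t\<in>{1..n}.
        selected (\<sigma> t) \<subseteq> {1..n} \<and>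
        center d (\<sigma> t) \<in> Rd d \<and>
        0 < scaling (\<sigma> t) \<and> scaling (\<sigma> t) \<le> 1 \<and>
        convex hull (z ` selected (\<sigma> t)) \<subseteq> convex hull (z ` {1..t}) \<and>
        convex hull (z ` {1..t}) \<subseteq>
          dilate (center d (\<sigma> t)) (1 / scaling (\<sigma> t)) (convex hull (z ` selected (\<sigma> t))) \<and>
        1 / scaling (\<sigma> t) \<le> real K * max 1 (real (affine_dim (z ` {1..t})) *
          ln (real (affine_dim (z ` {1..t})) * aspect_ratio d z t)) \<and>
        real (card (selected (\<sigma> t))) \<le> real K * max 1 (real (affine_dim (z ` {1..t})) *
          ln (aspect_ratio d z t)) \<and>
        (selected (\<sigma> t) = selected (\<sigma> (t - 1)) \<or>
         selected (\<sigma> t) = selected (\<sigma> (t - 1)) \<union> {t})) \<and>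
      selected (\<sigma> 0) = {} \<and>
      (\<forall>N::nat. 1 \<le> N \<longrightarrow>
        (\<forall>i\<in>{1..n}. \<forall>j<d. Poly_Mapping.lookup (z i) j \<in> \<int> \<and>
                            \<bar>Poly_Mapping.lookup (z i) j\<bar> \<le> real N) \<longrightarrow>
        (\<forall>t\<in>{1..n}.
          1 / scaling (\<sigma> t) \<le>
            real K * max 1 (real (affine_dim (z ` {1..t})) * ln (real d * real N)) \<and>
          real (card (selected (\<sigma> t))) \<le>
            real K * max 1 (real (affine_dim (z ` {1..t})) * ln (real d * real N)))))"
proof -
  \<comment> \<open>The constant 2000 of the running time also covers 30 for the sizes and 9 for the
    memory.\<close>
  obtain K :: nat where K: "2000 \<le> K" by blast
  have K30: "y \<le> 30 * max 1 w \<Longrightarrow> y \<le> real K * max 1 w" for y w :: real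
    using K by (elim order_trans) (auto intro!: mult_right_mono)
  show ?thesis
  proof (rule exI[of _ coreset_program], rule exI[of _ K], intro allI impI)
    fix d n :: nat and z :: "nat \<Rightarrow> point"
    assume d: "1 \<le> d" and n: "1 \<le> n" and z: "\<forall>i\<in>{1..n}. z i \<in> Rd d"
    let ?M = "K * d\<^sup>2" and ?W = "K * (n * d) ^ K"
    have nd: "1 \<le> n * d" using n d by simp
    have "(n * d) ^ 1 \<le> (n * d) ^ K" using nd K by (intro power_increasing) auto
    also have "\<dots> \<le> ?W" using K by simp
    finally have "n * d \<le> ?W" by simp
    moreover have "n \<le> n * d" "d \<le> n * d" using n d by simp_all
    ultimately have W: "n \<le> ?W" "d \<le> ?W" by linarith+
    have M: "9 * d\<^sup>2 \<le> ?M" using K by (intro mult_right_mono) auto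
    obtain \<sigma> \<tau> where \<sigma>0: "\<sigma> 0 = initial_state" and run_inv: "\<And>t. t \<le> n \<Longrightarrow> run_inv d z t (\<sigma> t)"
      and step: "\<And>t. t < n \<Longrightarrow> exec d (z (Suc t)) ?M ?W coreset_program (\<sigma> t) (\<tau> (Suc t)) (\<sigma> (Suc t)) \<and>
        \<tau> (Suc t) \<le> 2000 * d\<^sup>2 \<and>
        (selected (\<sigma> (Suc t)) = selected (\<sigma> t) \<or> selected (\<sigma> (Suc t)) = selected (\<sigma> t) \<union> {Suc t})"
      by (rule run_inv_run_exists[OF d W(2) M W(1), of z]) (use z in auto)
    have step': "exec d (z t) ?M ?W coreset_program (\<sigma> (t - 1)) (\<tau> t) (\<sigma> t)" "\<tau> t \<le> 2000 * d\<^sup>2"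
      "selected (\<sigma> t) = selected (\<sigma> (t - 1)) \<or> selected (\<sigma> t) = selected (\<sigma> (t - 1)) \<union> {t}"
      if "t \<in> {1..n}" for t
    proof -
      have e: "Suc (t - 1) = t" "t - 1 < n" using that by auto
      show "exec d (z t) ?M ?W coreset_program (\<sigma> (t - 1)) (\<tau> t) (\<sigma> t)" "\<tau> t \<le> 2000 * d\<^sup>2"
        "selected (\<sigma> t) = selected (\<sigma> (t - 1)) \<or> selected (\<sigma> t) = selected (\<sigma> (t - 1)) \<union> {t}"
        using step[OF e(2)] unfolding e(1) by blast+
    qed
    have pos: "0 < inner_radius d (z ` {1..i})" if "i \<in> {1..n}" for i
      using run_inv_inner_radius_pos[OF run_inv, of i] z that by simp
    note out = run_inv_output[OF run_inv _ d]
    have time: "real (\<Sum>t=1..n. \<tau> t) \<le> real K * (real n * (real d)\<^sup>2) * (1 + ln (real n * (real d)\<^sup>2)) ^ K"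
    proof -
      have "(\<Sum>t=1..n. \<tau> t) \<le> (\<Sum>t=1..n. 2000 * d\<^sup>2)"
        using step'(2) by (intro sum_mono) auto
      also have "\<dots> \<le> K * (n * d\<^sup>2)" using K by simp
      finally have "real (\<Sum>t=1..n. \<tau> t) \<le> real K * (real n * (real d)\<^sup>2)"
        by (metis of_nat_le_iff of_nat_mult of_nat_power)
      \<comment> \<open>The logarithmic factor is at least 1 because \<open>n * d\<^sup>2\<close>
        is.\<close>
      also have "\<dots> \<le> real K * (real n * (real d)\<^sup>2) * (1 + ln (real n * (real d)\<^sup>2)) ^ K"
      proof -
        have "1 \<le> real n * (real d)\<^sup>2" using n d by (simp add: mult_ge1_I)
        then have "1 \<le> (1 + ln (real n * (real d)\<^sup>2)) ^ K" by (intro one_le_power) simp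
        from mult_left_mono[OF this, of "real K * (real n * (real d)\<^sup>2)"] show ?thesis by simp
      qed
      finally show ?thesis .
    qed
    show "\<exists>\<sigma> \<tau>.
      stream_run coreset_program d z n ?M ?W \<sigma> \<tau> \<and>
      real (\<Sum>t=1..n. \<tau> t) \<le> real K * (real n * (real d)\<^sup>2) * (1 + ln (real n * (real d)\<^sup>2)) ^ K \<and>
      (\<forall>t\<in>{1..n}.
        selected (\<sigma> t) \<subseteq> {1..n} \<and>
        center d (\<sigma> t) \<in> Rd d \<and>
        0 < scaling (\<sigma> t) \<and> scaling (\<sigma> t) \<le> 1 \<and>
        convex hull (z ` selected (\<sigma> t)) \<subseteq> convex hull (z ` {1..t}) \<and>
        convex hull (z ` {1..t}) \<subseteq>
          dilate (center d (\<sigma> t)) (1 / scaling (\<sigma> t)) (convex hull (z ` selected (\<sigma> t))) \<and>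
        1 / scaling (\<sigma> t) \<le> real K * max 1 (real (affine_dim (z ` {1..t})) *
          ln (real (affine_dim (z ` {1..t})) * aspect_ratio d z t)) \<and>
        real (card (selected (\<sigma> t))) \<le> real K * max 1 (real (affine_dim (z ` {1..t})) *
          ln (aspect_ratio d z t)) \<and>
        (selected (\<sigma> t) = selected (\<sigma> (t - 1)) \<or>
         selected (\<sigma> t) = selected (\<sigma> (t - 1)) \<union> {t})) \<and>
      selected (\<sigma> 0) = {} \<and>
      (\<forall>N::nat. 1 \<le> N \<longrightarrow>
        (\<forall>i\<in>{1..n}. \<forall>j<d. Poly_Mapping.lookup (z i) j \<in> \<int> \<and>
                            \<bar>Poly_Mapping.lookup (z i) j\<bar> \<le> real N) \<longrightarrow>
        (\<forall>t\<in>{1..n}.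
          1 / scaling (\<sigma> t) \<le>
            real K * max 1 (real (affine_dim (z ` {1..t})) * ln (real d * real N)) \<and>
          real (card (selected (\<sigma> t))) \<le>
            real K * max 1 (real (affine_dim (z ` {1..t})) * ln (real d * real N))))"
    proof (rule exI[of _ \<sigma>], rule exI[of _ \<tau>], intro conjI ballI allI impI time)
      show "stream_run coreset_program d z n ?M ?W \<sigma> \<tau>"
        using \<sigma>0 step'(1) by (auto simp: stream_run_def)
      show "selected (\<sigma> 0) = {}" by (simp add: \<sigma>0 initial_state_def)
      fix t assume t: "t \<in> {1..n}"
      have prems: "t \<le> n" "1 \<le> t" "\<forall>i\<in>{1..t}. z i \<in> Rd d"
        "\<forall>i\<in>{1..t}. 0 < inner_radius d (z ` {1..i})"
        using t z pos by auto
      note o = out[OF prems]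
      show "selected (\<sigma> t) \<subseteq> {1..n}" using o(1) t by auto
      show "center d (\<sigma> t) \<in> Rd d" by (fact o(2))
      show "0 < scaling (\<sigma> t)" by (fact o(3))
      show "scaling (\<sigma> t) \<le> 1" by (fact o(4))
      show "convex hull (z ` selected (\<sigma> t)) \<subseteq> convex hull (z ` {1..t})"
        using o(1) by (intro hull_mono image_mono)
      show "convex hull (z ` {1..t}) \<subseteq>
          dilate (center d (\<sigma> t)) (1 / scaling (\<sigma> t)) (convex hull (z ` selected (\<sigma> t)))"
        by (fact o(5))
      show "1 / scaling (\<sigma> t) \<le> real K * max 1 (real (affine_dim (z ` {1..t})) *
          ln (real (affine_dim (z ` {1..t})) * aspect_ratio d z t))"
        by (rule K30[OF o(6)])
      show "real (card (selected (\<sigma> t))) \<le> real K * max 1 (real (affine_dim (z ` {1..t})) *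
          ln (aspect_ratio d z t))"
        by (rule K30[OF o(7)])
      show "selected (\<sigma> t) = selected (\<sigma> (t - 1)) \<or> selected (\<sigma> t) = selected (\<sigma> (t - 1)) \<union> {t}"
        by (rule step'(3)[OF t])
    next
      fix N t :: nat
      assume N: "1 \<le> N" and Z: "\<forall>i\<in>{1..n}. \<forall>j<d. Poly_Mapping.lookup (z i) j \<in> \<int> \<and>
                            \<bar>Poly_Mapping.lookup (z i) j\<bar> \<le> real N" and t: "t \<in> {1..n}"
      have prems: "t \<le> n" "1 \<le> t" "\<forall>i\<in>{1..t}. z i \<in> Rd d"
        "\<forall>i\<in>{1..t}. 0 < inner_radius d (z ` {1..i})"
        using t z pos by auto
      have "1 / scaling (\<sigma> t) \<le> 30 * max 1 (real (affine_dim (z ` {1..t})) * ln (real d * real N)) \<and>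
          real (card (selected (\<sigma> t))) \<le> 30 * max 1 (real (affine_dim (z ` {1..t})) * ln (real d * real N))"
        by (rule out(8)[OF prems N]) (use Z t in auto)
      then show "1 / scaling (\<sigma> t) \<le> real K * max 1 (real (affine_dim (z ` {1..t})) * ln (real d * real N))"
        "real (card (selected (\<sigma> t))) \<le> real K * max 1 (real (affine_dim (z ` {1..t})) * ln (real d * real N))"
        using K30 by blast+
    qed
  qed
qed

end
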